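(* Let $G$ and $H$ be discrete groups, let $\mathcal{A}=(A_g)_{g\in G}$ and $\mathcal{B}=(B_h)_{h\in H}$ be unital Fell bundles, let $\varphi\in \mathrm{Hom}(G,H)$, and let $T=(T_g)_{g\in G}$ be a positive definite $\mathcal{A}$-$\varphi$-$\mathcal{B}$ bundle map. Then there exist a Hilbert $\mathcal{B}$-bundle $\mathcal{X}=(X_h)_{h\in H}$, an $(\mathcal{A},\varphi)$-action $\rho$ on $\mathcal{X}$, and $\xi\in X_e$ such that \[T_g(a)=\langle \xi,\rho(a)\xi\rangle_{\mathcal{B}}\quad\text{for all } g\in G \text{ and } a\in A_g.\]
   Context: Groups are discrete and $e$ denotes the unit of any group. A Fell bundle $\mathcal{A}=(A_g)_{g\in G}$ is in the sense of Exel: Banach spaces $A_g$ with bilinear associative multiplications $A_g\times A_h\to A_{gh}$ and conjugate-linear involutions $A_g\to A_{g^{-1}}$ satisfying $\|ab\|\le\|a\|\|b\|$, $(ab)^*=b^*a^*$, $a^{**}=a$, $\|a^*a\|=\|a\|^2$ and $a^*a\ge 0$ in the $C^*$-algebra $A_e$; the symbol $\mathcal{A}$ also denotes the disjoint union of the fibres. $\mathcal{A}$ is unital if $A_e$ is unital. An $\mathcal{A}$-$\varphi$-$\mathcal{B}$ bundle map is a family $T=(T_g)_{g\in G}$ of bounded linear maps $T_g:A_g\to B_{\varphi(g)}$. It is positive definite if $\sum_{i,j=1}^n b_i\,T_{g_i^{-1}g_j}(a_i^*a_j)\,b_j^*\ge 0$ in $B_e$ for all $n\in\mathbb{N}$,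 $g_1,\dots,g_n\in G$, $a_i\in A_{g_i}$, $b_i\in B_{\varphi(g_i)}$. A Hilbert $\mathcal{B}$-bundle is a family $\mathcal{X}=(X_r)_{r\in H}$ of complex Banach spaces (also denoting their disjoint union) with maps $\mathcal{X}\times\mathcal{B}\to\mathcal{X}$, $(x,b)\mapsto xb$, and $\mathcal{X}\times\mathcal{X}\to\mathcal{B}$, $(x,y)\mapsto\langle x,y\rangle_{\mathcal{B}}$, such that: (1) $X_rB_s\subseteq X_{rs}$ and $(x,b)\mapsto xb$ is bilinear from $X_r\times B_s$ to $X_{rs}$; (2) $\langle X_r,X_s\rangle_{\mathcal{B}}\subseteq B_{r^{-1}s}$ and $y\mapsto\langle x,y\rangle_{\mathcal{B}}$ is linear on $X_s$ for each $x\in X_r$; (3) $\langle x,yb\rangle_{\mathcal{B}}=\langle x,y\rangle_{\mathcal{B}}b$ and $\langle x,y\rangle_{\mathcal{B}}^*=\langle y,x\rangle_{\mathcal{B}}$; (4) $\langle x,x\rangle_{\mathcal{B}}\ge0$ in $B_e$, and $\langle x,x\rangle_{\mathcal{B}}=0$ implies $x=0$; (5) the norm of $X_r$ satisfies $\|x\|=\|\langle x,x\rangle_{\mathcal{B}}\|^{1/2}$. For a Hilbert $\mathcal{B}$-bundle $\mathcal{X}$, let $\mathcal{F}(\mathcal{X})$ be the semigroup of all maps $\mathcal{X}\to\mathcal{X}$. An $(\mathcal{A},\varphi)$-action on $\mathcal{X}$ is a map $\rho:\mathcal{A}\to\mathcal{F}(\mathcal{X})$ such that: (i) $\rho(A_g)X_h\subseteq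 X_{\varphi(g)h}$ and $(a,x)\mapsto\rho(a)x$ is bilinear from $A_g\times X_h$ to $X_{\varphi(g)h}$; (ii) $\rho(aa')=\rho(a)\rho(a')$; (iii) $\langle\rho(a)x,y\rangle_{\mathcal{B}}=\langle x,\rho(a^* )y\rangle_{\mathcal{B}}$; (iv) $(\rho(a)x)b=\rho(a)(xb)$, for all $a,a'\in\mathcal{A}$, $x,y\in\mathcal{X}$, $b\in\mathcal{B}$. *)

theory Defs
  imports Complex_Main "HOL-Algebra.Group"
begin

definition cbanach_on ::
  "'x set \<Rightarrow> ('x \<Rightarrow> 'x \<Rightarrow> 'x) \<Rightarrow> (complex \<Rightarrow> 'x \<Rightarrow> 'x) \<Rightarrow> 'x \<Rightarrow> ('x \<Rightarrow> real) \<Rightarrow> bool"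
where
  "cbanach_on S add sm z nrm \<longleftrightarrow>
     z \<in> S \<and>
     (\<forall>x\<in>S. \<forall>y\<in>S. add x y \<in> S) \<and>
     (\<forall>c. \<forall>x\<in>S. sm c x \<in> S) \<and>
     (\<forall>x\<in>S. \<forall>y\<in>S. \<forall>w\<in>S. add (add x y) w = add x (add y w)) \<and>
     (\<forall>x\<in>S. \<forall>y\<in>S. add x y = add y x) \<and>
     (\<forall>x\<in>S. add z x = x) \<and>
     (\<forall>x\<in>S. add x (sm (-1) x) = z) \<and>
     (\<forall>x\<in>S. sm 1 x = x) \<and>
     (\<forall>c d. \<forall>x\<in>S. sm c (sm d x) = sm (c * d) x) \<and>
     (\<forall>c. \<forall>x\<in>S. \<forall>y\<in>S. sm c (add x y) = add (sm c x) (sm c y)) \<and>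
     (\<forall>c d. \<forall>x\<in>S. sm (c + d) x = add (sm c x) (sm d x)) \<and>
     (\<forall>x\<in>S. 0 \<le> nrm x) \<and>
     (\<forall>x\<in>S. nrm x = 0 \<longleftrightarrow> x = z) \<and>
     (\<forall>c. \<forall>x\<in>S. nrm (sm c x) = cmod c * nrm x) \<and>
     (\<forall>x\<in>S. \<forall>y\<in>S. nrm (add x y) \<le> nrm x + nrm y) \<and>
     (\<forall>f :: nat \<Rightarrow> 'x. (\<forall>n. f n \<in> S) \<and>
        (\<forall>\<epsilon>>0. \<exists>N. \<forall>m\<ge>N. \<forall>n\<ge>N. nrm (add (f m) (sm (-1) (f n))) < \<epsilon>)
        \<longrightarrow> (\<exists>l\<in>S. (\<lambda>n. nrm (add (f n) (sm (-1) l))) \<longlonglongrightarrow> 0))"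

definition fsum :: "('x \<Rightarrow> 'x \<Rightarrow> 'x) \<Rightarrow> 'x \<Rightarrow> (nat \<Rightarrow> 'x) \<Rightarrow> nat \<Rightarrow> 'x" where
  "fsum add z f n = foldl (\<lambda>acc i. add acc (f i)) z [0..<n]"

text \<open>The disjoint union of the fibres is a type 'a; fibre g is the set fib A g
(fibres pairwise disjoint).  Linear operations, norm, multiplication and
involution are maps on the disjoint union, as in the paper.\<close>

record ('g, 'a) fbundle =
  fib   :: "'g \<Rightarrow> 'a set"
  badd  :: "'a \<Rightarrow> 'a \<Rightarrow> 'a"
  bsm   :: "complex \<Rightarrow> 'a \<Rightarrow> 'a"
  bzero :: "'g \<Rightarrow> 'a"
  bnorm :: "'a \<Rightarrow> real"
  bmul  :: "'a \<Rightarrow> 'a \<Rightarrow> 'a"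
  bstar :: "'a \<Rightarrow> 'a"

definition pos_e :: "'g monoid \<Rightarrow> ('g, 'a) fbundle \<Rightarrow> 'a \<Rightarrow> bool" where
  "pos_e G A x \<longleftrightarrow> (\<exists>c\<in>fib A \<one>\<^bsub>G\<^esub>. x = bmul A (bstar A c) c)"

definition fell_bundle :: "'g monoid \<Rightarrow> ('g, 'a) fbundle \<Rightarrow> bool" where
  "fell_bundle G A \<longleftrightarrow>
     (\<forall>g\<in>carrier G. cbanach_on (fib A g) (badd A) (bsm A) (bzero A g) (bnorm A)) \<and>
     (\<forall>g\<in>carrier G. \<forall>h\<in>carrier G. g \<noteq> h \<longrightarrow> fib A g \<inter> fib A h = {}) \<and>
     (\<forall>g\<in>carrier G. \<forall>h\<in>carrier G. \<forall>a\<in>fib A g. \<forall>b\<in>fib A h.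
        bmul A a b \<in> fib A (g \<otimes>\<^bsub>G\<^esub> h)) \<and>
     (\<forall>g\<in>carrier G. \<forall>h\<in>carrier G. \<forall>a\<in>fib A g. \<forall>a'\<in>fib A g. \<forall>b\<in>fib A h.
        bmul A (badd A a a') b = badd A (bmul A a b) (bmul A a' b) \<and>
        bmul A b (badd A a a') = badd A (bmul A b a) (bmul A b a')) \<and>
     (\<forall>g\<in>carrier G. \<forall>h\<in>carrier G. \<forall>a\<in>fib A g. \<forall>b\<in>fib A h. \<forall>c.
        bmul A (bsm A c a) b = bsm A c (bmul A a b) \<and>
        bmul A a (bsm A c b) = bsm A c (bmul A a b)) \<and>
     (\<forall>g\<in>carrier G. \<forall>h\<in>carrier G. \<forall>k\<in>carrier G.
        \<forall>a\<in>fib A g. \<forall>b\<in>fib A h. \<forall>c\<in>fib A k.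
        bmul A (bmul A a b) c = bmul A a (bmul A b c)) \<and>
     (\<forall>g\<in>carrier G. \<forall>a\<in>fib A g. bstar A a \<in> fib A (inv\<^bsub>G\<^esub> g)) \<and>
     (\<forall>g\<in>carrier G. \<forall>a\<in>fib A g. \<forall>a'\<in>fib A g.
        bstar A (badd A a a') = badd A (bstar A a) (bstar A a')) \<and>
     (\<forall>g\<in>carrier G. \<forall>a\<in>fib A g. \<forall>c. bstar A (bsm A c a) = bsm A (cnj c) (bstar A a)) \<and>
     (\<forall>g\<in>carrier G. \<forall>h\<in>carrier G. \<forall>a\<in>fib A g. \<forall>b\<in>fib A h.
        bnorm A (bmul A a b) \<le> bnorm A a * bnorm A b \<and>
        bstar A (bmul A a b) = bmul A (bstar A b) (bstar A a)) \<and>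
     (\<forall>g\<in>carrier G. \<forall>a\<in>fib A g.
        bstar A (bstar A a) = a \<and>
        bnorm A (bmul A (bstar A a) a) = (bnorm A a)\<^sup>2 \<and>
        pos_e G A (bmul A (bstar A a) a))"

definition unital_fell_bundle :: "'g monoid \<Rightarrow> ('g, 'a) fbundle \<Rightarrow> bool" where
  "unital_fell_bundle G A \<longleftrightarrow> fell_bundle G A \<and>
     (\<exists>u\<in>fib A \<one>\<^bsub>G\<^esub>. \<forall>a\<in>fib A \<one>\<^bsub>G\<^esub>. bmul A u a = a \<and> bmul A a u = a)"

definition bundle_map ::
  "'g monoid \<Rightarrow> ('g \<Rightarrow> 'h) \<Rightarrow> ('g, 'a) fbundle \<Rightarrow> ('h, 'b) fbundle \<Rightarrow> ('a \<Rightarrow> 'b) \<Rightarrow> bool"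
where
  "bundle_map G \<phi> A B T \<longleftrightarrow>
     (\<forall>g\<in>carrier G.
        (\<forall>a\<in>fib A g. T a \<in> fib B (\<phi> g)) \<and>
        (\<forall>a\<in>fib A g. \<forall>a'\<in>fib A g. T (badd A a a') = badd B (T a) (T a')) \<and>
        (\<forall>a\<in>fib A g. \<forall>c. T (bsm A c a) = bsm B c (T a)) \<and>
        (\<exists>C. \<forall>a\<in>fib A g. bnorm B (T a) \<le> C * bnorm A a))"

definition positive_definite ::
  "'g monoid \<Rightarrow> 'h monoid \<Rightarrow> ('g \<Rightarrow> 'h) \<Rightarrow> ('g, 'a) fbundle \<Rightarrow> ('h, 'b) fbundle \<Rightarrow> ('a \<Rightarrow> 'b) \<Rightarrow> bool"
where
  "positive_definite G H \<phi> A B T \<longleftrightarrow>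
     (\<forall>n::nat. \<forall>gs as bs.
        (\<forall>i<n. gs i \<in> carrier G \<and> as i \<in> fib A (gs i) \<and> bs i \<in> fib B (\<phi> (gs i))) \<longrightarrow>
        pos_e H B
          (fsum (badd B) (bzero B \<one>\<^bsub>H\<^esub>)
             (\<lambda>i. fsum (badd B) (bzero B \<one>\<^bsub>H\<^esub>)
                (\<lambda>j. bmul B (bmul B (bs i) (T (bmul A (bstar A (as i)) (as j)))) (bstar B (bs j)))
                n)
             n))"

record ('h, 'x, 'b) hbundle =
  hfib  :: "'h \<Rightarrow> 'x set"
  hadd  :: "'x \<Rightarrow> 'x \<Rightarrow> 'x"
  hsm   :: "complex \<Rightarrow> 'x \<Rightarrow> 'x"
  hzero :: "'h \<Rightarrow> 'x"
  rmul  :: "'x \<Rightarrow> 'b \<Rightarrow> 'x"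
  ip    :: "'x \<Rightarrow> 'x \<Rightarrow> 'b"

definition hilbert_bundle :: "'h monoid \<Rightarrow> ('h, 'b) fbundle \<Rightarrow> ('h, 'x, 'b) hbundle \<Rightarrow> bool" where
  "hilbert_bundle H B X \<longleftrightarrow>
     \<comment> \<open>fibres are complex Banach spaces, with norm as in (5)\<close>
     (\<forall>r\<in>carrier H. cbanach_on (hfib X r) (hadd X) (hsm X) (hzero X r)
                      (\<lambda>x. sqrt (bnorm B (ip X x x)))) \<and>
     (\<forall>r\<in>carrier H. \<forall>s\<in>carrier H. r \<noteq> s \<longrightarrow> hfib X r \<inter> hfib X s = {}) \<and>
     \<comment> \<open>(1)\<close>
     (\<forall>r\<in>carrier H. \<forall>s\<in>carrier H. \<forall>x\<in>hfib X r. \<forall>b\<in>fib B s.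
        rmul X x b \<in> hfib X (r \<otimes>\<^bsub>H\<^esub> s)) \<and>
     (\<forall>r\<in>carrier H. \<forall>s\<in>carrier H. \<forall>x\<in>hfib X r. \<forall>x'\<in>hfib X r. \<forall>b\<in>fib B s. \<forall>b'\<in>fib B s. \<forall>c.
        rmul X (hadd X x x') b = hadd X (rmul X x b) (rmul X x' b) \<and>
        rmul X x (badd B b b') = hadd X (rmul X x b) (rmul X x b') \<and>
        rmul X (hsm X c x) b = hsm X c (rmul X x b) \<and>
        rmul X x (bsm B c b) = hsm X c (rmul X x b)) \<and>
     \<comment> \<open>(2)\<close>
     (\<forall>r\<in>carrier H. \<forall>s\<in>carrier H. \<forall>x\<in>hfib X r. \<forall>y\<in>hfib X s.
        ip X x y \<in> fib B (inv\<^bsub>H\<^esub> r \<otimes>\<^bsub>H\<^esub> s)) \<and>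
     (\<forall>r\<in>carrier H. \<forall>s\<in>carrier H. \<forall>x\<in>hfib X r. \<forall>y\<in>hfib X s. \<forall>y'\<in>hfib X s. \<forall>c.
        ip X x (hadd X y y') = badd B (ip X x y) (ip X x y') \<and>
        ip X x (hsm X c y) = bsm B c (ip X x y)) \<and>
     \<comment> \<open>(3)\<close>
     (\<forall>r\<in>carrier H. \<forall>s\<in>carrier H. \<forall>t\<in>carrier H. \<forall>x\<in>hfib X r. \<forall>y\<in>hfib X s. \<forall>b\<in>fib B t.
        ip X x (rmul X y b) = bmul B (ip X x y) b) \<and>
     (\<forall>r\<in>carrier H. \<forall>s\<in>carrier H. \<forall>x\<in>hfib X r. \<forall>y\<in>hfib X s.
        bstar B (ip X x y) = ip X y x) \<and>
     \<comment> \<open>(4)\<close>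
     (\<forall>r\<in>carrier H. \<forall>x\<in>hfib X r.
        pos_e H B (ip X x x) \<and> (ip X x x = bzero B \<one>\<^bsub>H\<^esub> \<longrightarrow> x = hzero X r))"

definition bundle_action ::
  "'g monoid \<Rightarrow> 'h monoid \<Rightarrow> ('g \<Rightarrow> 'h) \<Rightarrow> ('g, 'a) fbundle \<Rightarrow> ('h, 'b) fbundle \<Rightarrow>
   ('h, 'x, 'b) hbundle \<Rightarrow> ('a \<Rightarrow> 'x \<Rightarrow> 'x) \<Rightarrow> bool"
where
  "bundle_action G H \<phi> A B X \<rho> \<longleftrightarrow>
     \<comment> \<open>(i)\<close>
     (\<forall>g\<in>carrier G. \<forall>h\<in>carrier H. \<forall>a\<in>fib A g. \<forall>x\<in>hfib X h.
        \<rho> a x \<in> hfib X (\<phi> g \<otimes>\<^bsub>H\<^esub> h)) \<and>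
     (\<forall>g\<in>carrier G. \<forall>h\<in>carrier H. \<forall>a\<in>fib A g. \<forall>a'\<in>fib A g. \<forall>x\<in>hfib X h. \<forall>x'\<in>hfib X h. \<forall>c.
        \<rho> (badd A a a') x = hadd X (\<rho> a x) (\<rho> a' x) \<and>
        \<rho> a (hadd X x x') = hadd X (\<rho> a x) (\<rho> a x') \<and>
        \<rho> (bsm A c a) x = hsm X c (\<rho> a x) \<and>
        \<rho> a (hsm X c x) = hsm X c (\<rho> a x)) \<and>
     \<comment> \<open>(ii)\<close>
     (\<forall>g\<in>carrier G. \<forall>g'\<in>carrier G. \<forall>h\<in>carrier H. \<forall>a\<in>fib A g. \<forall>a'\<in>fib A g'. \<forall>x\<in>hfib X h.
        \<rho> (bmul A a a') x = \<rho> a (\<rho> a' x)) \<and>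
     \<comment> \<open>(iii)\<close>
     (\<forall>g\<in>carrier G. \<forall>h\<in>carrier H. \<forall>k\<in>carrier H. \<forall>a\<in>fib A g. \<forall>x\<in>hfib X h. \<forall>y\<in>hfib X k.
        ip X (\<rho> a x) y = ip X x (\<rho> (bstar A a) y)) \<and>
     \<comment> \<open>(iv)\<close>
     (\<forall>g\<in>carrier G. \<forall>h\<in>carrier H. \<forall>s\<in>carrier H. \<forall>a\<in>fib A g. \<forall>x\<in>hfib X h. \<forall>b\<in>fib B s.
        rmul X (\<rho> a x) b = \<rho> a (rmul X x b))"

end

theory Submission
  imports Defs
begin

text \<open>On the formal tensors \<open>a \<otimes> b\<close> put \<open>\<langle>a \<otimes> b, a' \<otimes> b'\<rangle> = b\<^sup>* T(a\<^sup>*a') b'\<close>, where \<open>a \<otimes> b\<close> has degree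
  \<open>\<phi>(g) h\<close> for \<open>a\<close> of degree \<open>g\<close> and \<open>b\<close> of degree \<open>h\<close>; the bundle \<open>\<X>\<close> is the completion,
  \<open>\<A>\<close> acts on the first factor, and \<open>\<xi> = 1 \<otimes> 1\<close>. Positive definiteness gives
  \<open>\<langle>x, x\<rangle> \<ge> 0\<close> only for \<open>x\<close> of degree \<open>\<one>\<close>, and the fibres of \<open>\<B>\<close> may be too small
  to transport this to the other degrees. It is extended by induction on the number of summands of
  \<open>x = \<Sum> a\<^sub>i \<otimes> b\<^sub>i\<close>. The Gram matrix \<open>(a\<^sub>i\<^sup>*a\<^sub>j)\<close> is a limit of sums of matrices \<open>(c\<^sub>i\<^sup>*c\<^sub>j)\<close> with
  \<open>c\<^sub>i = a\<^sub>l\<^sup>*z a\<^sub>i\<close>, in which \<open>c\<^sub>l\<close> lies in the unit fibre. In that case \<open>n b\<^sub>l\<^sup>*\<close> multiplies \<open>x\<close> into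
  degree \<open>\<one>\<close>, where \<open>n\<close> is the negative part of \<open>y = \<langle>x, x\<rangle>\<close>, which forces \<open>n b\<^sub>l\<^sup>* = 0\<close>; so
  \<open>n y n\<close> does not involve the \<open>l\<close>-th summand, is nonnegative by induction, and \<open>n = 0\<close>.\<close>

section \<open>Banach spaces given by a carrier set\<close>

text \<open>For x of degree r, a right factor b of degree inverse to r only yields b^* <x, x> b >=
  0, which is void if that fibre of B is zero. A summand c \<otimes> b with c of degree e helps
  because b itself has degree r, so that n b^* is such a factor. With n = |y| - y and p^2 = |y| one
  has n y n = -(p n)^* (p n) and n^2 = 2 p^2 n. Hence the compression of y by n b^* is at once
  nonnegative and equal to -w^* w for w = p n b^*; so w = 0, then n^2 b^* = 2 p w = 0 and n b^* = 0.
  The same two identities turn n y n >= 0 into n = 0. To decompose the Gram matrix, let q be a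
  multiple of the sum of all a_l a_l^* with norm at most 1, and s = sqrt(1 - q). The unit is the sum
  of s^m q s^m over m < k plus s^(2k). The first terms insert the a_l a_l^*; the last one enters
  only through the products s^k a_i, whose norms tend to 0. Thus no functional calculus beyond
  square roots occurs; these come from an iteration, and positivity of a self-adjoint h is tested by
  ||t - h|| <= t.\<close>

lemma LIMSEQ_one_over: "(\<lambda>n. 1 / (real n + 1)) \<longlonglongrightarrow> 0"
  using LIMSEQ_inverse_real_of_nat by (simp add: inverse_eq_divide add.commute)

locale cvec =
  fixes S :: "'x set" and add :: "'x \<Rightarrow> 'x \<Rightarrow> 'x" (infixl "\<boxplus>" 65)
    and sm :: "complex \<Rightarrow> 'x \<Rightarrow> 'x" (infixr "\<odot>" 75) and z :: 'x and nrm :: "'x \<Rightarrow> real"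
  assumes cbanach: "cbanach_on S (\<boxplus>) (\<odot>) z nrm"
begin

abbreviation minus_vec (infixl "\<boxminus>" 65) where "x \<boxminus> y \<equiv> x \<boxplus> (-1) \<odot> y"

lemma zero_closed [simp]: "z \<in> S"
  and add_closed [simp]: "x \<in> S \<Longrightarrow> y \<in> S \<Longrightarrow> x \<boxplus> y \<in> S"
  and sm_closed [simp]: "x \<in> S \<Longrightarrow> c \<odot> x \<in> S"
  and add_assoc: "x \<in> S \<Longrightarrow> y \<in> S \<Longrightarrow> w \<in> S \<Longrightarrow> (x \<boxplus> y) \<boxplus> w = x \<boxplus> (y \<boxplus> w)"
  and add_commute: "x \<in> S \<Longrightarrow> y \<in> S \<Longrightarrow> x \<boxplus> y = y \<boxplus> x"
  and zero_add [simp]: "x \<in> S \<Longrightarrow> z \<boxplus> x = x"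
  and diff_self [simp]: "x \<in> S \<Longrightarrow> x \<boxminus> x = z"
  and sm_one [simp]: "x \<in> S \<Longrightarrow> 1 \<odot> x = x"
  and sm_sm: "x \<in> S \<Longrightarrow> c \<odot> (d \<odot> x) = (c * d) \<odot> x"
  and sm_add: "x \<in> S \<Longrightarrow> y \<in> S \<Longrightarrow> c \<odot> (x \<boxplus> y) = c \<odot> x \<boxplus> c \<odot> y"
  and add_sm: "x \<in> S \<Longrightarrow> (c + d) \<odot> x = c \<odot> x \<boxplus> d \<odot> x"
  and nrm_ge_0 [simp]: "x \<in> S \<Longrightarrow> 0 \<le> nrm x"
  and nrm_eq_0 [simp]: "x \<in> S \<Longrightarrow> nrm x = 0 \<longleftrightarrow> x = z"
  and nrm_sm [simp]: "x \<in> S \<Longrightarrow> nrm (c \<odot> x) = cmod c * nrm x"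
  and nrm_add: "x \<in> S \<Longrightarrow> y \<in> S \<Longrightarrow> nrm (x \<boxplus> y) \<le> nrm x + nrm y"
  using cbanach unfolding cbanach_on_def by ((elim conjE, simp)+)

lemma complete:
  assumes "\<And>n. f n \<in> S"
    and "\<And>e. e > 0 \<Longrightarrow> \<exists>N::nat. \<forall>m\<ge>N. \<forall>n\<ge>N. nrm (f m \<boxminus> f n) < e"
  shows "\<exists>l\<in>S. (\<lambda>n. nrm (f n \<boxminus> l)) \<longlonglongrightarrow> 0"
proof -
  have "(\<forall>n. f n \<in> S) \<and> (\<forall>e>0. \<exists>N. \<forall>m\<ge>N. \<forall>n\<ge>N. nrm (f m \<boxminus> f n) < e)"
    using assms by blast
  then show ?thesis using cbanach unfolding cbanach_on_def by (elim conjE, elim allE[of _ f], elim mp) simp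
qed

lemma add_zero [simp]: "x \<in> S \<Longrightarrow> x \<boxplus> z = x"
  by (metis add_commute zero_add zero_closed)

lemma add_left_commute:
  "x \<in> S \<Longrightarrow> y \<in> S \<Longrightarrow> w \<in> S \<Longrightarrow> x \<boxplus> (y \<boxplus> w) = y \<boxplus> (x \<boxplus> w)"
  by (metis add_assoc add_commute)

lemma sm_zero_left [simp]: "x \<in> S \<Longrightarrow> 0 \<odot> x = z"
  using nrm_eq_0[of "0 \<odot> x"] by simp

lemma sm_zero_right [simp]: "c \<odot> z = z"
  using nrm_eq_0[of "c \<odot> z"] by simp

section \<open>Formal linear combinations\<close>

fun lc :: "(complex \<times> 'x) list \<Rightarrow> 'x" where
  "lc [] = z"
| "lc ((c, v) # xs) = c \<odot> v \<boxplus> lc xs"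

text \<open>The value of a formal combination under the linear extension of \<open>\<delta>\<close>
  to the free vector space on the atoms. As \<open>\<delta>\<close> varies, agreement of all these
  values is equality in the free space.\<close>

fun lcs :: "('x \<Rightarrow> complex) \<Rightarrow> (complex \<times> 'x) list \<Rightarrow> complex" where
  "lcs \<delta> [] = 0"
| "lcs \<delta> ((c, v) # xs) = c * \<delta> v + lcs \<delta> xs"

definition rp :: "'x \<Rightarrow> (complex \<times> 'x) list \<Rightarrow> bool" where
  "rp x xs \<longleftrightarrow> snd ` set xs \<subseteq> S \<and> x = lc xs"

lemma lc_closed [simp]: "snd ` set xs \<subseteq> S \<Longrightarrow> lc xs \<in> S"
  by (induction xs rule: lc.induct) auto

lemma lc_append: "snd ` set xs \<subseteq> S \<Longrightarrow> snd ` set ys \<subseteq> S \<Longrightarrow> lc (xs @ ys) = lc xs \<boxplus> lc ys"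
  by (induction xs rule: lc.induct) (auto simp: add_assoc)

lemma lc_sm: "snd ` set xs \<subseteq> S \<Longrightarrow> c \<odot> lc xs = lc (map (\<lambda>(d, v). (c * d, v)) xs)"
  by (induction xs rule: lc.induct) (auto simp: sm_add sm_sm)

lemma lcs_append [simp]: "lcs \<delta> (xs @ ys) = lcs \<delta> xs + lcs \<delta> ys"
  by (induction xs rule: lc.induct) auto

lemma lcs_sm [simp]: "lcs \<delta> (map (\<lambda>(d, v). (c * d, v)) xs) = c * lcs \<delta> xs"
  by (induction xs rule: lc.induct) (auto simp: algebra_simps)

lemma lc_filter:
  assumes "snd ` set xs \<subseteq> S" "v \<in> S"
  shows "lc xs = lcs (\<lambda>w. of_bool (w = v)) xs \<odot> v \<boxplus> lc (filter (\<lambda>p. snd p \<noteq> v) xs)"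
  using assms(1)
proof (induction xs rule: lc.induct)
  case (2 c w xs)
  have m: "snd ` set (filter (\<lambda>p. snd p \<noteq> v) xs) \<subseteq> S" "w \<in> S" using 2 by auto
  show ?case
  proof (cases "w = v")
    case True
    then show ?thesis using 2 m by (simp add: add_sm add_assoc)
  next
    case False
    then show ?thesis using 2 m \<open>v \<in> S\<close> by (simp add: add_left_commute[of "c \<odot> w"])
  qed
qed (use assms in simp)

lemma lcs_filter: "lcs \<delta> (filter (\<lambda>p. snd p \<noteq> v) xs) = lcs (\<delta>(v := 0)) xs"
  by (induction xs rule: lc.induct) auto

text \<open>All occurrences of the first vector v are collected: the indicator function of v shows
  that their coefficients add up to 0. The remaining combination is shorter and still vanishes under
  every function, as one sees by resetting the function to 0 at v.\<close>

lemma lc_eq_zero: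
  assumes "snd ` set xs \<subseteq> S" "\<And>\<delta>. lcs \<delta> xs = 0"
  shows "lc xs = z"
  using assms
proof (induction "length xs" arbitrary: xs rule: less_induct)
  case less
  show ?case
  proof (cases xs)
    case (Cons p ys)
    let ?f = "filter (\<lambda>q. snd q \<noteq> snd p) xs"
    have "length ?f < length xs" by (simp add: Cons less_Suc_eq_le)
    moreover have "snd ` set ?f \<subseteq> S" using less.prems by auto
    ultimately have "lc ?f = z" using less.hyps less.prems(2) by (simp add: lcs_filter)
    moreover have "snd p \<in> S" using less.prems Cons by auto
    ultimately show ?thesis using lc_filter[OF less.prems(1), of "snd p"] less.prems(2) by simp
  qed simp
qed

text \<open>Linear identities are decided by reflection: both sides are turned into formal linear
  combinations by the rules \<open>rp_rules\<close>, whose equality is then an identity of complex numbers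
  involving an arbitrary function \<open>\<delta>\<close> of the atoms.\<close>

lemma vec_eqI:
  assumes "rp x xs" "rp y ys" "\<And>\<delta>. lcs \<delta> xs = lcs \<delta> ys"
  shows "x = y"
proof -
  have s: "snd ` set xs \<subseteq> S" "snd ` set ys \<subseteq> S" "x = lc xs" "y = lc ys"
    using assms by (auto simp: rp_def)
  let ?n = "map (\<lambda>(d, v). (-1 * d, v)) ys"
  have sn: "snd ` set ?n \<subseteq> S" using s by auto
  have xy: "x \<in> S" "y \<in> S" using s by auto
  have "lc (xs @ ?n) = z"
    by (rule lc_eq_zero) (use s sn assms(3) lcs_sm[of _ "-1" ys] in \<open>auto simp del: lcs_sm mult_minus1\<close>)
  then have "x \<boxminus> y = z" using s sn by (simp add: lc_append lc_sm del: mult_minus1)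
  then have "x \<boxminus> y \<boxplus> y = y" using xy by simp
  then show ?thesis using xy by (metis add_assoc add_commute add_zero diff_self sm_closed)
qed

lemma rp_add: "rp x xs \<Longrightarrow> rp y ys \<Longrightarrow> rp (x \<boxplus> y) (xs @ ys)"
  by (auto simp: rp_def lc_append)

lemma rp_sm: "rp x xs \<Longrightarrow> rp (c \<odot> x) (map (\<lambda>(d, v). (c * d, v)) xs)"
  by (auto simp: rp_def lc_sm)

lemma rp_zero: "rp z []"
  by (simp add: rp_def)

lemma rp_atom: "x \<in> S \<Longrightarrow> rp x [(1, x)]"
  by (simp add: rp_def)

lemmas rp_rules = rp_add rp_sm rp_zero rp_atom

lemma nrm_zero [simp]: "nrm z = 0"
  by simp

lemma eq_if_diff_zero: "x \<in> S \<Longrightarrow> y \<in> S \<Longrightarrow> x \<boxminus> y = z \<Longrightarrow> x = y"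
  by (metis add_assoc add_commute add_zero diff_self sm_closed zero_add)

lemma nrm_minus_commute: "x \<in> S \<Longrightarrow> y \<in> S \<Longrightarrow> nrm (x \<boxminus> y) = nrm (y \<boxminus> x)"
proof -
  assume xy: "x \<in> S" "y \<in> S"
  have "x \<boxminus> y = (-1) \<odot> (y \<boxminus> x)"
    by (rule vec_eqI, (rule rp_rules | simp add: xy)+)
  then show ?thesis using xy by simp
qed

lemma nrm_diff_triangle:
  assumes "x \<in> S" "y \<in> S" "w \<in> S"
  shows "nrm (x \<boxminus> w) \<le> nrm (x \<boxminus> y) + nrm (y \<boxminus> w)"
proof -
  have "x \<boxminus> w = (x \<boxminus> y) \<boxplus> (y \<boxminus> w)"
    by (rule vec_eqI, (rule rp_rules | simp add: assms)+)
  then show ?thesis using assms nrm_add[of "x \<boxminus> y" "y \<boxminus> w"] by simp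
qed

lemma nrm_le_diff: "x \<in> S \<Longrightarrow> y \<in> S \<Longrightarrow> nrm x \<le> nrm y + nrm (x \<boxminus> y)"
  using nrm_diff_triangle[of x y z] by simp

text \<open>The range e <= 1 matches estimates such as \<open>fip_lip_limit\<close>, whose constant
  is uniform only there.\<close>

lemma eq_if_nrm_small:
  assumes "x \<in> S" "y \<in> S" "\<And>e. e > 0 \<Longrightarrow> e \<le> 1 \<Longrightarrow> nrm (x \<boxminus> y) \<le> c * e"
  shows "x = y"
proof (rule eq_if_diff_zero)
  have "nrm (x \<boxminus> y) \<le> 0 + e" if "e > 0" for e
  proof -
    \<comment> \<open>The denominator exceeds the modulus of c, so that c times this value is at
      most e, also for c = 0.\<close>
    let ?d = "min (e / (\<bar>c\<bar> + 1)) 1"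
    have "nrm (x \<boxminus> y) \<le> c * ?d" using assms(3)[of ?d] that by simp
    also have "\<dots> \<le> \<bar>c\<bar> * (e / (\<bar>c\<bar> + 1))" using that by (intro mult_mono) auto
    also have "\<dots> \<le> e" using that by (simp add: field_simps)
    finally show ?thesis by simp
  qed
  then have "nrm (x \<boxminus> y) \<le> 0" by (rule field_le_epsilon)
  then have "nrm (x \<boxminus> y) = 0" using assms by (intro order.antisym nrm_ge_0) auto
  then show "x \<boxminus> y = z" using assms by simp
qed (use assms in auto)

section \<open>Convergence in norm\<close>

definition conv :: "(nat \<Rightarrow> 'x) \<Rightarrow> 'x \<Rightarrow> bool" where
  "conv f l \<longleftrightarrow> (\<forall>n. f n \<in> S) \<and> l \<in> S \<and> (\<lambda>n. nrm (f n \<boxminus> l)) \<longlonglongrightarrow> 0"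

lemma convD: "conv f l \<Longrightarrow> f n \<in> S" "conv f l \<Longrightarrow> l \<in> S"
    "conv f l \<Longrightarrow> (\<lambda>n. nrm (f n \<boxminus> l)) \<longlonglongrightarrow> 0"
  by (auto simp: conv_def)

lemma conv_bound:
  assumes "\<And>n. f n \<in> S" "l \<in> S" "\<And>n. nrm (f n \<boxminus> l) \<le> e n" "e \<longlonglongrightarrow> 0"
  shows "conv f l"
proof -
  have "(\<lambda>n. nrm (f n \<boxminus> l)) \<longlonglongrightarrow> 0"
    by (rule real_tendsto_sandwich[where f = "\<lambda>_. 0" and h = e]) (use assms in auto)
  then show ?thesis using assms by (simp add: conv_def)
qed

lemma conv_unique:
  assumes "conv f l" "conv f k"
  shows "l = k"
proof (rule eq_if_diff_zero)
  note a = convD(1,2)[OF assms(1)] convD(1,2)[OF assms(2)]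
  show "l \<in> S" "k \<in> S" by (fact a)+
  have le: "nrm (l \<boxminus> k) \<le> nrm (f n \<boxminus> l) + nrm (f n \<boxminus> k)" for n
    using nrm_diff_triangle[of l "f n" k] nrm_minus_commute[of l "f n"] a by simp
  have "(\<lambda>n. nrm (f n \<boxminus> l) + nrm (f n \<boxminus> k)) \<longlonglongrightarrow> 0"
    using tendsto_add_zero[OF convD(3)[OF assms(1)] convD(3)[OF assms(2)]] .
  from LIMSEQ_le_const[OF this, of "nrm (l \<boxminus> k)"] le have "nrm (l \<boxminus> k) \<le> 0" by blast
  moreover have "l \<boxminus> k \<in> S" using a by simp
  ultimately have "nrm (l \<boxminus> k) = 0" by (intro order.antisym nrm_ge_0)
  then show "l \<boxminus> k = z" using \<open>l \<boxminus> k \<in> S\<close> by (simp only: nrm_eq_0)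
qed

lemma conv_const: "x \<in> S \<Longrightarrow> conv (\<lambda>_. x) x"
  by (simp add: conv_def)

lemma conv_add: 
  assumes "conv f l" "conv g k"
  shows "conv (\<lambda>n. f n \<boxplus> g n) (l \<boxplus> k)"
proof (rule conv_bound)
  note a = convD[OF assms(1)] convD[OF assms(2)]
  have "(f n \<boxplus> g n) \<boxminus> (l \<boxplus> k) = (f n \<boxminus> l) \<boxplus> (g n \<boxminus> k)" for n
    by (rule vec_eqI, (rule rp_rules | simp add: a)+)
  then show "nrm ((f n \<boxplus> g n) \<boxminus> (l \<boxplus> k)) \<le> nrm (f n \<boxminus> l) + nrm (g n \<boxminus> k)" for n
    using nrm_add[of "f n \<boxminus> l" "g n \<boxminus> k"] a(1,2,4,5) by simp
  show "(\<lambda>n. nrm (f n \<boxminus> l) + nrm (g n \<boxminus> k)) \<longlonglongrightarrow> 0"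
    using tendsto_add_zero[OF a(3) a(6)] .
qed (simp_all add: convD(1,2)[OF assms(1)] convD(1,2)[OF assms(2)])

lemma conv_sm: 
  assumes "conv f l"
  shows "conv (\<lambda>n. c \<odot> f n) (c \<odot> l)"
proof (rule conv_bound)
  note a = convD[OF assms(1)]
  have "c \<odot> f n \<boxminus> c \<odot> l = c \<odot> (f n \<boxminus> l)" for n
    by (rule vec_eqI, (rule rp_rules | simp add: a algebra_simps)+)
  then show "nrm (c \<odot> f n \<boxminus> c \<odot> l) \<le> cmod c * nrm (f n \<boxminus> l)" for n
    using a(1,2) by simp
  show "(\<lambda>n. cmod c * nrm (f n \<boxminus> l)) \<longlonglongrightarrow> 0"
    using tendsto_mult_right_zero[OF a(3)] .
qed (simp_all add: convD(1,2)[OF assms(1)])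

lemma conv_Suc: "conv f l \<Longrightarrow> conv (\<lambda>n. f (Suc n)) l"
  unfolding conv_def by (use LIMSEQ_Suc[of "\<lambda>n. nrm (f n \<boxminus> l)"] in auto)

lemma nrm_limit_le:
  assumes "conv f l" "\<And>n. nrm (f n) \<le> b n" "b \<longlonglongrightarrow> c"
  shows "nrm l \<le> c"
proof -
  note a = convD(1,2)[OF assms(1)]
  have le: "nrm l \<le> b n + nrm (f n \<boxminus> l)" for n
    using nrm_le_diff[of l "f n"] nrm_minus_commute[of l "f n"] a assms(2)[of n] by simp
  have "(\<lambda>n. b n + nrm (f n \<boxminus> l)) \<longlonglongrightarrow> c"
    using tendsto_add[OF assms(3) convD(3)[OF assms(1)]] by simp
  from LIMSEQ_le_const[OF this, of "nrm l"] le show ?thesis by blast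
qed

end

section \<open>Unital C*-algebras given by a carrier set\<close>

locale ucstar = cvec S add sm z nrm
  for S :: "'x set" and add (infixl "\<boxplus>" 65) and sm (infixr "\<odot>" 75) and z and nrm +
  fixes mul :: "'x \<Rightarrow> 'x \<Rightarrow> 'x" (infixl "\<star>" 70) and star :: "'x \<Rightarrow> 'x" and u :: 'x
  assumes mul_closed [simp]: "x \<in> S \<Longrightarrow> y \<in> S \<Longrightarrow> x \<star> y \<in> S"
    and star_closed [simp]: "x \<in> S \<Longrightarrow> star x \<in> S"
    and unit_closed [simp]: "u \<in> S"
    and mul_assoc: "x \<in> S \<Longrightarrow> y \<in> S \<Longrightarrow> w \<in> S \<Longrightarrow> (x \<star> y) \<star> w = x \<star> (y \<star> w)"
    and add_mul: "x \<in> S \<Longrightarrow> y \<in> S \<Longrightarrow> w \<in> S \<Longrightarrow> (x \<boxplus> y) \<star> w = x \<star> w \<boxplus> y \<star> w"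
    and mul_add: "x \<in> S \<Longrightarrow> y \<in> S \<Longrightarrow> w \<in> S \<Longrightarrow> w \<star> (x \<boxplus> y) = w \<star> x \<boxplus> w \<star> y"
    and sm_mul: "x \<in> S \<Longrightarrow> y \<in> S \<Longrightarrow> (c \<odot> x) \<star> y = c \<odot> (x \<star> y)"
    and mul_sm: "x \<in> S \<Longrightarrow> y \<in> S \<Longrightarrow> x \<star> (c \<odot> y) = c \<odot> (x \<star> y)"
    and unit_mul [simp]: "x \<in> S \<Longrightarrow> u \<star> x = x"
    and mul_unit [simp]: "x \<in> S \<Longrightarrow> x \<star> u = x"
    and star_add [simp]: "x \<in> S \<Longrightarrow> y \<in> S \<Longrightarrow> star (x \<boxplus> y) = star x \<boxplus> star y"
    and star_sm [simp]: "x \<in> S \<Longrightarrow> star (c \<odot> x) = cnj c \<odot> star x"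
    and star_mul [simp]: "x \<in> S \<Longrightarrow> y \<in> S \<Longrightarrow> star (x \<star> y) = star y \<star> star x"
    and star_star [simp]: "x \<in> S \<Longrightarrow> star (star x) = x"
    and nrm_mul: "x \<in> S \<Longrightarrow> y \<in> S \<Longrightarrow> nrm (x \<star> y) \<le> nrm x * nrm y"
    and cstar_identity: "x \<in> S \<Longrightarrow> nrm (star x \<star> x) = (nrm x)\<^sup>2"
begin

lemmas expand = mul_assoc add_mul mul_add sm_mul mul_sm

lemma mul_zero [simp]: "x \<in> S \<Longrightarrow> x \<star> z = z"
  using mul_sm[of x z 0] by simp

lemma zero_mul [simp]: "x \<in> S \<Longrightarrow> z \<star> x = z"
  using sm_mul[of z x 0] by simp

lemma star_zero [simp]: "star z = z"
  using star_sm[of z 0] by simp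

lemma star_unit [simp]: "star u = u"
  using star_mul[of "star u" u] by simp

lemma nrm_star [simp]:
  assumes "x \<in> S" shows "nrm (star x) = nrm x"
proof -
  have le: "nrm y \<le> nrm (star y)" if "y \<in> S" for y
  proof -
    have "nrm y * nrm y \<le> nrm (star y) * nrm y"
      using cstar_identity[of y] nrm_mul[of "star y" y] that by (simp add: power2_eq_square)
    moreover have "0 \<le> nrm y" "0 \<le> nrm (star y)" using that by simp_all
    ultimately show ?thesis by (metis mult_right_le_imp_le order_le_less)
  qed
  show ?thesis using le[of x] le[of "star x"] assms by simp
qed

text \<open>The C*-identity gives ||u|| = ||u||^2. Equality with 1 cannot be claimed, because the
  algebra may be zero.\<close>

lemma nrm_unit_le: "nrm u \<le> 1"
proof -
  have "nrm u = nrm u * nrm u" using cstar_identity[of u] by (simp add: power2_eq_square)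
  then show ?thesis by (metis linorder_not_le mult_cancel_right1 nrm_ge_0 order_less_le unit_closed
      mult_eq_self_implies_10 zero_le_one zero_less_one le_less)
qed

lemma nrm_square:
  "x \<in> S \<Longrightarrow> star x = x \<Longrightarrow> nrm (x \<star> x) = (nrm x)\<^sup>2"
  using cstar_identity[of x] by simp

lemma conv_mul:
  assumes "conv f l" "conv g k"
  shows "conv (\<lambda>n. f n \<star> g n) (l \<star> k)"
proof (rule conv_bound)
  note a = convD(1,2)[OF assms(1)] convD(1,2)[OF assms(2)]
  have eq: "f n \<star> g n \<boxminus> l \<star> k =
      (f n \<boxminus> l) \<star> (g n \<boxminus> k) \<boxplus> ((f n \<boxminus> l) \<star> k \<boxplus> l \<star> (g n \<boxminus> k))" for n
    by (simp add: a expand, rule vec_eqI, (rule rp_rules | simp add: a)+)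
  show "nrm (f n \<star> g n \<boxminus> l \<star> k) \<le> nrm (f n \<boxminus> l) * nrm (g n \<boxminus> k) +
      (nrm (f n \<boxminus> l) * nrm k + nrm l * nrm (g n \<boxminus> k))" for n
    unfolding eq by (intro order.trans[OF nrm_add] add_mono nrm_mul) (simp_all add: a)
  note t = convD(3)[OF assms(1)] convD(3)[OF assms(2)]
  show "(\<lambda>n. nrm (f n \<boxminus> l) * nrm (g n \<boxminus> k) +
      (nrm (f n \<boxminus> l) * nrm k + nrm l * nrm (g n \<boxminus> k))) \<longlonglongrightarrow> 0"
    by (intro tendsto_add_zero tendsto_mult_zero tendsto_mult_left_zero tendsto_mult_right_zero t)
qed (simp_all add: convD(1,2)[OF assms(1)] convD(1,2)[OF assms(2)])

lemma conv_star:
  assumes "conv f l" shows "conv (\<lambda>n. star (f n)) (star l)"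
proof (rule conv_bound)
  note a = convD(1,2)[OF assms(1)]
  show "nrm (star (f n) \<boxminus> star l) \<le> nrm (f n \<boxminus> l)" for n
    using a nrm_star[of "f n \<boxminus> l"] by simp
qed (simp_all add: convD[OF assms(1)])

section \<open>Square roots by iteration\<close>

text \<open>The iteration \<open>y\<^sub>0 = 0\<close>, \<open>y\<^sub>n\<^sub>+\<^sub>1 = (x + y\<^sub>n\<^sup>2) / 2\<close> converges to \<open>1 - \<surd>(1 - x)\<close>. Its increments
  are dominated by those of the scalar iteration with \<open>x = 1\<close>.\<close>

primrec sqrt_iter :: "'x \<Rightarrow> nat \<Rightarrow> 'x" where
  "sqrt_iter x 0 = z"
| "sqrt_iter x (Suc n) = (1/2) \<odot> (x \<boxplus> sqrt_iter x n \<star> sqrt_iter x n)"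

primrec sqrt_bound :: "nat \<Rightarrow> real" where
  "sqrt_bound 0 = 0"
| "sqrt_bound (Suc n) = (1 + (sqrt_bound n)\<^sup>2) / 2"

lemma sqrt_bound: "0 \<le> sqrt_bound n" "sqrt_bound n \<le> 1" "sqrt_bound n \<le> sqrt_bound (Suc n)"
proof -
  show a: "0 \<le> sqrt_bound n" by (cases n) auto
  show "sqrt_bound n \<le> 1"
  proof (induction n)
    case (Suc n)
    have "0 \<le> sqrt_bound n" by (cases n) auto
    then show ?case using Suc power_le_one[of "sqrt_bound n" 2] by simp
  qed simp
  have "0 \<le> (1 - sqrt_bound n)\<^sup>2" by simp
  then show "sqrt_bound n \<le> sqrt_bound (Suc n)" by (simp add: power2_eq_square algebra_simps)
qed

lemma sqrt_iter_closed [simp]: "x \<in> S \<Longrightarrow> sqrt_iter x n \<in> S"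
  by (induction n) auto

lemma sqrt_iter_commute:
  assumes "x \<in> S" "w \<in> S" "x \<star> w = w \<star> x"
  shows "sqrt_iter x n \<star> w = w \<star> sqrt_iter x n"
proof (induction n)
  case (Suc n)
  have "sqrt_iter x n \<star> (sqrt_iter x n \<star> w) = w \<star> (sqrt_iter x n \<star> sqrt_iter x n)"
    by (metis Suc assms(1,2) mul_assoc sqrt_iter_closed)
  then show ?case using assms by (simp add: expand)
qed (use assms in auto)

lemma diff_squares:
  assumes "x \<in> S" "a \<in> S" "b \<in> S" "b \<star> a = a \<star> b"
  shows "(1/2) \<odot> (x \<boxplus> a \<star> a) \<boxminus> (1/2) \<odot> (x \<boxplus> b \<star> b) = (1/2) \<odot> ((a \<boxminus> b) \<star> (a \<boxplus> b))"
  apply (simp add: assms expand)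
  by (rule vec_eqI, (rule rp_rules | simp add: assms algebra_simps)+)

text \<open>Since the iterates commute, each increment factors as half the product of the previous
  increment and the sum of its two iterates. Both factors are dominated by their scalar
  counterparts.\<close>

lemma sqrt_iter_increment:
  assumes x: "x \<in> S" "nrm x \<le> 1"
  shows "nrm (sqrt_iter x n) \<le> sqrt_bound n"
    and "nrm (sqrt_iter x (Suc n) \<boxminus> sqrt_iter x n) \<le> sqrt_bound (Suc n) - sqrt_bound n"
proof -
  let ?y = "sqrt_iter x" and ?t = sqrt_bound
  have b: "nrm (?y n) \<le> ?t n" for n
  proof (induction n)
    case (Suc n)
    have "nrm (?y n \<star> ?y n) \<le> ?t n * ?t n"
      by (rule order.trans[OF nrm_mul mult_mono]) (simp_all add: x Suc sqrt_bound(1))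
    then have "nrm (x \<boxplus> ?y n \<star> ?y n) \<le> 1 + ?t n * ?t n"
      using nrm_add[of x "?y n \<star> ?y n"] x by simp
    then show ?case using x by (simp add: power2_eq_square)
  qed simp
  then show "nrm (?y n) \<le> ?t n" .
  show "nrm (?y (Suc n) \<boxminus> ?y n) \<le> ?t (Suc n) - ?t n"
  proof (induction n)
    case 0
    then show ?case using x by simp
  next
    case (Suc n)
    let ?a = "?y (Suc n)" and ?b = "?y n"
    have c: "?b \<star> ?a = ?a \<star> ?b"
      by (intro sqrt_iter_commute sqrt_iter_commute[symmetric] sqrt_iter_closed x refl)
    have cl: "?a \<in> S" "?b \<in> S" using x by simp_all
    have e: "?y (Suc (Suc n)) \<boxminus> ?a = (1/2) \<odot> ((?a \<boxminus> ?b) \<star> (?a \<boxplus> ?b))"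
      using diff_squares[OF x(1) cl c] by simp
    have "nrm ((?a \<boxminus> ?b) \<star> (?a \<boxplus> ?b)) \<le> (?t (Suc n) - ?t n) * (?t (Suc n) + ?t n)"
    proof (rule order.trans[OF nrm_mul mult_mono])
      show "nrm (?a \<boxplus> ?b) \<le> ?t (Suc n) + ?t n"
        using order.trans[OF nrm_add[OF cl] add_mono[OF b b]] .
      show "0 \<le> ?t (Suc n) - ?t n" using sqrt_bound(3)[of n] by linarith
    qed (use Suc cl in \<open>simp_all del: sqrt_iter.simps sqrt_bound.simps\<close>)
    then have "nrm ((1/2) \<odot> ((?a \<boxminus> ?b) \<star> (?a \<boxplus> ?b)))
        \<le> (?t (Suc n) - ?t n) * (?t (Suc n) + ?t n) / 2"
      using cl by (simp del: sqrt_iter.simps sqrt_bound.simps)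
    also have "\<dots> = ?t (Suc (Suc n)) - ?t (Suc n)"
      by (simp add: power2_eq_square field_simps)
    finally show ?case unfolding e .
  qed
qed

lemma sqrt_iter_diff:
  assumes x: "x \<in> S" "nrm x \<le> 1"
  shows "nrm (sqrt_iter x (n + k) \<boxminus> sqrt_iter x n) \<le> sqrt_bound (n + k) - sqrt_bound n"
proof (induction k)
  case (Suc k)
  then show ?case
    using nrm_diff_triangle[of "sqrt_iter x (n + Suc k)" "sqrt_iter x (n + k)" "sqrt_iter x n"]
      sqrt_iter_increment(2)[OF x, of "n + k"] x(1)
    by (simp del: sqrt_iter.simps sqrt_bound.simps)
qed (use x in simp)

text \<open>The limit y of the iteration satisfies y = (x + y^2)/2, that is, (u - y)^2 = u - x. The
  bound on u - r makes the root positive through \<open>pos_if_nrm_le\<close>; commutation with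
  everything that commutes with x allows several roots to be multiplied later.\<close>

lemma sqrt_exists:
  assumes x: "x \<in> S" "star x = x" "nrm x \<le> 1"
  shows "\<exists>r\<in>S. star r = r \<and> r \<star> r = u \<boxminus> x \<and> nrm (u \<boxminus> r) \<le> 1 \<and>
    (\<forall>w\<in>S. x \<star> w = w \<star> x \<longrightarrow> r \<star> w = w \<star> r)"
proof -
  let ?y = "sqrt_iter x" and ?t = sqrt_bound
  have cl: "?y n \<in> S" for n using x by simp
  have "incseq ?t" using sqrt_bound(3) by (rule incseq_SucI)
  then have "Cauchy ?t"
    using sqrt_bound(1,2) by (intro convergent_Cauchy Bseq_mono_convergent)
      (auto intro!: BseqI'[of _ 1] simp: incseq_def)
  have "\<exists>l\<in>S. (\<lambda>n. nrm (?y n \<boxminus> l)) \<longlonglongrightarrow> 0"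
  proof (rule complete)
    fix e :: real assume "e > 0"
    then obtain N where N: "\<And>m n. m \<ge> N \<Longrightarrow> n \<ge> N \<Longrightarrow> \<bar>?t m - ?t n\<bar> < e"
      using CauchyD[OF \<open>Cauchy ?t\<close>] by (metis real_norm_def)
    have *: "nrm (?y m \<boxminus> ?y n) < e" if "m \<ge> n" "n \<ge> N" for m n
      using sqrt_iter_diff[OF x(1,3), of n "m - n"] N[of m n] that
      by (simp del: sqrt_iter.simps sqrt_bound.simps)
    have "nrm (?y m \<boxminus> ?y n) < e" if "m \<ge> N" "n \<ge> N" for m n
      using *[of m n] *[of n m] that nrm_minus_commute[OF cl cl, of m n] by (cases "m \<ge> n") auto
    then show "\<exists>N. \<forall>m\<ge>N. \<forall>n\<ge>N. nrm (?y m \<boxminus> ?y n) < e" by blast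
  qed (rule cl)
  then obtain y where y: "conv ?y y" using cl by (auto simp: conv_def)
  have yS [simp]: "y \<in> S" using convD(2)[OF y] .
  have "star (?y n) = ?y n" for n
    by (induction n) (use x in simp_all)
  then have sy: "star y = y" using conv_unique[OF conv_star[OF y]] y by simp
  have "conv (\<lambda>n. ?y (Suc n)) ((1/2) \<odot> (x \<boxplus> y \<star> y))"
    unfolding sqrt_iter.simps by (intro conv_sm conv_add conv_mul conv_const y x)
  then have fixpoint: "y = (1/2) \<odot> (x \<boxplus> y \<star> y)"
    using conv_unique[OF conv_Suc[OF y]] by blast
  have com: "y \<star> w = w \<star> y" if w: "w \<in> S" "x \<star> w = w \<star> x" for w
  proof -
    have "conv (\<lambda>n. ?y n \<star> w) (y \<star> w)" "conv (\<lambda>n. w \<star> ?y n) (w \<star> y)"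
      by (intro conv_mul conv_const y w)+
    then show ?thesis using conv_unique sqrt_iter_commute[OF x(1) w] by simp
  qed
  have yy: "y \<star> y = 2 \<odot> y \<boxminus> x"
  proof -
    have "2 \<odot> y = 2 \<odot> ((1/2) \<odot> (x \<boxplus> y \<star> y))" by (rule arg_cong[OF fixpoint])
    also have "\<dots> = x \<boxplus> y \<star> y" using x by (simp add: sm_sm)
    finally show ?thesis
      by (simp, intro vec_eqI) ((rule rp_rules | simp add: x)+)
  qed
  have sq: "(u \<boxminus> y) \<star> (u \<boxminus> y) = u \<boxminus> x"
    apply (simp add: expand yy x)
    by (rule vec_eqI, (rule rp_rules | simp add: x algebra_simps)+)
  have "nrm y \<le> 1"
    by (rule nrm_limit_le[OF y order.trans[OF sqrt_iter_increment(1) sqrt_bound(2)] tendsto_const])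
      (use x in auto)
  moreover have "u \<boxminus> (u \<boxminus> y) = y"
    by (rule vec_eqI, (rule rp_rules | simp)+)
  ultimately have "nrm (u \<boxminus> (u \<boxminus> y)) \<le> 1" by simp
  then show ?thesis
    using sq sy com by (intro bexI[of _ "u \<boxminus> y"]) (simp_all add: expand)
qed

text \<open>With U = d + i s the hypotheses give U^* U = \<beta> u, and s is the imaginary part of
  U, so its norm is at most that of U. This stands in for a spectral estimate.\<close>

lemma unitary_bound:
  assumes "d \<in> S" "s \<in> S" "star d = d" "star s = s" "d \<star> s = s \<star> d" "0 \<le> \<beta>"
    and sum: "d \<star> d \<boxplus> s \<star> s = complex_of_real \<beta> \<odot> u"
  shows "(nrm s)\<^sup>2 \<le> \<beta>"
proof -
  define U where "U = d \<boxplus> \<i> \<odot> s"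
  have US: "U \<in> S" using assms by (simp add: U_def)
  have "star U \<star> U = d \<star> d \<boxplus> s \<star> s"
    unfolding U_def by (simp add: assms(1-5) expand, intro vec_eqI)
      ((rule rp_rules | simp add: assms(1-5))+)
  then have "(nrm U)\<^sup>2 = \<beta> * nrm u"
    using cstar_identity[OF US] sum assms by simp
  then have U: "(nrm U)\<^sup>2 \<le> \<beta>"
    using nrm_unit_le assms mult_left_mono[of "nrm u" 1 \<beta>] by simp
  have "s = (- \<i> / 2) \<odot> (U \<boxminus> star U)"
    unfolding U_def by (simp add: assms, intro vec_eqI) ((rule rp_rules | simp add: assms algebra_simps)+)
  then have "nrm s = nrm (U \<boxminus> star U) / 2"
    using nrm_sm[of "U \<boxminus> star U" "- \<i> / 2"] US by (simp add: norm_divide del: nrm_sm)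
  also have "\<dots> \<le> nrm U" using nrm_add[of U "(-1) \<odot> star U"] US by simp
  finally have "(nrm s)\<^sup>2 \<le> (nrm U)\<^sup>2" using assms by (intro power_mono) auto
  then show ?thesis using U by linarith
qed

text \<open>Write u - d^2 as a square s^2. The root s commutes with d, and d^2 + s^2 = u, so
  \<open>unitary_bound\<close> applies.\<close>

lemma nrm_unit_minus_square:
  assumes d: "d \<in> S" "star d = d" "nrm d \<le> 1"
  shows "nrm (u \<boxminus> d \<star> d) \<le> 1"
proof -
  have "nrm (d \<star> d) \<le> 1" using d nrm_square[of d] by (simp add: power_le_one)
  moreover have "d \<star> d \<in> S" "star (d \<star> d) = d \<star> d" using d by simp_all
  ultimately obtain s where s: "s \<in> S" "star s = s" "s \<star> s = u \<boxminus> d \<star> d"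
    and comm: "\<And>w. w \<in> S \<Longrightarrow> (d \<star> d) \<star> w = w \<star> (d \<star> d) \<Longrightarrow> s \<star> w = w \<star> s"
    using sqrt_exists[of "d \<star> d"] by blast
  have "d \<star> s = s \<star> d" by (rule comm[symmetric]) (use d(1) in \<open>simp_all add: mul_assoc\<close>)
  moreover have "d \<star> d \<boxplus> s \<star> s = complex_of_real 1 \<odot> u"
    unfolding s by (intro vec_eqI) ((rule rp_rules | simp add: d)+)
  ultimately have "(nrm s)\<^sup>2 \<le> 1" using d s by (intro unitary_bound) auto
  then show ?thesis using s nrm_square[of s] by simp
qed

section \<open>The positive cone\<close>

text \<open>Squares of self-adjoint elements are taken instead of elements c^* c, because the norm
  criterion below, and with it closure under sums, is available for them before every c^* c is known
  to be positive. \<open>pos_iff\<close> identifies the two notions in the end.\<close>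

definition pos :: "'x \<Rightarrow> bool" where
  "pos h \<longleftrightarrow> (\<exists>d\<in>S. star d = d \<and> h = d \<star> d)"

lemma posI: "d \<in> S \<Longrightarrow> star d = d \<Longrightarrow> pos (d \<star> d)"
  unfolding pos_def by blast

lemma posE:
  assumes "pos h" obtains d where "d \<in> S" "star d = d" "h = d \<star> d"
  using assms unfolding pos_def by blast

lemma pos_closed [simp]: "pos h \<Longrightarrow> h \<in> S"
  and pos_star [simp]: "pos h \<Longrightarrow> star h = h"
  by (auto elim: posE)

lemma pos_zero [simp]: "pos z"
  using posI[of z] by simp

lemma pos_sm: "pos h \<Longrightarrow> 0 \<le> c \<Longrightarrow> pos (complex_of_real c \<odot> h)"
proof -
  assume "pos h" "0 \<le> c"
  then obtain d where d: "d \<in> S" "star d = d" "h = d \<star> d" by (elim posE)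
  have "complex_of_real (sqrt c) * complex_of_real (sqrt c) = complex_of_real c"
    using \<open>0 \<le> c\<close> by (simp flip: of_real_mult)
  then have "complex_of_real c \<odot> h =
      (complex_of_real (sqrt c) \<odot> d) \<star> (complex_of_real (sqrt c) \<odot> d)"
    using d(1,3) by (simp add: expand sm_sm)
  moreover have "star (complex_of_real (sqrt c) \<odot> d) = complex_of_real (sqrt c) \<odot> d"
    using d(1,2) by simp
  moreover have "complex_of_real (sqrt c) \<odot> d \<in> S" using d(1) by simp
  ultimately show ?thesis using posI by metis
qed

text \<open>After scaling by 1/t this is \<open>nrm_unit_minus_square\<close>. Together with its
  converse \<open>pos_if_nrm_le\<close> it characterizes positivity by a norm inequality, so that
  sums and limits of positive elements are handled by the triangle inequality.\<close>

lemma pos_imp_nrm_le: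
  assumes "pos h" "nrm h \<le> t"
  shows "nrm (complex_of_real t \<odot> u \<boxminus> h) \<le> t"
proof (cases "t = 0")
  case True
  then have "nrm h = 0" using assms by (intro order.antisym nrm_ge_0) auto
  then show ?thesis using True assms by simp
next
  case False
  then have t: "t > 0" using assms nrm_ge_0[of h] by (simp del: nrm_ge_0)
  obtain d where d: "d \<in> S" "star d = d" "h = d \<star> d" using assms(1) by (elim posE)
  let ?d = "complex_of_real (1 / sqrt t) \<odot> d"
  have "(nrm d)\<^sup>2 \<le> t" using assms d nrm_square[of d] by simp
  then have "nrm d \<le> sqrt t" by (rule real_le_rsqrt)
  then have "nrm (u \<boxminus> ?d \<star> ?d) \<le> 1"
    using d t by (intro nrm_unit_minus_square) (auto simp: norm_divide)
  moreover have "complex_of_real (1 / sqrt t) * complex_of_real (1 / sqrt t) = complex_of_real (1 / t)"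
    using t by (simp flip: of_real_mult)
  moreover have "u \<boxminus> complex_of_real (1 / t) \<odot> h =
      complex_of_real (1 / t) \<odot> (complex_of_real t \<odot> u \<boxminus> h)"
    by (intro vec_eqI) ((rule rp_rules | simp add: assms less_imp_neq[OF t, symmetric] algebra_simps)+)
  ultimately have "nrm (complex_of_real (1 / t) \<odot> (complex_of_real t \<odot> u \<boxminus> h)) \<le> 1"
    using d by (simp add: expand sm_sm del: nrm_sm)
  then show ?thesis using t assms by (simp add: norm_divide)
qed

text \<open>The element u - h/t is a contraction, so \<open>sqrt_exists\<close> provides a square
  root of h/t; multiplying it by the root of t gives d.\<close>

lemma nrm_le_imp_sqrt:
  assumes h: "h \<in> S" "star h = h" and t: "t > 0" "nrm (complex_of_real t \<odot> u \<boxminus> h) \<le> t"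
  shows "\<exists>d\<in>S. star d = d \<and> d \<star> d = h \<and> nrm (complex_of_real (sqrt t) \<odot> u \<boxminus> d) \<le> sqrt t \<and>
    (\<forall>w\<in>S. h \<star> w = w \<star> h \<longrightarrow> d \<star> w = w \<star> d)"
proof -
  define x where "x = complex_of_real (1 / t) \<odot> (complex_of_real t \<odot> u \<boxminus> h)"
  have x: "x \<in> S" "star x = x" using h by (simp_all add: x_def)
  have "nrm x \<le> 1" using h t by (simp add: x_def norm_divide)
  then obtain r where r: "r \<in> S" "star r = r" "r \<star> r = u \<boxminus> x" "nrm (u \<boxminus> r) \<le> 1"
    and comm: "\<And>w. w \<in> S \<Longrightarrow> x \<star> w = w \<star> x \<Longrightarrow> r \<star> w = w \<star> r"
    using sqrt_exists[OF x] by blast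
  let ?c = "complex_of_real (sqrt t)"
  have c: "?c * ?c = complex_of_real t" using t by (simp flip: of_real_mult)
  have "(?c \<odot> r) \<star> (?c \<odot> r) = complex_of_real t \<odot> (u \<boxminus> x)"
    using r c x(1) by (simp add: expand sm_sm)
  also have "\<dots> = h"
    unfolding x_def by (intro vec_eqI) ((rule rp_rules | simp add: h less_imp_neq[OF t(1), symmetric] algebra_simps)+)
  finally have 1: "(?c \<odot> r) \<star> (?c \<odot> r) = h" .
  have "?c \<odot> u \<boxminus> ?c \<odot> r = ?c \<odot> (u \<boxminus> r)" using r
    by (intro vec_eqI) ((rule rp_rules | simp add: r algebra_simps)+)
  then have 2: "nrm (?c \<odot> u \<boxminus> ?c \<odot> r) \<le> sqrt t"
    using r t by simp
  have 3: "(?c \<odot> r) \<star> w = w \<star> (?c \<odot> r)" if "w \<in> S" "h \<star> w = w \<star> h" for w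
    using comm[of w] that r h by (simp add: expand x_def)
  show ?thesis using 1 2 3 r by (intro bexI[of _ "?c \<odot> r"]) simp_all
qed

lemma pos_if_nrm_le:
  assumes "h \<in> S" "star h = h" "nrm (complex_of_real t \<odot> u \<boxminus> h) \<le> t"
  shows "pos h"
proof (cases "t = 0")
  case True
  then have "nrm ((-1) \<odot> h) = 0" using assms by (intro order.antisym nrm_ge_0) auto
  then show ?thesis using assms by simp
next
  case False
  then have "t > 0" using assms nrm_ge_0[of "complex_of_real t \<odot> u \<boxminus> h"] by (simp del: nrm_ge_0)
  then show ?thesis using nrm_le_imp_sqrt[OF assms(1,2) _ assms(3)] posI by metis
qed

lemma pos_sqrt:
  assumes "pos h"
  shows "\<exists>d. pos d \<and> d \<star> d = h \<and> (\<forall>w\<in>S. h \<star> w = w \<star> h \<longrightarrow> d \<star> w = w \<star> d)"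
proof -
  \<comment> \<open>The summand 1 keeps the bound positive when h = 0.\<close>
  have "nrm (complex_of_real (nrm h + 1) \<odot> u \<boxminus> h) \<le> nrm h + 1"
    using assms by (intro pos_imp_nrm_le) auto
  moreover have "0 < nrm h + 1" using nrm_ge_0[OF pos_closed[OF assms]] by linarith
  ultimately obtain d where "d \<in> S" "star d = d" "d \<star> d = h"
      "nrm (complex_of_real (sqrt (nrm h + 1)) \<odot> u \<boxminus> d) \<le> sqrt (nrm h + 1)"
      "\<forall>w\<in>S. h \<star> w = w \<star> h \<longrightarrow> d \<star> w = w \<star> d"
    using nrm_le_imp_sqrt[of h] assms by (metis pos_closed pos_star)
  then show ?thesis using pos_if_nrm_le by blast
qed

lemma pos_add [simp]:
  assumes "pos h" "pos k" shows "pos (h \<boxplus> k)"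
proof (rule pos_if_nrm_le)
  let ?t = "complex_of_real (nrm h)" and ?s = "complex_of_real (nrm k)"
  have "complex_of_real (nrm h + nrm k) \<odot> u \<boxminus> (h \<boxplus> k) = (?t \<odot> u \<boxminus> h) \<boxplus> (?s \<odot> u \<boxminus> k)"
    by (intro vec_eqI) ((rule rp_rules | simp add: assms algebra_simps)+)
  then show "nrm (complex_of_real (nrm h + nrm k) \<odot> u \<boxminus> (h \<boxplus> k)) \<le> nrm h + nrm k"
    using nrm_add[of "?t \<odot> u \<boxminus> h" "?s \<odot> u \<boxminus> k"] assms
      pos_imp_nrm_le[OF assms(1) order_refl] pos_imp_nrm_le[OF assms(2) order_refl] by simp
qed (use assms in simp_all)

text \<open>The inequality of the norm criterion passes to limits once t is fixed. The value t =
  ||l|| + 1 serves all approximants at distance at most 1, hence the minimum with 1 in the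
  proof.\<close>

lemma pos_limit:
  assumes l: "l \<in> S" and approx: "\<And>e. e > 0 \<Longrightarrow> \<exists>h. pos h \<and> nrm (h \<boxminus> l) \<le> e"
  shows "pos l"
proof (rule pos_if_nrm_le[OF l])
  let ?t = "nrm l + 1"
  show "star l = l"
  proof (rule eq_if_nrm_small[where c = 2])
    fix e :: real assume "e > 0"
    then obtain h where h: "pos h" "nrm (h \<boxminus> l) \<le> e" using approx by blast
    have "nrm (star l \<boxminus> h) = nrm (h \<boxminus> l)"
      using nrm_star[of "l \<boxminus> h"] h l nrm_minus_commute[of l h] by simp
    then show "nrm (star l \<boxminus> l) \<le> 2 * e"
      using nrm_diff_triangle[of "star l" h l] h l by simp
  qed (use l in auto)
  have "nrm (complex_of_real ?t \<odot> u \<boxminus> l) \<le> ?t + e" if "e > 0" for e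
  proof -
    have "0 < min e 1" using that by simp
    then obtain h where h: "pos h" "nrm (h \<boxminus> l) \<le> min e 1" using approx by blast
    have "nrm h \<le> ?t" using nrm_le_diff[of h l] h l by simp
    then show ?thesis
      using nrm_diff_triangle[of "complex_of_real ?t \<odot> u" h l] pos_imp_nrm_le[OF h(1)] h l by force
  qed
  then show "nrm (complex_of_real ?t \<odot> u \<boxminus> l) \<le> ?t" by (rule field_le_epsilon)
qed

lemma pos_nrm_minus:
  assumes "pos h" "nrm h \<le> t" shows "pos (complex_of_real t \<odot> u \<boxminus> h)"
proof (rule pos_if_nrm_le)
  have "complex_of_real t \<odot> u \<boxminus> (complex_of_real t \<odot> u \<boxminus> h) = h"
    by (intro vec_eqI) ((rule rp_rules | simp add: assms)+)
  then show "nrm (complex_of_real t \<odot> u \<boxminus> (complex_of_real t \<odot> u \<boxminus> h)) \<le> t"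
    using assms by simp
qed (use assms in simp_all)

text \<open>Square roots s of a and d of t u - a commute, and d^2 + s^2 = t u. So
  \<open>unitary_bound\<close> gives ||a|| = ||s||^2 <= t.\<close>

lemma nrm_le_if_pos:
  assumes "pos a" "pos (complex_of_real t \<odot> u \<boxminus> a)" "0 \<le> t"
  shows "nrm a \<le> t"
proof -
  obtain s where s: "pos s" "s \<star> s = a" and s_comm: "\<And>w. w \<in> S \<Longrightarrow> a \<star> w = w \<star> a \<Longrightarrow> s \<star> w = w \<star> s"
    using pos_sqrt[OF assms(1)] by blast
  let ?b = "complex_of_real t \<odot> u \<boxminus> a"
  obtain d where d: "pos d" "d \<star> d = ?b" and d_comm: "\<And>w. w \<in> S \<Longrightarrow> ?b \<star> w = w \<star> ?b \<Longrightarrow> d \<star> w = w \<star> d"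
    using pos_sqrt[OF assms(2)] by blast
  have "a \<star> s = s \<star> a" unfolding s(2)[symmetric] using s(1) by (simp add: mul_assoc)
  then have "?b \<star> s = s \<star> ?b" using s(1) assms(1) by (simp add: expand)
  then have "d \<star> s = s \<star> d" using d_comm s(1) by simp
  moreover have "d \<star> d \<boxplus> s \<star> s = complex_of_real t \<odot> u"
    unfolding s d by (intro vec_eqI) ((rule rp_rules | simp add: assms)+)
  ultimately have "(nrm s)\<^sup>2 \<le> t" using s d assms by (intro unitary_bound[of d s]) auto
  then show ?thesis using nrm_square[of s] s by simp
qed

lemma nrm_mono:
  assumes "pos a" "b \<in> S" "pos (b \<boxminus> a)"
  shows "nrm a \<le> nrm b"
proof (rule nrm_le_if_pos)
  have "b = (b \<boxminus> a) \<boxplus> a" by (intro vec_eqI) ((rule rp_rules | simp add: assms)+)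
  then have "pos b" using assms pos_add by metis
  then have "pos ((complex_of_real (nrm b) \<odot> u \<boxminus> b) \<boxplus> (b \<boxminus> a))"
    by (rule pos_add[OF pos_nrm_minus[OF _ order_refl] assms(3)])
  moreover have "(complex_of_real (nrm b) \<odot> u \<boxminus> b) \<boxplus> (b \<boxminus> a) = complex_of_real (nrm b) \<odot> u \<boxminus> a"
    by (intro vec_eqI) ((rule rp_rules | simp add: assms)+)
  ultimately show "pos (complex_of_real (nrm b) \<odot> u \<boxminus> a)" by simp
qed (use assms in auto)

lemma pos_antisym:
  assumes "pos a" "pos ((-1) \<odot> a)" shows "a = z"
proof -
  have "nrm a \<le> nrm z" using assms by (intro nrm_mono) auto
  then have "nrm a = 0" using assms by (intro order.antisym nrm_ge_0) auto
  then show ?thesis using assms by simp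
qed

section \<open>Positivity of the elements x^* x\<close>

text \<open>The next two lemmas are Kaplansky's argument that \<open>x\<^sup>*x\<close> is positive: the sum
  \<open>x\<^sup>*x + xx\<^sup>*\<close> equals \<open>2(Re x)\<^sup>2 + 2(Im x)\<^sup>2\<close>. Instead of comparing the spectra of \<open>x\<^sup>*x\<close> and \<open>xx\<^sup>*\<close>,
  we apply this a second time, to \<open>xd\<close>.\<close>

lemma pos_mul_star_if_neg:
  assumes "x \<in> S" "d \<in> S" "star d = d" "star x \<star> x = (-1) \<odot> (d \<star> d)"
  shows "pos (x \<star> star x)"
proof -
  let ?a = "(1/2) \<odot> (x \<boxplus> star x)" and ?b = "(- \<i> / 2) \<odot> (x \<boxminus> star x)"
  have a: "?a \<in> S" "star ?a = ?a"
    using assms by (simp_all add: add_commute)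
  have "star ?b = ?b" using assms
    by (simp, intro vec_eqI) ((rule rp_rules | simp add: assms)+)
  then have "pos (?a \<star> ?a)" "pos (?b \<star> ?b)" "pos (d \<star> d)"
    using a assms(1-3) by (intro posI; simp)+
  then have "pos (complex_of_real 2 \<odot> (?a \<star> ?a) \<boxplus> (complex_of_real 2 \<odot> (?b \<star> ?b) \<boxplus> d \<star> d))"
    by (intro pos_add pos_sm) auto
  also have "complex_of_real 2 \<odot> (?a \<star> ?a) \<boxplus> (complex_of_real 2 \<odot> (?b \<star> ?b) \<boxplus> d \<star> d) = x \<star> star x"
    using assms by (simp add: expand, intro vec_eqI)
      ((rule rp_rules | simp add: assms algebra_simps)+)
  finally show ?thesis .
qed

lemma star_mul_neg_imp_zero:
  assumes "x \<in> S" "d \<in> S" "star d = d" "star x \<star> x = (-1) \<odot> (d \<star> d)"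
  shows "x = z"
proof -
  let ?v = "x \<star> star x"
  have e: "star x \<star> (x \<star> w) = (-1) \<odot> (d \<star> (d \<star> w))" if "w \<in> S" for w
    using assms that by (metis mul_assoc mul_closed sm_mul star_closed)
  have neg: "star (x \<star> d) \<star> (x \<star> d) = (-1) \<odot> ((d \<star> d) \<star> (d \<star> d))"
    using assms by (simp add: expand e)
  have "pos ((x \<star> d) \<star> star (x \<star> d))"
    by (rule pos_mul_star_if_neg[OF _ _ _ neg]) (simp_all add: assms(1-3))
  \<comment> \<open>Here x d^2 x^* = -x (x^* x) x^* = -v^2 for v = x x^*, so that v^2 and its
    negative are both positive.\<close>
  also have "(x \<star> d) \<star> star (x \<star> d) = (-1) \<odot> (?v \<star> ?v)"
    using assms by (simp add: expand e sm_sm)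
  finally have "pos ((-1) \<odot> (?v \<star> ?v))" .
  moreover have "pos (?v \<star> ?v)" using assms(1) by (intro posI) simp_all
  ultimately have "?v \<star> ?v = z" by (intro pos_antisym)
  then have "nrm ?v = 0" using assms nrm_square[of ?v] by (simp del: nrm_eq_0)
  then have "(nrm (star x))\<^sup>2 = 0" using cstar_identity[of "star x"] assms(1) by simp
  then show ?thesis using assms(1) by simp
qed

text \<open>In the next lemma \<open>n\<close> is \<open>\<bar>y\<bar> - y\<close>, twice the negative part of \<open>y\<close>, and \<open>p = \<surd>\<bar>y\<bar>\<close>.\<close>

lemma negative_part:
  assumes y: "y \<in> S" "star y = y"
  obtains n p where "n \<in> S" "star n = n" "p \<in> S" "star p = p"
    "p \<star> n = n \<star> p"
    "n \<star> (y \<star> n) = (-1) \<odot> ((n \<star> p) \<star> (p \<star> n))"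
    "n \<star> n = 2 \<odot> (p \<star> (p \<star> n))"
    "n = z \<Longrightarrow> pos y"
proof -
  have "pos (y \<star> y)" using y by (rule posI)
  then obtain k where k: "pos k" "k \<star> k = y \<star> y"
    and k_comm: "\<And>w. w \<in> S \<Longrightarrow> (y \<star> y) \<star> w = w \<star> (y \<star> y) \<Longrightarrow> k \<star> w = w \<star> k"
    using pos_sqrt by blast
  obtain p where p: "p \<in> S" "star p = p" "k = p \<star> p"
    and p_comm: "\<And>w. w \<in> S \<Longrightarrow> k \<star> w = w \<star> k \<Longrightarrow> p \<star> w = w \<star> p"
    using pos_sqrt[OF k(1)] pos_closed pos_star by metis
  have ky: "k \<star> y = y \<star> k" by (rule k_comm) (use y in \<open>simp_all add: mul_assoc\<close>)
  let ?n = "k \<boxminus> y"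
  have kS: "k \<in> S" "star k = k" using k by auto
  \<comment> \<open>From k^2 = y^2 and k y = y k: the product y (k - y) is k y - k^2 = -k (k -
    y).\<close>
  have yn: "y \<star> ?n = (-1) \<odot> (k \<star> ?n)"
    using y kS ky k(2)
    by (simp add: expand, intro vec_eqI) ((rule rp_rules | simp add: y kS)+)
  have "?n \<star> (y \<star> ?n) = (-1) \<odot> ((?n \<star> p) \<star> (p \<star> ?n))"
    unfolding yn using y kS p(1) by (simp add: mul_sm) (simp add: p(3) mul_assoc)
  moreover have "?n \<star> ?n = 2 \<odot> (k \<star> ?n)"
    using y kS ky k(2)
    by (simp add: expand, intro vec_eqI) ((rule rp_rules | simp add: y kS)+)
  then have "?n \<star> ?n = 2 \<odot> (p \<star> (p \<star> ?n))" using p y by (simp add: mul_assoc)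
  moreover have "pos y" if "?n = z" using eq_if_diff_zero[OF kS(1) y(1) that] k by simp
  moreover have "p \<star> ?n = ?n \<star> p" by (rule p_comm) (use y kS ky in \<open>simp_all add: expand\<close>)
  ultimately show thesis using y p(1,2) kS by (intro that[of ?n p]) simp_all
qed

text \<open>If n is twice the negative part of y = c^* c, then (c n)^* (c n) = n y n = -(n p)^2,
  which forces c n = 0 by \<open>star_mul_neg_imp_zero\<close>. Then n p = 0, hence n^2 = 2 p^2 n =
  0.\<close>

lemma pos_star_mul:
  assumes c: "c \<in> S" shows "pos (star c \<star> c)"
proof -
  let ?y = "star c \<star> c"
  obtain n p where n: "n \<in> S" "star n = n" "p \<in> S" "star p = p" "p \<star> n = n \<star> p"
    "n \<star> (?y \<star> n) = (-1) \<odot> ((n \<star> p) \<star> (p \<star> n))"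
    "n \<star> n = 2 \<odot> (p \<star> (p \<star> n))" "n = z \<Longrightarrow> pos ?y"
    using negative_part[of ?y] c by auto
  have sa: "star (n \<star> p) = n \<star> p" using n(1-5) by simp
  have "star (c \<star> n) \<star> (c \<star> n) = (-1) \<odot> ((n \<star> p) \<star> (n \<star> p))"
    using n(5,6) n(1-4) c by (simp add: mul_assoc)
  then have "c \<star> n = z"
    using sa n(1,3) c by (intro star_mul_neg_imp_zero[of "c \<star> n" "n \<star> p"]) auto
  then have "(-1) \<odot> ((n \<star> p) \<star> (p \<star> n)) = z"
    using n(1,6) c by (simp add: mul_assoc)
  then have "nrm ((-1) \<odot> ((n \<star> p) \<star> (p \<star> n))) = 0" by simp
  then have "nrm ((n \<star> p) \<star> (n \<star> p)) = 0" using n(1,3,5) by (simp del: nrm_eq_0)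
  then have "nrm (n \<star> p) = 0" using nrm_square[OF _ sa] n(1,3) by (simp del: nrm_eq_0)
  then have "n \<star> n = z" using n(1,3,5,7) by simp
  then have "n = z" using nrm_square[of n] n(1,2) by simp
  then show ?thesis by (rule n(8))
qed

lemma pos_iff: "pos h \<longleftrightarrow> (\<exists>c\<in>S. h = star c \<star> c)"
  using pos_star_mul posE by metis

end

section \<open>Fell bundles\<close>

notation badd (infixl "\<oplus>\<index>" 65)
notation bsm (infixr "\<odot>\<index>" 75)
notation bmul (infixl "\<cdot>\<index>" 70)

locale ufell = group G for G :: "'g monoid" (structure) +
  fixes A :: "('g, 'a) fbundle" and u :: 'a
  assumes fell: "fell_bundle G A"
    and unit_fib: "u \<in> fib A \<one>"
    and unit_e: "a \<in> fib A \<one> \<Longrightarrow> u \<cdot>\<^bsub>A\<^esub> a = a" "a \<in> fib A \<one> \<Longrightarrow> a \<cdot>\<^bsub>A\<^esub> u = a"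
begin

lemma cvec_fib: "g \<in> carrier G \<Longrightarrow> cvec (fib A g) (badd A) (bsm A) (bzero A g) (bnorm A)"
  using fell unfolding fell_bundle_def cvec_def by (elim conjE) blast

lemmas fib_eqI = cvec.vec_eqI[OF cvec_fib]
lemmas fib_rp = cvec.rp_rules[OF cvec_fib]

lemma fib_zero [simp]: "g \<in> carrier G \<Longrightarrow> bzero A g \<in> fib A g"
  and fib_add: "g \<in> carrier G \<Longrightarrow> a \<in> fib A g \<Longrightarrow> b \<in> fib A g \<Longrightarrow> a \<oplus>\<^bsub>A\<^esub> b \<in> fib A g"
  and fib_sm: "g \<in> carrier G \<Longrightarrow> a \<in> fib A g \<Longrightarrow> c \<odot>\<^bsub>A\<^esub> a \<in> fib A g"
  and bnorm_ge_0: "g \<in> carrier G \<Longrightarrow> a \<in> fib A g \<Longrightarrow> 0 \<le> bnorm A a"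
  and bnorm_eq_0: "g \<in> carrier G \<Longrightarrow> a \<in> fib A g \<Longrightarrow> bnorm A a = 0 \<longleftrightarrow> a = bzero A g"
  and bnorm_sm: "g \<in> carrier G \<Longrightarrow> a \<in> fib A g \<Longrightarrow> bnorm A (c \<odot>\<^bsub>A\<^esub> a) = cmod c * bnorm A a"
  and bnorm_add: "g \<in> carrier G \<Longrightarrow> a \<in> fib A g \<Longrightarrow> b \<in> fib A g \<Longrightarrow>
    bnorm A (a \<oplus>\<^bsub>A\<^esub> b) \<le> bnorm A a + bnorm A b"
  and sm_0_fib: "g \<in> carrier G \<Longrightarrow> a \<in> fib A g \<Longrightarrow> 0 \<odot>\<^bsub>A\<^esub> a = bzero A g"
  by (fact cvec.zero_closed[OF cvec_fib] cvec.add_closed[OF cvec_fib] cvec.sm_closed[OF cvec_fib]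
      cvec.nrm_ge_0[OF cvec_fib] cvec.nrm_eq_0[OF cvec_fib] cvec.nrm_sm[OF cvec_fib]
      cvec.nrm_add[OF cvec_fib] cvec.sm_zero_left[OF cvec_fib])+

lemma fib_mul: "g \<in> carrier G \<Longrightarrow> h \<in> carrier G \<Longrightarrow> a \<in> fib A g \<Longrightarrow> b \<in> fib A h \<Longrightarrow>
    g \<otimes> h = k \<Longrightarrow> a \<cdot>\<^bsub>A\<^esub> b \<in> fib A k"
  and fib_star: "g \<in> carrier G \<Longrightarrow> a \<in> fib A g \<Longrightarrow> inv g = k \<Longrightarrow> bstar A a \<in> fib A k"
  using fell unfolding fell_bundle_def by (elim conjE, hypsubst, simp)+

lemma fib_disjoint: "g \<in> carrier G \<Longrightarrow> h \<in> carrier G \<Longrightarrow> a \<in> fib A g \<Longrightarrow> a \<in> fib A h \<Longrightarrow> g = h"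
  using fell unfolding fell_bundle_def by (elim conjE) blast

lemma add_bmul: "g \<in> carrier G \<Longrightarrow> h \<in> carrier G \<Longrightarrow> a \<in> fib A g \<Longrightarrow> a' \<in> fib A g \<Longrightarrow> b \<in> fib A h \<Longrightarrow>
    (a \<oplus>\<^bsub>A\<^esub> a') \<cdot>\<^bsub>A\<^esub> b = a \<cdot>\<^bsub>A\<^esub> b \<oplus>\<^bsub>A\<^esub> a' \<cdot>\<^bsub>A\<^esub> b"
  and bmul_add: "g \<in> carrier G \<Longrightarrow> h \<in> carrier G \<Longrightarrow> a \<in> fib A g \<Longrightarrow> a' \<in> fib A g \<Longrightarrow> b \<in> fib A h \<Longrightarrow>
    b \<cdot>\<^bsub>A\<^esub> (a \<oplus>\<^bsub>A\<^esub> a') = b \<cdot>\<^bsub>A\<^esub> a \<oplus>\<^bsub>A\<^esub> b \<cdot>\<^bsub>A\<^esub> a'"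
  using fell unfolding fell_bundle_def by (elim conjE, simp)+

lemma bstar_add: "g \<in> carrier G \<Longrightarrow> a \<in> fib A g \<Longrightarrow> b \<in> fib A g \<Longrightarrow>
    bstar A (a \<oplus>\<^bsub>A\<^esub> b) = bstar A a \<oplus>\<^bsub>A\<^esub> bstar A b"
  using fell unfolding fell_bundle_def by (elim conjE) simp

definition tot :: "'a set" where
  "tot = (\<Union>g\<in>carrier G. fib A g)"

definition deg :: "'a \<Rightarrow> 'g" where
  "deg a = (THE g. g \<in> carrier G \<and> a \<in> fib A g)"

lemma fib_tot: "g \<in> carrier G \<Longrightarrow> a \<in> fib A g \<Longrightarrow> a \<in> tot"
  by (auto simp: tot_def)

lemma deg_eq [simp]: "a \<in> fib A g \<Longrightarrow> g \<in> carrier G \<Longrightarrow> deg a = g"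
  unfolding deg_def using fib_disjoint by blast

lemma tot_mul [simp]: "a \<in> tot \<Longrightarrow> b \<in> tot \<Longrightarrow> a \<cdot>\<^bsub>A\<^esub> b \<in> tot"
  unfolding tot_def by (auto intro!: fib_mul)

lemma tot_star [simp]: "a \<in> tot \<Longrightarrow> bstar A a \<in> tot"
  unfolding tot_def by (auto intro!: fib_star)

lemma tot_sm [simp]: "a \<in> tot \<Longrightarrow> c \<odot>\<^bsub>A\<^esub> a \<in> tot"
  unfolding tot_def by (auto intro!: fib_sm)

text \<open>Laws without sums of two fibre elements hold throughout the disjoint union. Stated over
  \<open>tot\<close>, they rewrite without any bookkeeping of degrees; the additive laws need a
  common fibre and keep their degree hypotheses.\<close>

lemma bmul_assoc: "a \<in> tot \<Longrightarrow> b \<in> tot \<Longrightarrow> c \<in> tot \<Longrightarrow> (a \<cdot>\<^bsub>A\<^esub> b) \<cdot>\<^bsub>A\<^esub> c = a \<cdot>\<^bsub>A\<^esub> (b \<cdot>\<^bsub>A\<^esub> c)"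
  and sm_bmul: "a \<in> tot \<Longrightarrow> b \<in> tot \<Longrightarrow> (k \<odot>\<^bsub>A\<^esub> a) \<cdot>\<^bsub>A\<^esub> b = k \<odot>\<^bsub>A\<^esub> (a \<cdot>\<^bsub>A\<^esub> b)"
  and bmul_sm: "a \<in> tot \<Longrightarrow> b \<in> tot \<Longrightarrow> a \<cdot>\<^bsub>A\<^esub> (k \<odot>\<^bsub>A\<^esub> b) = k \<odot>\<^bsub>A\<^esub> (a \<cdot>\<^bsub>A\<^esub> b)"
  and bstar_sm: "a \<in> tot \<Longrightarrow> bstar A (k \<odot>\<^bsub>A\<^esub> a) = cnj k \<odot>\<^bsub>A\<^esub> bstar A a"
  and bstar_bmul: "a \<in> tot \<Longrightarrow> b \<in> tot \<Longrightarrow> bstar A (a \<cdot>\<^bsub>A\<^esub> b) = bstar A b \<cdot>\<^bsub>A\<^esub> bstar A a"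
  and bstar_bstar [simp]: "a \<in> tot \<Longrightarrow> bstar A (bstar A a) = a"
  and bnorm_bmul: "a \<in> tot \<Longrightarrow> b \<in> tot \<Longrightarrow> bnorm A (a \<cdot>\<^bsub>A\<^esub> b) \<le> bnorm A a * bnorm A b"
  and bnorm_cstar: "a \<in> tot \<Longrightarrow> bnorm A (bstar A a \<cdot>\<^bsub>A\<^esub> a) = (bnorm A a)\<^sup>2"
  and pos_e_cstar: "a \<in> tot \<Longrightarrow> pos_e G A (bstar A a \<cdot>\<^bsub>A\<^esub> a)"
  using fell unfolding fell_bundle_def tot_def by (elim conjE UN_E, simp)+

lemma tot_norm_ge_0: "a \<in> tot \<Longrightarrow> 0 \<le> bnorm A a"
  unfolding tot_def by (auto intro: bnorm_ge_0)

sublocale E: ucstar "fib A \<one>" "badd A" "bsm A" "bzero A \<one>" "bnorm A" "bmul A" "bstar A" u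
proof -
  interpret cvec "fib A \<one>" "badd A" "bsm A" "bzero A \<one>" "bnorm A"
    by (rule cvec_fib) simp
  have t: "a \<in> tot" if "a \<in> fib A \<one>" for a using fib_tot that by blast
  have m: "a \<cdot>\<^bsub>A\<^esub> b \<in> fib A \<one>" if "a \<in> fib A \<one>" "b \<in> fib A \<one>" for a b
    by (rule fib_mul[OF _ _ that]) simp_all
  have s: "bstar A a \<in> fib A \<one>" if "a \<in> fib A \<one>" for a
    by (rule fib_star[OF _ that]) simp_all
  show "ucstar (fib A \<one>) (badd A) (bsm A) (bzero A \<one>) (bnorm A) (bmul A) (bstar A) u"
    by unfold_locales
      ((rule m s unit_fib unit_e bmul_assoc sm_bmul bmul_sm bstar_sm bstar_bmul bstar_bstar bnorm_bmul
          bnorm_cstar add_bmul[OF one_closed one_closed] bmul_add[OF one_closed one_closed]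
          bstar_add[OF one_closed], ((assumption | erule t)+)?)+)
qed

lemma pos_e_iff: "pos_e G A x \<longleftrightarrow> E.pos x"
  by (simp add: pos_e_def E.pos_iff)

lemma pos_cstar: "a \<in> tot \<Longrightarrow> E.pos (bstar A a \<cdot>\<^bsub>A\<^esub> a)"
  using pos_e_cstar by (simp add: pos_e_iff)

lemma bnorm_bstar:
  assumes "a \<in> tot" shows "bnorm A (bstar A a) = bnorm A a"
proof -
  have le: "bnorm A y \<le> bnorm A (bstar A y)" if "y \<in> tot" for y
  proof -
    have "bnorm A y * bnorm A y \<le> bnorm A (bstar A y) * bnorm A y"
      using bnorm_cstar[of y] bnorm_bmul[of "bstar A y" y] that by (simp add: power2_eq_square)
    moreover have "0 \<le> bnorm A y" "0 \<le> bnorm A (bstar A y)" using that by (simp_all add: tot_norm_ge_0)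
    ultimately show ?thesis by (metis mult_right_le_imp_le order_le_less)
  qed
  show ?thesis using le[of a] le[of "bstar A a"] assms by simp
qed

lemma bmul_zero:
  assumes "g \<in> carrier G" "h \<in> carrier G" "a \<in> fib A g"
  shows "a \<cdot>\<^bsub>A\<^esub> bzero A h = bzero A (g \<otimes> h)"
proof -
  have "a \<cdot>\<^bsub>A\<^esub> (0 \<odot>\<^bsub>A\<^esub> bzero A h) = 0 \<odot>\<^bsub>A\<^esub> (a \<cdot>\<^bsub>A\<^esub> bzero A h)"
    using assms by (intro bmul_sm) (auto intro: fib_tot)
  then show ?thesis using assms by (simp add: sm_0_fib[of h] sm_0_fib[of "g \<otimes> h"] fib_mul)
qed

text \<open>The norm of \<open>u a - a\<close> is computed from \<open>aa\<^sup>*\<close>, which lies in the unit fibre.\<close>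

lemma unit_bmul [simp]:
  assumes "a \<in> tot" shows "u \<cdot>\<^bsub>A\<^esub> a = a"
proof -
  obtain g where g: "g \<in> carrier G" "a \<in> fib A g" using assms by (auto simp: tot_def)
  have ut: "u \<in> tot" using unit_fib fib_tot by blast
  have ua: "u \<cdot>\<^bsub>A\<^esub> a \<in> fib A g" by (rule fib_mul[OF _ g(1) unit_fib g(2)]) (simp_all add: g)
  let ?d = "u \<cdot>\<^bsub>A\<^esub> a \<oplus>\<^bsub>A\<^esub> (-1) \<odot>\<^bsub>A\<^esub> a"
  have d: "?d \<in> fib A g" using g ua by (intro fib_add fib_sm)
  have st: "bstar A a \<in> fib A (inv g)" by (rule fib_star[OF g refl])
  have e: "a \<cdot>\<^bsub>A\<^esub> bstar A a \<in> fib A \<one>" by (rule fib_mul[OF g(1) _ g(2) st]) (simp_all add: g)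
  have "?d \<cdot>\<^bsub>A\<^esub> bstar A a = u \<cdot>\<^bsub>A\<^esub> a \<cdot>\<^bsub>A\<^esub> bstar A a \<oplus>\<^bsub>A\<^esub> ((-1) \<odot>\<^bsub>A\<^esub> a) \<cdot>\<^bsub>A\<^esub> bstar A a"
    using g ua st by (intro add_bmul[of g "inv g"] fib_sm) auto
  also have "\<dots> = bzero A \<one>"
    using assms e ut by (simp add: sm_bmul bmul_assoc)
  finally have z: "?d \<cdot>\<^bsub>A\<^esub> bstar A a = bzero A \<one>" .
  have dt: "?d \<in> tot" using d g fib_tot by blast
  have "bstar A ?d = bstar A a \<cdot>\<^bsub>A\<^esub> u \<oplus>\<^bsub>A\<^esub> (-1) \<odot>\<^bsub>A\<^esub> bstar A a"
    using g ua assms ut by (subst bstar_add[of g]) (auto simp: fib_sm bstar_bmul bstar_sm)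
  then have "?d \<cdot>\<^bsub>A\<^esub> bstar A ?d = ?d \<cdot>\<^bsub>A\<^esub> (bstar A a \<cdot>\<^bsub>A\<^esub> u \<oplus>\<^bsub>A\<^esub> (-1) \<odot>\<^bsub>A\<^esub> bstar A a)"
    by (rule arg_cong)
  also have "\<dots> = ?d \<cdot>\<^bsub>A\<^esub> (bstar A a \<cdot>\<^bsub>A\<^esub> u) \<oplus>\<^bsub>A\<^esub> ?d \<cdot>\<^bsub>A\<^esub> ((-1) \<odot>\<^bsub>A\<^esub> bstar A a)"
  proof (rule bmul_add[of "inv g" g])
    show "bstar A a \<cdot>\<^bsub>A\<^esub> u \<in> fib A (inv g)"
      by (rule fib_mul[OF _ _ st unit_fib]) (simp_all add: g)
  qed (use g d st fib_sm in simp_all)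
  also have "\<dots> = bzero A \<one>"
    using z dt ut assms by (simp add: bmul_sm flip: bmul_assoc)
  finally have "bnorm A (bstar A ?d) = 0"
    using bnorm_cstar[of "bstar A ?d"] dt by simp
  then have "?d = bzero A g" using bnorm_bstar[OF dt] bnorm_eq_0[OF g(1) d] by simp
  then show ?thesis using cvec.eq_if_diff_zero[OF cvec_fib[OF g(1)] ua g(2)] by simp
qed

lemma bmul_unit [simp]:
  assumes "a \<in> tot" shows "a \<cdot>\<^bsub>A\<^esub> u = a"
proof -
  have "u \<in> tot" using unit_fib fib_tot by blast
  then have "bstar A (a \<cdot>\<^bsub>A\<^esub> u) = bstar A a"
    using assms \<open>u \<in> tot\<close> by (simp add: bstar_bmul)
  then show ?thesis using assms \<open>u \<in> tot\<close> bstar_bstar tot_mul by metis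
qed

end

section \<open>Completion of pre-Hilbert bundles\<close>

lemma (in group) inv_cancel_left [simp]:
  assumes "x \<in> carrier G" "y \<in> carrier G"
  shows "inv x \<otimes> (x \<otimes> y) = y" "x \<otimes> (inv x \<otimes> y) = y"
  using assms by (simp_all flip: m_assoc)

text \<open>The fibres \<open>L r\<close> are not assumed to be vector spaces, since the model
  consists of lists with concatenation as addition. The operations are linear only as seen by the
  inner product, which may also be degenerate; the completion repairs both.\<close>

locale pre_hilbert = ufell H B u
  for H :: "'h monoid" (structure) and B :: "('h, 'b) fbundle" and u :: 'b +
  fixes L :: "'h \<Rightarrow> 'l set" and ladd :: "'l \<Rightarrow> 'l \<Rightarrow> 'l" and lsm :: "complex \<Rightarrow> 'l \<Rightarrow> 'l"
    and lzero :: "'h \<Rightarrow> 'l" and lmul :: "'l \<Rightarrow> 'b \<Rightarrow> 'l" and lip :: "'l \<Rightarrow> 'l \<Rightarrow> 'b"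
  assumes ladd_closed: "r \<in> carrier H \<Longrightarrow> x \<in> L r \<Longrightarrow> y \<in> L r \<Longrightarrow> ladd x y \<in> L r"
    and lsm_closed: "r \<in> carrier H \<Longrightarrow> x \<in> L r \<Longrightarrow> lsm c x \<in> L r"
    and lzero_closed: "r \<in> carrier H \<Longrightarrow> lzero r \<in> L r"
    and lmul_closed: "r \<in> carrier H \<Longrightarrow> s \<in> carrier H \<Longrightarrow> x \<in> L r \<Longrightarrow> b \<in> fib B s \<Longrightarrow> lmul x b \<in> L (r \<otimes> s)"
    and L_disjoint: "r \<in> carrier H \<Longrightarrow> s \<in> carrier H \<Longrightarrow> x \<in> L r \<Longrightarrow> x \<in> L s \<Longrightarrow> r = s"
    and lip_fib: "r \<in> carrier H \<Longrightarrow> s \<in> carrier H \<Longrightarrow> x \<in> L r \<Longrightarrow> y \<in> L s \<Longrightarrow> lip x y \<in> fib B (inv r \<otimes> s)"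
    and lip_ladd: "r \<in> carrier H \<Longrightarrow> s \<in> carrier H \<Longrightarrow> x \<in> L r \<Longrightarrow> y \<in> L s \<Longrightarrow> y' \<in> L s \<Longrightarrow>
      lip x (ladd y y') = lip x y \<oplus>\<^bsub>B\<^esub> lip x y'"
    and lip_lsm: "r \<in> carrier H \<Longrightarrow> s \<in> carrier H \<Longrightarrow> x \<in> L r \<Longrightarrow> y \<in> L s \<Longrightarrow>
      lip x (lsm c y) = c \<odot>\<^bsub>B\<^esub> lip x y"
    and lip_lzero: "r \<in> carrier H \<Longrightarrow> s \<in> carrier H \<Longrightarrow> x \<in> L r \<Longrightarrow> lip x (lzero s) = bzero B (inv r \<otimes> s)"
    and lip_lmul: "r \<in> carrier H \<Longrightarrow> s \<in> carrier H \<Longrightarrow> t \<in> carrier H \<Longrightarrow> x \<in> L r \<Longrightarrow> y \<in> L s \<Longrightarrow> b \<in> fib B t \<Longrightarrow>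
      lip x (lmul y b) = lip x y \<cdot>\<^bsub>B\<^esub> b"
    and lip_star: "r \<in> carrier H \<Longrightarrow> s \<in> carrier H \<Longrightarrow> x \<in> L r \<Longrightarrow> y \<in> L s \<Longrightarrow> bstar B (lip x y) = lip y x"
    and lip_pos: "r \<in> carrier H \<Longrightarrow> x \<in> L r \<Longrightarrow> E.pos (lip x x)"
begin

section \<open>The seminorm and the Cauchy-Schwarz inequality\<close>

definition lnorm :: "'l \<Rightarrow> real" where
  "lnorm x = sqrt (bnorm B (lip x x))"

definition ldiff :: "'l \<Rightarrow> 'l \<Rightarrow> 'l" where
  "ldiff x y = ladd x (lsm (-1) y)"

abbreviation bminus (infixl "\<ominus>" 65) where "a \<ominus> b \<equiv> a \<oplus>\<^bsub>B\<^esub> (-1) \<odot>\<^bsub>B\<^esub> b"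

lemma ldiff_closed: "r \<in> carrier H \<Longrightarrow> x \<in> L r \<Longrightarrow> y \<in> L r \<Longrightarrow> ldiff x y \<in> L r"
  by (simp add: ldiff_def ladd_closed lsm_closed)

lemma lip_ldiff:
  assumes "r \<in> carrier H" "s \<in> carrier H" "x \<in> L r" "y \<in> L s" "y' \<in> L s"
  shows "lip x (ldiff y y') = lip x y \<ominus> lip x y'"
  using assms by (simp add: ldiff_def lip_ladd[of r s] lip_lsm[of r s] lsm_closed)

lemma lip_ladd_left:
  assumes "r \<in> carrier H" "s \<in> carrier H" "x \<in> L r" "x' \<in> L r" "y \<in> L s"
  shows "lip (ladd x x') y = lip x y \<oplus>\<^bsub>B\<^esub> lip x' y"
proof -
  have "bstar B (lip y (ladd x x')) = bstar B (lip y x) \<oplus>\<^bsub>B\<^esub> bstar B (lip y x')"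
    using assms by (simp add: lip_ladd[of s r] bstar_add[of "inv s \<otimes> r"] lip_fib)
  then show ?thesis using assms by (simp add: lip_star[of s r] ladd_closed)
qed

lemma lip_tot: "r \<in> carrier H \<Longrightarrow> s \<in> carrier H \<Longrightarrow> x \<in> L r \<Longrightarrow> y \<in> L s \<Longrightarrow> lip x y \<in> tot"
  using lip_fib[of r s x y] fib_tot[of "inv r \<otimes> s"] by simp

lemma lip_lsm_left:
  assumes "r \<in> carrier H" "s \<in> carrier H" "x \<in> L r" "y \<in> L s"
  shows "lip (lsm c x) y = cnj c \<odot>\<^bsub>B\<^esub> lip x y"
proof -
  have "bstar B (lip y (lsm c x)) = cnj c \<odot>\<^bsub>B\<^esub> bstar B (lip y x)"
    using assms by (simp add: lip_lsm[of s r] bstar_sm lip_tot[of s r])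
  then show ?thesis using assms by (simp add: lip_star[of s r] lsm_closed)
qed

lemma lip_lmul_left:
  assumes "r \<in> carrier H" "s \<in> carrier H" "t \<in> carrier H" "x \<in> L r" "y \<in> L s" "b \<in> fib B t"
  shows "lip (lmul x b) y = bstar B b \<cdot>\<^bsub>B\<^esub> lip x y"
proof -
  have "bstar B (lip y (lmul x b)) = bstar B b \<cdot>\<^bsub>B\<^esub> bstar B (lip y x)"
    using assms fib_tot[of t b] by (simp add: lip_lmul[of s r t] bstar_bmul lip_tot[of s r])
  then show ?thesis using assms by (simp add: lip_star[of s "r \<otimes> t"] lip_star[of s r] lmul_closed)
qed

lemma lip_self_fib: "r \<in> carrier H \<Longrightarrow> x \<in> L r \<Longrightarrow> lip x x \<in> fib B \<one>"
  using lip_fib[of r r x x] by simp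

lemma lnorm_ge_0 [simp]: "r \<in> carrier H \<Longrightarrow> x \<in> L r \<Longrightarrow> 0 \<le> lnorm x"
  using E.nrm_ge_0[OF lip_self_fib] by (simp add: lnorm_def)

lemma lnorm_sq: "r \<in> carrier H \<Longrightarrow> x \<in> L r \<Longrightarrow> (lnorm x)\<^sup>2 = bnorm B (lip x x)"
  using E.nrm_ge_0[OF lip_self_fib] by (simp add: lnorm_def)

text \<open>As t u - Q = c^* c with c in the unit fibre, the element is (c b)^* (c b), which is
  positive by the Fell bundle axiom although b lies in an arbitrary fibre.\<close>

lemma bnorm_conj_le:
  assumes s: "s \<in> carrier H" "b \<in> fib B s" and Q: "E.pos Q" "bnorm B Q \<le> t"
  shows "E.pos (complex_of_real t \<odot>\<^bsub>B\<^esub> (bstar B b \<cdot>\<^bsub>B\<^esub> b) \<ominus> bstar B b \<cdot>\<^bsub>B\<^esub> (Q \<cdot>\<^bsub>B\<^esub> b))"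
proof -
  have "E.pos (complex_of_real t \<odot>\<^bsub>B\<^esub> u \<ominus> Q)" using Q by (rule E.pos_nrm_minus)
  then obtain c where c: "c \<in> fib B \<one>" "complex_of_real t \<odot>\<^bsub>B\<^esub> u \<ominus> Q = bstar B c \<cdot>\<^bsub>B\<^esub> c"
    unfolding E.pos_iff by blast
  have ct: "c \<in> tot" "b \<in> tot" "u \<in> tot" "Q \<in> tot"
    using c s fib_tot[OF _ c(1)] fib_tot[OF s] fib_tot[OF _ unit_fib] fib_tot[OF _ E.pos_closed[OF Q(1)]]
    by simp_all
  have bs: "bstar B b \<in> fib B (inv s)" using fib_star[OF s refl] .
  have Qb: "Q \<cdot>\<^bsub>B\<^esub> b \<in> fib B s" by (rule fib_mul[OF _ s(1) E.pos_closed[OF Q(1)] s(2)]) (simp_all add: s)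
  have "bstar B (c \<cdot>\<^bsub>B\<^esub> b) \<cdot>\<^bsub>B\<^esub> (c \<cdot>\<^bsub>B\<^esub> b) = bstar B b \<cdot>\<^bsub>B\<^esub> ((bstar B c \<cdot>\<^bsub>B\<^esub> c) \<cdot>\<^bsub>B\<^esub> b)"
    using ct by (simp add: bstar_bmul bmul_assoc)
  also have "(bstar B c \<cdot>\<^bsub>B\<^esub> c) \<cdot>\<^bsub>B\<^esub> b = complex_of_real t \<odot>\<^bsub>B\<^esub> b \<ominus> Q \<cdot>\<^bsub>B\<^esub> b"
    unfolding c(2)[symmetric] using ct s Q
    by (subst add_bmul[of \<one> s]) (simp_all add: sm_bmul fib_sm unit_fib)
  also have "bstar B b \<cdot>\<^bsub>B\<^esub> (complex_of_real t \<odot>\<^bsub>B\<^esub> b \<ominus> Q \<cdot>\<^bsub>B\<^esub> b) =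
      complex_of_real t \<odot>\<^bsub>B\<^esub> (bstar B b \<cdot>\<^bsub>B\<^esub> b) \<ominus> bstar B b \<cdot>\<^bsub>B\<^esub> (Q \<cdot>\<^bsub>B\<^esub> b)"
    using ct s bs Qb by (subst bmul_add[of s "inv s"]) (simp_all add: bmul_sm fib_sm)
  finally show ?thesis using pos_cstar[of "c \<cdot>\<^bsub>B\<^esub> b"] ct by simp
qed

text \<open>For b = <y, x> and t > 0 at least the norm of <y, y>, expand the positive element <x - y
  b/t, x - y b/t> and add the positive element b^* (t - <y, y>) b / t^2. The sum is <x, x> - b^* b /
  t, so ||b||^2 <= t ||<x, x>||. Then t tends to the norm of <y, y>.\<close>

lemma cauchy_schwarz:
  assumes r: "r \<in> carrier H" "x \<in> L r" and s: "s \<in> carrier H" "y \<in> L s"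
  shows "bnorm B (lip x y) \<le> lnorm x * lnorm y"
proof -
  let ?P = "lip x x" and ?Q = "lip y y"
  define b where "b = lip y x"
  have b: "b \<in> fib B (inv s \<otimes> r)" and g: "inv s \<otimes> r \<in> carrier H"
    unfolding b_def using r s by (simp_all add: lip_fib)
  have bst: "bstar B b = lip x y" unfolding b_def using r s by (simp add: lip_star[of s r])
  have P: "E.pos ?P" "E.pos ?Q" using r s by (auto intro: lip_pos)
  have bt: "b \<in> tot" using fib_tot[OF g b] .
  let ?R = "bstar B b \<cdot>\<^bsub>B\<^esub> b"
  have R: "E.pos ?R" using pos_cstar[OF bt] .
  have yb: "lmul y b \<in> L r" using lmul_closed[OF s(1) g s(2) b] r s by simp
  have main: "(bnorm B b)\<^sup>2 \<le> t * bnorm B ?P" if t: "t > 0" "bnorm B ?Q \<le> t" for t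
  proof -
    define k where "k = complex_of_real (- 1 / t)"
    let ?w = "ladd x (lsm k (lmul y b))"
    let ?Z = "bstar B b \<cdot>\<^bsub>B\<^esub> (?Q \<cdot>\<^bsub>B\<^esub> b)"
    have Z: "?Z \<in> fib B \<one>"
    proof (rule fib_mul[of "inv (inv s \<otimes> r)" "inv s \<otimes> r"])
      show "?Q \<cdot>\<^bsub>B\<^esub> b \<in> fib B (inv s \<otimes> r)"
        by (rule fib_mul[OF _ g E.pos_closed[OF P(2)] b]) (use g in simp_all)
    qed (use g b fib_star[OF g b refl] in simp_all)
    have kk: "k * cnj k = complex_of_real (1 / t\<^sup>2)" "cnj k = k"
      by (simp_all add: k_def power2_eq_square)
    have e1: "lip (lmul y b) (lmul y b) = ?Z"
      using lip_lmul[OF r(1) s(1) g yb s(2) b] lip_lmul_left[OF s(1) s(1) g s(2) s(2) b] bt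
        lip_tot[OF s(1) s(1) s(2) s(2)] by (simp add: bmul_assoc)
    have e2: "lip x (lmul y b) = ?R"
      using lip_lmul[OF r(1) s(1) g r(2) s(2) b] bst by simp
    have e3: "lip (lmul y b) x = ?R"
      using lip_lmul_left[OF s(1) r(1) g s(2) r(2) b] by (simp add: b_def)
    have kl: "lsm k (lmul y b) \<in> L r" using lsm_closed[OF r(1) yb] .
    have kw: "?w \<in> L r" using ladd_closed[OF r kl] .
    have "lip ?w ?w = (?P \<oplus>\<^bsub>B\<^esub> k \<odot>\<^bsub>B\<^esub> ?R) \<oplus>\<^bsub>B\<^esub> (k \<odot>\<^bsub>B\<^esub> ?R \<oplus>\<^bsub>B\<^esub> k \<odot>\<^bsub>B\<^esub> (k \<odot>\<^bsub>B\<^esub> ?Z))"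
      using lip_ladd[OF r(1) r(1) kw r(2) kl] lip_ladd_left[OF r(1) r(1) r(2) kl r(2)]
        lip_ladd_left[OF r(1) r(1) r(2) kl kl]
        lip_lsm[OF r(1) r(1) r(2) yb] lip_lsm_left[OF r(1) r(1) yb r(2)]
        lip_lsm_left[OF r(1) r(1) yb kl] lip_lsm[OF r(1) r(1) yb yb] e1 e2 e3 kk
      by (simp add: kk)
    then have w: "E.pos ((?P \<oplus>\<^bsub>B\<^esub> k \<odot>\<^bsub>B\<^esub> ?R) \<oplus>\<^bsub>B\<^esub> (k \<odot>\<^bsub>B\<^esub> ?R \<oplus>\<^bsub>B\<^esub> k \<odot>\<^bsub>B\<^esub> (k \<odot>\<^bsub>B\<^esub> ?Z)))"
      using lip_pos[OF r(1) kw] by simp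
    have "E.pos (complex_of_real (1 / t\<^sup>2) \<odot>\<^bsub>B\<^esub> (complex_of_real t \<odot>\<^bsub>B\<^esub> ?R \<ominus> ?Z))"
      by (intro E.pos_sm bnorm_conj_le[OF g b P(2) t(2)]) simp
    note E.pos_add[OF w this]
    also have "((?P \<oplus>\<^bsub>B\<^esub> k \<odot>\<^bsub>B\<^esub> ?R) \<oplus>\<^bsub>B\<^esub> (k \<odot>\<^bsub>B\<^esub> ?R \<oplus>\<^bsub>B\<^esub> k \<odot>\<^bsub>B\<^esub> (k \<odot>\<^bsub>B\<^esub> ?Z)))
        \<oplus>\<^bsub>B\<^esub> (complex_of_real (1 / t\<^sup>2) \<odot>\<^bsub>B\<^esub> (complex_of_real t \<odot>\<^bsub>B\<^esub> ?R \<ominus> ?Z))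
      = ?P \<ominus> complex_of_real (1 / t) \<odot>\<^bsub>B\<^esub> ?R"
      by (intro E.vec_eqI)
        ((rule E.rp_rules | simp add: E.pos_closed[OF P(1)] E.pos_closed[OF R] Z k_def power2_eq_square
            algebra_simps less_imp_neq[OF t(1), symmetric])+)
    finally have p: "E.pos (?P \<ominus> complex_of_real (1 / t) \<odot>\<^bsub>B\<^esub> ?R)" .
    have "E.pos (complex_of_real (1 / t) \<odot>\<^bsub>B\<^esub> ?R)" using R t by (intro E.pos_sm) auto
    from E.nrm_mono[OF this _ p] P have "bnorm B (complex_of_real (1 / t) \<odot>\<^bsub>B\<^esub> ?R) \<le> bnorm B ?P" by simp
    then have "(1 / t) * (bnorm B b)\<^sup>2 \<le> bnorm B ?P"
      using E.pos_closed[OF R] t bnorm_cstar[OF bt] by (simp add: norm_divide)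
    then show ?thesis using t by (simp add: field_simps)
  qed
  have bb: "bnorm B (lip x y) = bnorm B b"
    using bnorm_bstar[OF bt] bst by simp
  have "(bnorm B b)\<^sup>2 \<le> bnorm B ?Q * bnorm B ?P + e" if e: "e > 0" for e
  proof -
    \<comment> \<open>The excess over the norm is chosen so that, multiplied by the norm of <x, x>,
      it is at most e.\<close>
    let ?t = "bnorm B ?Q + e / (bnorm B ?P + 1)"
    have nn: "0 \<le> bnorm B ?P" "0 \<le> bnorm B ?Q" using P by simp_all
    have pos: "0 < e / (bnorm B ?P + 1)" using nn e by (intro divide_pos_pos) linarith+
    have "(bnorm B b)\<^sup>2 \<le> ?t * bnorm B ?P"
      by (rule main) (use nn pos in linarith)+
    also have "\<dots> = bnorm B ?Q * bnorm B ?P + e * (bnorm B ?P / (bnorm B ?P + 1))"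
      by (simp add: algebra_simps)
    also have "e * (bnorm B ?P / (bnorm B ?P + 1)) \<le> e * 1"
      using e nn by (intro mult_left_mono) simp_all
    finally show ?thesis by simp
  qed
  then have "(bnorm B b)\<^sup>2 \<le> bnorm B ?Q * bnorm B ?P" by (rule field_le_epsilon)
  also have "\<dots> = (lnorm x * lnorm y)\<^sup>2"
    using r s by (simp add: power_mult_distrib lnorm_sq)
  finally have "bnorm B b \<le> lnorm x * lnorm y"
    by (rule power2_le_imp_le) (use r s in simp)
  then show ?thesis using bb by simp
qed

text \<open>Since \<open>ladd y (ldiff x y)\<close> need not be x, the inequality is obtained from
  <x, x> = <x, y> + <x, x - y>, the Cauchy-Schwarz inequality and division by the seminorm of
  x.\<close>

lemma lnorm_le_ldiff:
  assumes r: "r \<in> carrier H" "x \<in> L r" "y \<in> L r"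
  shows "lnorm x \<le> lnorm y + lnorm (ldiff x y)"
proof -
  let ?d = "ldiff x y"
  have d: "?d \<in> L r" using r by (intro ldiff_closed)
  have f: "lip x x \<in> fib B \<one>" "lip x y \<in> fib B \<one>"
    using r lip_fib[of r r] by simp_all
  have "lip x x = lip x y \<oplus>\<^bsub>B\<^esub> lip x ?d"
    unfolding lip_ldiff[OF r(1) r(1) r(2) r(2) r(3)]
    by (intro E.vec_eqI) ((rule E.rp_rules | simp add: f)+)
  then have "bnorm B (lip x x) \<le> bnorm B (lip x y) + bnorm B (lip x ?d)"
    using f r d lip_fib[of r r x ?d] by (auto intro!: E.nrm_add)
  also have "\<dots> \<le> lnorm x * lnorm y + lnorm x * lnorm ?d"
    using r d by (intro add_mono cauchy_schwarz)
  finally have "lnorm x * lnorm x \<le> lnorm x * (lnorm y + lnorm ?d)"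
    using lnorm_sq[OF r(1,2)] by (simp add: power2_eq_square algebra_simps)
  moreover have "0 \<le> lnorm x" "0 \<le> lnorm y" "0 \<le> lnorm ?d" using r d by (simp_all add: lnorm_ge_0[of r])
  ultimately show ?thesis
    by (metis add_nonneg_nonneg mult_left_le_imp_le order_le_less)
qed

section \<open>Points of the completion as functionals\<close>

definition Lall :: "'l set" where
  "Lall = (\<Union>r\<in>carrier H. L r)"

lemma LallI [intro]: "r \<in> carrier H \<Longrightarrow> x \<in> L r \<Longrightarrow> x \<in> Lall"
  by (auto simp: Lall_def)

text \<open>Closeness in the operator norm, expressed before functionals have a norm of their
  own.\<close>

definition close :: "real \<Rightarrow> ('l \<Rightarrow> 'b) \<Rightarrow> 'l \<Rightarrow> bool" where
  "close e F x \<longleftrightarrow> (\<forall>s\<in>carrier H. \<forall>z\<in>L s. bnorm B (F z \<ominus> lip z x) \<le> e * lnorm z)"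

text \<open>A point \<open>x\<close> of the completion is encoded by the functional \<open>z \<mapsto> \<langle>z, x\<rangle>\<close> on the
  pre-Hilbert bundle, so that no equivalence classes of Cauchy sequences are needed.\<close>

definition X :: "'h \<Rightarrow> ('l \<Rightarrow> 'b) set" where
  "X r = {F \<in> extensional Lall. (\<forall>s\<in>carrier H. \<forall>z\<in>L s. F z \<in> fib B (inv s \<otimes> r)) \<and>
    (\<forall>e>0. \<exists>x\<in>L r. close e F x)}"

lemma closeD: "close e F x \<Longrightarrow> s \<in> carrier H \<Longrightarrow> z \<in> L s \<Longrightarrow> bnorm B (F z \<ominus> lip z x) \<le> e * lnorm z"
  by (auto simp: close_def)

lemma X_fib: "F \<in> X r \<Longrightarrow> s \<in> carrier H \<Longrightarrow> z \<in> L s \<Longrightarrow> F z \<in> fib B (inv s \<otimes> r)"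
  by (auto simp: X_def)

lemma X_approx: "F \<in> X r \<Longrightarrow> e > 0 \<Longrightarrow> \<exists>x\<in>L r. close e F x"
  by (auto simp: X_def)

lemma X_eqI: "F \<in> X r \<Longrightarrow> F' \<in> X r \<Longrightarrow> (\<And>s z. s \<in> carrier H \<Longrightarrow> z \<in> L s \<Longrightarrow> F z = F' z) \<Longrightarrow> F = F'"
  by (rule extensionalityI[of _ Lall]) (auto simp: X_def Lall_def)

lemma XI:
  assumes "F \<in> extensional Lall" "\<And>s z. s \<in> carrier H \<Longrightarrow> z \<in> L s \<Longrightarrow> F z \<in> fib B (inv s \<otimes> r)"
    "\<And>e. e > 0 \<Longrightarrow> \<exists>x\<in>L r. close e F x"
  shows "F \<in> X r"
  using assms by (auto simp: X_def)

lemma bnorm_triangle3: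
  assumes "k \<in> carrier H" "a \<in> fib B k" "b \<in> fib B k" "c \<in> fib B k"
  shows "bnorm B (a \<ominus> c) \<le> bnorm B (a \<ominus> b) + bnorm B (b \<ominus> c)"
  using cvec.nrm_diff_triangle[OF cvec_fib] assms by blast

lemma bnorm_commute:
  "k \<in> carrier H \<Longrightarrow> a \<in> fib B k \<Longrightarrow> b \<in> fib B k \<Longrightarrow> bnorm B (a \<ominus> b) = bnorm B (b \<ominus> a)"
  using cvec.nrm_minus_commute[OF cvec_fib] by blast

lemma bnorm_le_diff:
  "k \<in> carrier H \<Longrightarrow> a \<in> fib B k \<Longrightarrow> b \<in> fib B k \<Longrightarrow> bnorm B a \<le> bnorm B b + bnorm B (a \<ominus> b)"
  using cvec.nrm_le_diff[OF cvec_fib] by blast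

lemma fib_diff: "k \<in> carrier H \<Longrightarrow> a \<in> fib B k \<Longrightarrow> b \<in> fib B k \<Longrightarrow> a \<ominus> b \<in> fib B k"
  by (intro fib_add fib_sm)

lemma bnorm_diff2:
  assumes k: "k \<in> carrier H" and f: "a \<in> fib B k" "b \<in> fib B k" "a' \<in> fib B k" "b' \<in> fib B k"
  shows "bnorm B ((a \<oplus>\<^bsub>B\<^esub> b) \<ominus> (a' \<oplus>\<^bsub>B\<^esub> b')) \<le> bnorm B (a \<ominus> a') + bnorm B (b \<ominus> b')"
proof -
  have "(a \<oplus>\<^bsub>B\<^esub> b) \<ominus> (a' \<oplus>\<^bsub>B\<^esub> b') = (a \<ominus> a') \<oplus>\<^bsub>B\<^esub> (b \<ominus> b')"
    by (intro fib_eqI[OF k]) ((rule fib_rp[OF k] | simp add: f)+)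
  then show ?thesis using bnorm_add[OF k fib_diff fib_diff] k f by simp
qed

lemma bnorm_diff_sm:
  assumes k: "k \<in> carrier H" and f: "a \<in> fib B k" "b \<in> fib B k"
  shows "bnorm B (c \<odot>\<^bsub>B\<^esub> a \<ominus> c \<odot>\<^bsub>B\<^esub> b) = cmod c * bnorm B (a \<ominus> b)"
proof -
  have "c \<odot>\<^bsub>B\<^esub> a \<ominus> c \<odot>\<^bsub>B\<^esub> b = c \<odot>\<^bsub>B\<^esub> (a \<ominus> b)"
    by (intro fib_eqI[OF k]) ((rule fib_rp[OF k] | simp add: f)+)
  then show ?thesis using bnorm_sm[OF k fib_diff] k f by simp
qed

lemma fib_eq_small:
  assumes "k \<in> carrier H" "a \<in> fib B k" "b \<in> fib B k"
    "\<And>e. e > 0 \<Longrightarrow> e \<le> 1 \<Longrightarrow> bnorm B (a \<ominus> b) \<le> c * e"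
  shows "a = b"
  using cvec.eq_if_nrm_small[OF cvec_fib] assms by blast

text \<open>Additivity in z is inherited from the approximants: each z \<mapsto> <z, x> is additive,
  and F is a limit of such maps.\<close>

lemma X_ladd:
  assumes F: "F \<in> X r" "r \<in> carrier H" and s: "s \<in> carrier H" "z \<in> L s" "z' \<in> L s"
  shows "F (ladd z z') = F z \<oplus>\<^bsub>B\<^esub> F z'"
proof (rule fib_eq_small)
  have l: "ladd z z' \<in> L s" using s by (intro ladd_closed)
  show k: "inv s \<otimes> r \<in> carrier H" using F s by simp
  show f: "F (ladd z z') \<in> fib B (inv s \<otimes> r)" "F z \<oplus>\<^bsub>B\<^esub> F z' \<in> fib B (inv s \<otimes> r)"
    using F s l k by (auto intro!: X_fib fib_add)
  fix e :: real assume e: "e > 0"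
  then obtain x where x: "x \<in> L r" "close e F x" using X_approx F by blast
  have m: "lip z x \<in> fib B (inv s \<otimes> r)" "lip z' x \<in> fib B (inv s \<otimes> r)"
    "F z \<in> fib B (inv s \<otimes> r)" "F z' \<in> fib B (inv s \<otimes> r)"
    using F s x by (auto intro: lip_fib X_fib)
  have "bnorm B (F (ladd z z') \<ominus> (F z \<oplus>\<^bsub>B\<^esub> F z')) \<le>
      bnorm B (F (ladd z z') \<ominus> lip (ladd z z') x) + bnorm B (lip (ladd z z') x \<ominus> (F z \<oplus>\<^bsub>B\<^esub> F z'))"
    using F s x l f by (intro bnorm_triangle3[OF k]) (auto intro: lip_fib)
  also have "bnorm B (lip (ladd z z') x \<ominus> (F z \<oplus>\<^bsub>B\<^esub> F z')) \<le>
      bnorm B (F z \<ominus> lip z x) + bnorm B (F z' \<ominus> lip z' x)"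
    unfolding lip_ladd_left[OF s(1) F(2) s(2,3) x(1)]
      bnorm_commute[OF k m(3,1)] bnorm_commute[OF k m(4,2)]
    by (rule bnorm_diff2[OF k]) (use m in auto)
  finally show "bnorm B (F (ladd z z') \<ominus> (F z \<oplus>\<^bsub>B\<^esub> F z')) \<le> (lnorm (ladd z z') + (lnorm z + lnorm z')) * e"
    using closeD[OF x(2) s(1) l] closeD[OF x(2) s(1,2)] closeD[OF x(2) s(1,3)]
    by (simp add: algebra_simps)
qed

lemma X_lsm:
  assumes F: "F \<in> X r" "r \<in> carrier H" and s: "s \<in> carrier H" "z \<in> L s"
  shows "F (lsm c z) = cnj c \<odot>\<^bsub>B\<^esub> F z"
proof (rule fib_eq_small)
  have l: "lsm c z \<in> L s" using s by (intro lsm_closed)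
  show k: "inv s \<otimes> r \<in> carrier H" using F s by simp
  show f: "F (lsm c z) \<in> fib B (inv s \<otimes> r)" "cnj c \<odot>\<^bsub>B\<^esub> F z \<in> fib B (inv s \<otimes> r)"
    using F s l k by (auto intro!: X_fib fib_sm)
  fix e :: real assume e: "e > 0"
  then obtain x where x: "x \<in> L r" "close e F x" using X_approx F by blast
  have m: "lip z x \<in> fib B (inv s \<otimes> r)" "F z \<in> fib B (inv s \<otimes> r)"
    using F s x by (auto intro: lip_fib X_fib)
  have "bnorm B (F (lsm c z) \<ominus> cnj c \<odot>\<^bsub>B\<^esub> F z) \<le>
      bnorm B (F (lsm c z) \<ominus> lip (lsm c z) x) + bnorm B (lip (lsm c z) x \<ominus> cnj c \<odot>\<^bsub>B\<^esub> F z)"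
    using F s x l f by (intro bnorm_triangle3[OF k]) (auto intro: lip_fib)
  also have "bnorm B (lip (lsm c z) x \<ominus> cnj c \<odot>\<^bsub>B\<^esub> F z) = cmod c * bnorm B (F z \<ominus> lip z x)"
    unfolding lip_lsm_left[OF s(1) F(2) s(2) x(1)] bnorm_commute[OF k m(2,1)]
    by (subst bnorm_diff_sm[OF k m]) simp
  also have "\<dots> \<le> cmod c * (e * lnorm z)"
    using closeD[OF x(2) s] by (rule mult_left_mono) simp
  finally show "bnorm B (F (lsm c z) \<ominus> cnj c \<odot>\<^bsub>B\<^esub> F z) \<le> (lnorm (lsm c z) + cmod c * lnorm z) * e"
    using closeD[OF x(2) s(1) l] by (simp add: algebra_simps)
qed

lemma X_ldiff:
  assumes F: "F \<in> X r" "r \<in> carrier H" and s: "s \<in> carrier H" "z \<in> L s" "z' \<in> L s"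
  shows "F (ldiff z z') = F z \<ominus> F z'"
  using assms by (simp add: ldiff_def X_ladd[OF F s(1)] X_lsm[OF F s(1)] lsm_closed)

lemma close_bound:
  assumes F: "F \<in> X r" "r \<in> carrier H" and x: "x \<in> L r" "close e F x"
    and s: "s \<in> carrier H" "z \<in> L s"
  shows "bnorm B (F z) \<le> (lnorm x + e) * lnorm z"
proof -
  have "bnorm B (F z) \<le> bnorm B (lip z x) + bnorm B (F z \<ominus> lip z x)"
    using F s x by (intro bnorm_le_diff[of "inv s \<otimes> r"] X_fib lip_fib) auto
  also have "\<dots> \<le> lnorm z * lnorm x + e * lnorm z"
    using F s x by (intro add_mono cauchy_schwarz closeD)
  finally show ?thesis by (simp add: algebra_simps)
qed

text \<open>Evaluate F at d = x - y: both <d, x> and <d, y> are close to F d, and their difference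
  is <d, d>, so that one factor ||d|| cancels.\<close>

lemma close_dist:
  assumes F: "F \<in> X r" "r \<in> carrier H" and x: "x \<in> L r" "close e F x" and y: "y \<in> L r" "close e' F y"
    and nonneg: "0 \<le> e" "0 \<le> e'"
  shows "lnorm (ldiff x y) \<le> e + e'"
proof -
  let ?d = "ldiff x y"
  have d: "?d \<in> L r" using F x y by (intro ldiff_closed)
  have k: "inv r \<otimes> r \<in> carrier H" using F by simp
  note m = X_fib[OF F(1) F(2) d] lip_fib[OF F(2) F(2) d x(1)] lip_fib[OF F(2) F(2) d y(1)]
  have "bnorm B (lip ?d ?d) = bnorm B (lip ?d x \<ominus> lip ?d y)"
    using F x y d by (simp add: lip_ldiff[of r r])
  also have "\<dots> \<le> bnorm B (F ?d \<ominus> lip ?d x) + bnorm B (F ?d \<ominus> lip ?d y)"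
    using bnorm_triangle3[OF k m(2,1,3)] bnorm_commute[OF k m(1,2)] by simp
  also have "\<dots> \<le> e * lnorm ?d + e' * lnorm ?d"
    using F x y d by (intro add_mono closeD)
  finally have "lnorm ?d * lnorm ?d \<le> (e + e') * lnorm ?d"
    using lnorm_sq[OF F(2) d] by (simp add: power2_eq_square algebra_simps)
  then show ?thesis
    using nonneg lnorm_ge_0[OF F(2) d] by (cases "lnorm ?d = 0") auto
qed

section \<open>The inner product of functionals\<close>

text \<open>The inner product is the limit of F' x as x approaches F. A linear rate is demanded so
  that the algebraic laws follow by combining constants, without a choice of sequences.\<close>

definition is_ip :: "'h \<Rightarrow> 'h \<Rightarrow> ('l \<Rightarrow> 'b) \<Rightarrow> ('l \<Rightarrow> 'b) \<Rightarrow> 'b \<Rightarrow> bool" where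
  "is_ip r s F F' w \<longleftrightarrow> w \<in> fib B (inv r \<otimes> s) \<and>
    (\<exists>C. \<forall>e>0. \<forall>x\<in>L r. close e F x \<longrightarrow> bnorm B (w \<ominus> F' x) \<le> C * e)"

definition fip :: "'h \<Rightarrow> 'h \<Rightarrow> ('l \<Rightarrow> 'b) \<Rightarrow> ('l \<Rightarrow> 'b) \<Rightarrow> 'b" where
  "fip r s F F' = (THE w. is_ip r s F F' w)"

lemma is_ip_unique:
  assumes F: "F \<in> X r" "r \<in> carrier H" "F' \<in> X s" "s \<in> carrier H"
    and w: "is_ip r s F F' w" "is_ip r s F F' w'"
  shows "w = w'"
proof -
  obtain C where C: "w \<in> fib B (inv r \<otimes> s)" "\<And>e x. e > 0 \<Longrightarrow> x \<in> L r \<Longrightarrow> close e F x \<Longrightarrow> bnorm B (w \<ominus> F' x) \<le> C * e"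
    using w(1) by (auto simp: is_ip_def)
  obtain C' where C': "w' \<in> fib B (inv r \<otimes> s)" "\<And>e x. e > 0 \<Longrightarrow> x \<in> L r \<Longrightarrow> close e F x \<Longrightarrow> bnorm B (w' \<ominus> F' x) \<le> C' * e"
    using w(2) by (auto simp: is_ip_def)
  have k: "inv r \<otimes> s \<in> carrier H" using F by simp
  show ?thesis
  proof (rule fib_eq_small[OF k C(1) C'(1)])
    fix e :: real assume e: "e > 0"
    then obtain x where x: "x \<in> L r" "close e F x" using X_approx F by blast
    have f: "F' x \<in> fib B (inv r \<otimes> s)" by (rule X_fib[OF F(3,2) x(1)])
    show "bnorm B (w \<ominus> w') \<le> (C + C') * e"
      using bnorm_triangle3[OF k C(1) f C'(1)] bnorm_commute[OF k f C'(1)] C(2)[OF e x] C'(2)[OF e x]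
      by (simp add: algebra_simps)
  qed
qed

text \<open>F' is bounded, and two approximants of F are close to each other by
  \<open>close_dist\<close>. So F' takes Cauchy values along approximants with errors 1/(n+1), and
  the fibre of B is complete.\<close>

lemma is_ip_exists:
  assumes F: "F \<in> X r" "r \<in> carrier H" "F' \<in> X s" "s \<in> carrier H"
  shows "\<exists>w. is_ip r s F F' w"
proof -
  have k: "inv r \<otimes> s \<in> carrier H" using F by simp
  interpret V: cvec "fib B (inv r \<otimes> s)" "badd B" "bsm B" "bzero B (inv r \<otimes> s)" "bnorm B"
    by (rule cvec_fib[OF k])
  \<comment> \<open>One approximant of F' at distance 1 already bounds F' as an operator.\<close>
  obtain y where y: "y \<in> L s" "close 1 F' y" using X_approx[OF F(3), of 1] by auto
  define C where "C = lnorm y + 1"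
  have C: "0 \<le> C" using F y by (simp add: C_def lnorm_ge_0[of s] add_nonneg_nonneg)
  have dist: "bnorm B (F' x \<ominus> F' x') \<le> C * (e + e')"
    if "e > 0" "e' > 0" "x \<in> L r" "close e F x" "x' \<in> L r" "close e' F x'" for e e' x x'
  proof -
    have "bnorm B (F' x \<ominus> F' x') = bnorm B (F' (ldiff x x'))"
      by (simp add: X_ldiff[OF F(3,4,2) that(3,5)])
    also have "\<dots> \<le> C * lnorm (ldiff x x')"
      unfolding C_def by (rule close_bound[OF F(3,4) y F(2)]) (use F that in \<open>simp add: ldiff_closed\<close>)
    also have "\<dots> \<le> C * (e + e')"
      by (rule mult_left_mono[OF close_dist[OF F(1,2) that(3-6)] C]) (use that in simp_all)
    finally show ?thesis .
  qed
  have pos: "0 < 1 / (real n + 1)" for n by simp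
  obtain x where x: "\<And>n. x n \<in> L r" "\<And>n. close (1 / (real n + 1)) F (x n)"
    using X_approx[OF F(1) pos] by metis
  have cl: "F' (x n) \<in> fib B (inv r \<otimes> s)" for n by (rule X_fib[OF F(3,2) x(1)])
  have "\<exists>l\<in>fib B (inv r \<otimes> s). (\<lambda>n. bnorm B (F' (x n) \<ominus> l)) \<longlonglongrightarrow> 0"
  proof (rule V.complete[OF cl])
    fix e :: real assume e: "e > 0"
    have "(\<lambda>n. C * (1 / (real n + 1))) \<longlonglongrightarrow> 0" using tendsto_mult_right_zero[OF LIMSEQ_one_over] .
    then have "eventually (\<lambda>n. C * (1 / (real n + 1)) < e / 2) sequentially"
      using e by (intro order_tendstoD) auto
    then obtain N where N: "\<And>n. n \<ge> N \<Longrightarrow> C * (1 / (real n + 1)) < e / 2"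
      by (auto simp: eventually_sequentially)
    have "bnorm B (F' (x m) \<ominus> F' (x n)) < e" if "m \<ge> N" "n \<ge> N" for m n
      using dist[OF pos pos x(1) x(2) x(1) x(2), of m n] N[OF that(1)] N[OF that(2)]
      unfolding distrib_left by linarith
    then show "\<exists>N. \<forall>m\<ge>N. \<forall>n\<ge>N. bnorm B (F' (x m) \<ominus> F' (x n)) < e" by blast
  qed
  then obtain w where w: "w \<in> fib B (inv r \<otimes> s)" "(\<lambda>n. bnorm B (F' (x n) \<ominus> w)) \<longlonglongrightarrow> 0" by blast
  have "bnorm B (w \<ominus> F' v) \<le> C * e" if "e > 0" "v \<in> L r" "close e F v" for e v
  proof -
    have f: "F' v \<in> fib B (inv r \<otimes> s)" by (rule X_fib[OF F(3,2) that(2)])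
    have "bnorm B (w \<ominus> F' v) \<le> bnorm B (F' (x n) \<ominus> w) + C * (1 / (real n + 1) + e)" for n
      using bnorm_triangle3[OF k w(1) cl[of n] f] bnorm_commute[OF k w(1) cl[of n]]
        dist[OF pos that(1) x(1) x(2) that(2,3), of n] by linarith
    moreover have "(\<lambda>n. bnorm B (F' (x n) \<ominus> w) + C * (1 / (real n + 1) + e)) \<longlonglongrightarrow> 0 + C * (0 + e)"
      by (intro tendsto_intros w LIMSEQ_one_over)
    ultimately show ?thesis
      using LIMSEQ_le_const[of _ "0 + C * (0 + e)" "bnorm B (w \<ominus> F' v)"] by fastforce
  qed
  then show ?thesis unfolding is_ip_def using w(1) by blast
qed

lemma is_ip_fip:
  assumes "F \<in> X r" "r \<in> carrier H" "F' \<in> X s" "s \<in> carrier H"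
  shows "is_ip r s F F' (fip r s F F')"
  unfolding fip_def using is_ip_exists[OF assms] is_ip_unique[OF assms] theI' by metis

lemma fip_fib:
  assumes "F \<in> X r" "r \<in> carrier H" "F' \<in> X s" "s \<in> carrier H"
  shows "fip r s F F' \<in> fib B (inv r \<otimes> s)"
  using is_ip_fip[OF assms] by (simp add: is_ip_def)

lemma fip_limit:
  assumes "F \<in> X r" "r \<in> carrier H" "F' \<in> X s" "s \<in> carrier H"
  obtains C where "0 \<le> C"
    "\<And>e x. e > 0 \<Longrightarrow> x \<in> L r \<Longrightarrow> close e F x \<Longrightarrow> bnorm B (fip r s F F' \<ominus> F' x) \<le> C * e"
proof -
  obtain C where C: "\<And>e x. e > 0 \<Longrightarrow> x \<in> L r \<Longrightarrow> close e F x \<Longrightarrow> bnorm B (fip r s F F' \<ominus> F' x) \<le> C * e"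
    using is_ip_fip[OF assms] by (auto simp: is_ip_def)
  show thesis
  proof (rule that[of "\<bar>C\<bar>"])
    fix e x assume "(e::real) > 0" "x \<in> L r" "close e F x"
    from C[OF this] mult_right_mono[OF abs_ge_self[of C], of e] \<open>e > 0\<close>
    show "bnorm B (fip r s F F' \<ominus> F' x) \<le> \<bar>C\<bar> * e" by linarith
  qed simp
qed

lemma fip_eqI:
  assumes "F \<in> X r" "r \<in> carrier H" "F' \<in> X s" "s \<in> carrier H" and "w \<in> fib B (inv r \<otimes> s)"
    and "\<And>e x. e > 0 \<Longrightarrow> x \<in> L r \<Longrightarrow> close e F x \<Longrightarrow> bnorm B (w \<ominus> F' x) \<le> C * e"
  shows "fip r s F F' = w"
  by (rule is_ip_unique[OF assms(1-4) is_ip_fip[OF assms(1-4)]])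
    (use assms(5,6) in \<open>auto simp: is_ip_def\<close>)

definition fnorm :: "'h \<Rightarrow> ('l \<Rightarrow> 'b) \<Rightarrow> real" where
  "fnorm r F = sqrt (bnorm B (fip r r F F))"

text \<open>The elements <F, F'> and <x, y> are compared through F' x. The second error is e ||x||;
  a fixed approximant of F at distance 1 bounds ||x|| uniformly, and this is where e <= 1
  enters.\<close>

lemma fip_lip_limit:
  assumes F: "F \<in> X r" "r \<in> carrier H" "F' \<in> X s" "s \<in> carrier H"
  obtains C where "0 \<le> C"
    "\<And>e x y. e > 0 \<Longrightarrow> e \<le> 1 \<Longrightarrow> x \<in> L r \<Longrightarrow> close e F x \<Longrightarrow> y \<in> L s \<Longrightarrow> close e F' y \<Longrightarrow>
      bnorm B (fip r s F F' \<ominus> lip x y) \<le> C * e"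
proof -
  have k: "inv r \<otimes> s \<in> carrier H" using F by simp
  obtain C where C: "0 \<le> C"
    "\<And>e x. e > 0 \<Longrightarrow> x \<in> L r \<Longrightarrow> close e F x \<Longrightarrow> bnorm B (fip r s F F' \<ominus> F' x) \<le> C * e"
    using fip_limit[OF F] by metis
  obtain v where v: "v \<in> L r" "close 1 F v" using X_approx[OF F(1), of 1] by auto
  have v0: "0 \<le> lnorm v" using lnorm_ge_0[OF F(2) v(1)] .
  show thesis
  proof (rule that[of "C + (lnorm v + 2)"])
    fix e x y assume e: "(e::real) > 0" "e \<le> 1" and x: "x \<in> L r" "close e F x" and y: "y \<in> L s" "close e F' y"
    note m = fip_fib[OF F] X_fib[OF F(3,2) x(1)] lip_fib[OF F(2,4) x(1) y(1)]
    have "lnorm x \<le> lnorm v + lnorm (ldiff x v)" by (rule lnorm_le_ldiff[OF F(2) x(1) v(1)])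
    also have "lnorm (ldiff x v) \<le> e + 1" by (rule close_dist[OF F(1,2) x v]) (use e in simp_all)
    finally have "lnorm x \<le> lnorm v + 2" using e by simp
    then have "e * lnorm x \<le> e * (lnorm v + 2)" using e by (intro mult_left_mono) auto
    then show "bnorm B (fip r s F F' \<ominus> lip x y) \<le> (C + (lnorm v + 2)) * e"
      using bnorm_triangle3[OF k m] C(2)[OF e(1) x] closeD[OF y(2) F(2) x(1)]
      by (simp add: algebra_simps)
  qed (use C v0 in simp)
qed

lemma fip_star:
  assumes F: "F \<in> X r" "r \<in> carrier H" "F' \<in> X s" "s \<in> carrier H"
  shows "bstar B (fip r s F F') = fip s r F' F"
proof -
  have k: "inv r \<otimes> s \<in> carrier H" "inv s \<otimes> r \<in> carrier H" using F by simp_all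
  have i: "inv (inv r \<otimes> s) = inv s \<otimes> r" using F by (simp add: inv_mult_group)
  obtain C where C: "0 \<le> C"
    "\<And>e x y. e > 0 \<Longrightarrow> e \<le> 1 \<Longrightarrow> x \<in> L r \<Longrightarrow> close e F x \<Longrightarrow> y \<in> L s \<Longrightarrow> close e F' y \<Longrightarrow>
      bnorm B (fip r s F F' \<ominus> lip x y) \<le> C * e"
    using fip_lip_limit[OF F] by metis
  obtain C' where C': "0 \<le> C'"
    "\<And>e x y. e > 0 \<Longrightarrow> e \<le> 1 \<Longrightarrow> x \<in> L s \<Longrightarrow> close e F' x \<Longrightarrow> y \<in> L r \<Longrightarrow> close e F y \<Longrightarrow>
      bnorm B (fip s r F' F \<ominus> lip x y) \<le> C' * e"
    using fip_lip_limit[OF F(3,4,1,2)] by metis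
  have st: "bstar B (fip r s F F') \<in> fib B (inv s \<otimes> r)"
    using fib_star[OF k(1) fip_fib[OF F] i] .
  show ?thesis
  proof (rule fib_eq_small[OF k(2) st fip_fib[OF F(3,4,1,2)]])
    fix e :: real assume e: "e > 0" "e \<le> 1"
    obtain x where x: "x \<in> L r" "close e F x" using X_approx[OF F(1) e(1)] by blast
    obtain y where y: "y \<in> L s" "close e F' y" using X_approx[OF F(3) e(1)] by blast
    note m = lip_fib[OF F(2,4) x(1) y(1)] lip_fib[OF F(4,2) y(1) x(1)]
    have d: "fip r s F F' \<ominus> lip x y \<in> fib B (inv r \<otimes> s)" using k fip_fib[OF F] m by (intro fib_diff)
    have "bstar B (fip r s F F') \<ominus> lip y x = bstar B (fip r s F F' \<ominus> lip x y)"
      using k fip_fib[OF F] m lip_star[OF F(2,4) x(1) y(1)] fib_tot[OF k(1) m(1)]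
      by (simp add: bstar_add[of "inv r \<otimes> s"] fib_sm bstar_sm)
    then have "bnorm B (bstar B (fip r s F F') \<ominus> lip y x) \<le> C * e"
      using bnorm_bstar[OF fib_tot[OF k(1) d]] C(2)[OF e x y] by simp
    then show "bnorm B (bstar B (fip r s F F') \<ominus> fip s r F' F) \<le> (C + C') * e"
      using bnorm_triangle3[OF k(2) st m(2) fip_fib[OF F(3,4,1,2)]] C'(2)[OF e y x]
        bnorm_commute[OF k(2) m(2) fip_fib[OF F(3,4,1,2)]] by (simp add: algebra_simps)
  qed
qed

lemma fip_self_fib: "F \<in> X r \<Longrightarrow> r \<in> carrier H \<Longrightarrow> fip r r F F \<in> fib B \<one>"
  using fip_fib[of F r F r] by simp

lemma fip_pos:
  assumes F: "F \<in> X r" "r \<in> carrier H"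
  shows "E.pos (fip r r F F)"
proof (rule E.pos_limit[OF fip_self_fib[OF F]])
  fix e :: real assume e: "e > 0"
  obtain C where C: "0 \<le> C"
    "\<And>e x y. e > 0 \<Longrightarrow> e \<le> 1 \<Longrightarrow> x \<in> L r \<Longrightarrow> close e F x \<Longrightarrow> y \<in> L r \<Longrightarrow> close e F y \<Longrightarrow>
      bnorm B (fip r r F F \<ominus> lip x y) \<le> C * e"
    using fip_lip_limit[OF F F] by metis
  let ?d = "min 1 (e / (C + 1))"
  have d: "0 < ?d" "?d \<le> 1" using e C(1) by simp_all
  obtain x where x: "x \<in> L r" "close ?d F x" using X_approx[OF F(1) d(1)] by blast
  have "bnorm B (fip r r F F \<ominus> lip x x) \<le> C * ?d" by (rule C(2)[OF d x x])
  also have "\<dots> \<le> C * (e / (C + 1))" using C(1) by (intro mult_left_mono) auto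
  also have "\<dots> \<le> e" using e C(1) by (simp add: field_simps)
  finally show "\<exists>h. E.pos h \<and> bnorm B (h \<ominus> fip r r F F) \<le> e"
    using lip_pos[OF F(2) x(1)] bnorm_commute[OF one_closed lip_self_fib[OF F(2) x(1)] fip_self_fib[OF F]]
    by auto
qed

section \<open>The norm of a functional\<close>

lemma fnorm_ge_0: "F \<in> X r \<Longrightarrow> r \<in> carrier H \<Longrightarrow> 0 \<le> fnorm r F"
  using E.nrm_ge_0[OF fip_self_fib] by (simp add: fnorm_def)

lemma X_sequence:
  assumes F: "F \<in> X r" "r \<in> carrier H"
  obtains x where "\<And>n::nat. x n \<in> L r" "\<And>n. close (1 / (real n + 1)) F (x n)"
    "(\<lambda>n. lnorm (x n)) \<longlonglongrightarrow> fnorm r F"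
proof -
  have pos: "0 < 1 / (real n + 1)" for n by simp
  obtain x where x: "\<And>n. x n \<in> L r" "\<And>n. close (1 / (real n + 1)) F (x n)"
    using X_approx[OF F(1) pos] by metis
  obtain C where C: "0 \<le> C"
    "\<And>e x y. e > 0 \<Longrightarrow> e \<le> 1 \<Longrightarrow> x \<in> L r \<Longrightarrow> close e F x \<Longrightarrow> y \<in> L r \<Longrightarrow> close e F y \<Longrightarrow>
      bnorm B (fip r r F F \<ominus> lip x y) \<le> C * e"
    using fip_lip_limit[OF F F] by metis
  have "\<bar>bnorm B (lip (x n) (x n)) - bnorm B (fip r r F F)\<bar> \<le> C * (1 / (real n + 1))" for n
  proof -
    note m = lip_self_fib[OF F(2) x(1)[of n]] fip_self_fib[OF F]
    have "bnorm B (fip r r F F \<ominus> lip (x n) (x n)) \<le> C * (1 / (real n + 1))"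
      by (rule C(2)[OF pos _ x x]) (simp add: field_simps)
    then show ?thesis using bnorm_le_diff[OF one_closed m] bnorm_le_diff[OF one_closed m(2,1)]
      bnorm_commute[OF one_closed m] by linarith
  qed
  then have "(\<lambda>n. \<bar>bnorm B (lip (x n) (x n)) - bnorm B (fip r r F F)\<bar>) \<longlonglongrightarrow> 0"
    by (intro real_tendsto_sandwich[OF _ _ tendsto_const[of 0] tendsto_mult_right_zero[OF LIMSEQ_one_over, of C]]
        always_eventually allI) simp_all
  then have "(\<lambda>n. bnorm B (lip (x n) (x n)) - bnorm B (fip r r F F)) \<longlonglongrightarrow> 0"
    by (rule tendsto_rabs_zero_cancel)
  then have "(\<lambda>n. bnorm B (lip (x n) (x n))) \<longlonglongrightarrow> bnorm B (fip r r F F)"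
    by (simp add: LIM_zero_iff)
  then have "(\<lambda>n. lnorm (x n)) \<longlonglongrightarrow> fnorm r F"
    unfolding lnorm_def fnorm_def by (rule tendsto_real_sqrt)
  then show thesis using that x by blast
qed

lemma fnorm_close:
  assumes F: "F \<in> X r" "r \<in> carrier H" and x: "x \<in> L r" "close e F x" "e > 0"
  shows "fnorm r F \<le> lnorm x + e" "lnorm x \<le> fnorm r F + e"
proof -
  obtain y where y: "\<And>n::nat. y n \<in> L r" "\<And>n. close (1 / (real n + 1)) F (y n)"
    "(\<lambda>n. lnorm (y n)) \<longlonglongrightarrow> fnorm r F"
    using X_sequence[OF F] by blast
  have d: "lnorm (ldiff x (y n)) \<le> e + 1 / (real n + 1)"  "lnorm (ldiff (y n) x) \<le> 1 / (real n + 1) + e" for n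
    by (rule close_dist[OF F]; use x y in simp)+
  have le: "lnorm (y n) \<le> lnorm x + (1 / (real n + 1) + e)" "lnorm x \<le> lnorm (y n) + (1 / (real n + 1) + e)" for n
    using d[of n] lnorm_le_ldiff[OF F(2) x(1) y(1)[of n]] lnorm_le_ldiff[OF F(2) y(1)[of n] x(1)]
    by linarith+
  have "(\<lambda>n. lnorm x + (1 / (real n + 1) + e)) \<longlonglongrightarrow> lnorm x + (0 + e)"
    "(\<lambda>n. lnorm (y n) + (1 / (real n + 1) + e)) \<longlonglongrightarrow> fnorm r F + (0 + e)"
    by (intro tendsto_intros LIMSEQ_one_over y)+
  then show "fnorm r F \<le> lnorm x + e" "lnorm x \<le> fnorm r F + e"
    using LIMSEQ_le[OF y(3), of _ "lnorm x + (0 + e)"] le(1)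
      LIMSEQ_le_const[of _ "fnorm r F + (0 + e)" "lnorm x"] le(2) by fastforce+
qed

text \<open>With \<open>fnorm_le\<close> this identifies the norm coming from the inner product with
  the operator norm, so that the triangle inequality and completeness can be proved
  pointwise.\<close>

lemma X_bound:
  assumes F: "F \<in> X r" "r \<in> carrier H" and s: "s \<in> carrier H" "z \<in> L s"
  shows "bnorm B (F z) \<le> fnorm r F * lnorm z"
proof (rule field_le_epsilon)
  fix e :: real assume e: "e > 0"
  have z: "0 \<le> lnorm z" using s by simp
  \<comment> \<open>Two errors of this size occur, each multiplied by ||z||; adding 1 avoids
    division by zero.\<close>
  let ?d = "e / (lnorm z + 1) / 2"
  have d: "0 < ?d" using e z by simp
  obtain x where x: "x \<in> L r" "close ?d F x" using X_approx[OF F(1) d] by blast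
  have "bnorm B (F z) \<le> (lnorm x + ?d) * lnorm z" by (rule close_bound[OF F x s])
  also have "\<dots> \<le> (fnorm r F + ?d + ?d) * lnorm z"
    using fnorm_close(2)[OF F x d] z by (intro mult_right_mono) auto
  also have "\<dots> = fnorm r F * lnorm z + e * (lnorm z / (lnorm z + 1))"
    unfolding add.assoc field_sum_of_halves by (simp add: distrib_right)
  also have "\<dots> \<le> fnorm r F * lnorm z + e * 1"
    using e z by (intro add_left_mono mult_left_mono) simp_all
  finally show "bnorm B (F z) \<le> fnorm r F * lnorm z + e" by simp
qed

lemma fnorm_le:
  assumes F: "F \<in> X r" "r \<in> carrier H" and e: "e \<ge> 0"
    and le: "\<And>s z. s \<in> carrier H \<Longrightarrow> z \<in> L s \<Longrightarrow> bnorm B (F z) \<le> e * lnorm z"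
  shows "fnorm r F \<le> e"
proof (rule field_le_epsilon)
  fix d :: real assume d: "d > 0"
  obtain x where x: "x \<in> L r" "close (d / 2) F x" using X_approx[OF F(1), of "d / 2"] d by auto
  note m = X_fib[OF F(1,2) x(1)] lip_fib[OF F(2,2) x(1,1)]
  have k: "inv r \<otimes> r \<in> carrier H" using F by simp
  have "bnorm B (lip x x) \<le> bnorm B (F x) + bnorm B (F x \<ominus> lip x x)"
    using bnorm_le_diff[OF k m(2,1)] bnorm_commute[OF k m] by simp
  also have "\<dots> \<le> e * lnorm x + d / 2 * lnorm x"
    using F x by (intro add_mono le closeD)
  finally have "lnorm x * lnorm x \<le> (e + d / 2) * lnorm x"
    using lnorm_sq[OF F(2) x(1)] by (simp add: power2_eq_square algebra_simps)
  then have "lnorm x \<le> e + d / 2"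
    using lnorm_ge_0[OF F(2) x(1)] e d by (cases "lnorm x = 0") auto
  then show "fnorm r F \<le> e + d" using fnorm_close(1)[OF F x] d by simp
qed

section \<open>Operations on functionals\<close>

definition fadd :: "('l \<Rightarrow> 'b) \<Rightarrow> ('l \<Rightarrow> 'b) \<Rightarrow> 'l \<Rightarrow> 'b" where
  "fadd F F' = (\<lambda>z\<in>Lall. F z \<oplus>\<^bsub>B\<^esub> F' z)"

definition fsm :: "complex \<Rightarrow> ('l \<Rightarrow> 'b) \<Rightarrow> 'l \<Rightarrow> 'b" where
  "fsm c F = (\<lambda>z\<in>Lall. c \<odot>\<^bsub>B\<^esub> F z)"

definition fmul :: "('l \<Rightarrow> 'b) \<Rightarrow> 'b \<Rightarrow> 'l \<Rightarrow> 'b" where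
  "fmul F b = (\<lambda>z\<in>Lall. F z \<cdot>\<^bsub>B\<^esub> b)"

definition emb :: "'l \<Rightarrow> 'l \<Rightarrow> 'b" where
  "emb x = (\<lambda>z\<in>Lall. lip z x)"

lemma fun_apply [simp]:
  assumes "s \<in> carrier H" "z \<in> L s"
  shows "fadd F F' z = F z \<oplus>\<^bsub>B\<^esub> F' z" "fsm c F z = c \<odot>\<^bsub>B\<^esub> F z" "fmul F b z = F z \<cdot>\<^bsub>B\<^esub> b"
    "emb x z = lip z x"
  using LallI[OF assms] by (simp_all add: fadd_def fsm_def fmul_def emb_def)

lemma fun_extensional [simp]:
  "fadd F F' \<in> extensional Lall" "fsm c F \<in> extensional Lall" "fmul F b \<in> extensional Lall"
  "emb x \<in> extensional Lall"
  by (simp_all add: fadd_def fsm_def fmul_def emb_def)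

lemma close_emb:
  assumes "r \<in> carrier H" "x \<in> L r" "e \<ge> 0"
  shows "close e (emb x) x"
  unfolding close_def
proof (intro ballI)
  fix s z assume s: "s \<in> carrier H" "z \<in> L s"
  have k: "inv s \<otimes> r \<in> carrier H" using s assms by simp
  have "emb x z \<ominus> lip z x = bzero B (inv s \<otimes> r)"
    using cvec.diff_self[OF cvec_fib[OF k]] lip_fib[OF s(1) assms(1) s(2) assms(2)] s by simp
  then show "bnorm B (emb x z \<ominus> lip z x) \<le> e * lnorm z"
    using cvec.nrm_zero[OF cvec_fib[OF k]] assms s by simp
qed

lemma X_emb: "r \<in> carrier H \<Longrightarrow> x \<in> L r \<Longrightarrow> emb x \<in> X r"
  by (rule XI) (auto intro: lip_fib close_emb[OF _ _ less_imp_le])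

lemma X_fadd:
  assumes F: "F \<in> X r" "r \<in> carrier H" "F' \<in> X r"
  shows "fadd F F' \<in> X r"
proof (rule XI)
  fix s z assume s: "s \<in> carrier H" "z \<in> L s"
  then show "fadd F F' z \<in> fib B (inv s \<otimes> r)"
    using fib_add[OF _ X_fib[OF F(1) s] X_fib[OF F(3) s]] F(2) by simp
next
  fix e :: real assume e: "e > 0"
  obtain x where x: "x \<in> L r" "close (e / 2) F x" using X_approx[OF F(1), of "e / 2"] e by auto
  obtain y where y: "y \<in> L r" "close (e / 2) F' y" using X_approx[OF F(3), of "e / 2"] e by auto
  have "close e (fadd F F') (ladd x y)"
    unfolding close_def
  proof (intro ballI)
    fix s z assume s: "s \<in> carrier H" "z \<in> L s"
    have k: "inv s \<otimes> r \<in> carrier H" using s F by simp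
    have "bnorm B (fadd F F' z \<ominus> lip z (ladd x y)) \<le> bnorm B (F z \<ominus> lip z x) + bnorm B (F' z \<ominus> lip z y)"
      using s lip_ladd[OF s(1) F(2) s(2) x(1) y(1)]
        bnorm_diff2[OF k X_fib[OF F(1) s] X_fib[OF F(3) s] lip_fib[OF s(1) F(2) s(2) x(1)]
          lip_fib[OF s(1) F(2) s(2) y(1)]] by simp
    then show "bnorm B (fadd F F' z \<ominus> lip z (ladd x y)) \<le> e * lnorm z"
      using closeD[OF x(2) s] closeD[OF y(2) s] by (simp add: field_simps)
  qed
  then show "\<exists>x\<in>L r. close e (fadd F F') x" using ladd_closed[OF F(2) x(1) y(1)] by blast
qed simp

lemma close_fsm:
  assumes F: "F \<in> X r" "r \<in> carrier H" and x: "x \<in> L r" "close e F x"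
  shows "close (cmod c * e) (fsm c F) (lsm c x)"
  unfolding close_def
proof (intro ballI)
  fix s z assume s: "s \<in> carrier H" "z \<in> L s"
  have k: "inv s \<otimes> r \<in> carrier H" using s F by simp
  have "bnorm B (fsm c F z \<ominus> lip z (lsm c x)) = cmod c * bnorm B (F z \<ominus> lip z x)"
    using s lip_lsm[OF s(1) F(2) s(2) x(1)]
      bnorm_diff_sm[OF k X_fib[OF F(1) s] lip_fib[OF s(1) F(2) s(2) x(1)]] by simp
  then show "bnorm B (fsm c F z \<ominus> lip z (lsm c x)) \<le> cmod c * e * lnorm z"
    using mult_left_mono[OF closeD[OF x(2) s], of "cmod c"] by (simp add: mult.assoc)
qed

lemma close_mono: "close e F x \<Longrightarrow> e \<le> e' \<Longrightarrow> close e' F x"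
  unfolding close_def by (meson lnorm_ge_0 mult_right_mono order_trans)

text \<open>Scalar multiplication, right multiplication and the action all enlarge approximation
  errors by a fixed factor k. As k may be 0, the error is divided by k + 1.\<close>

lemma approx_scale:
  assumes F: "F \<in> X r" and k: "k \<ge> 0" and e: "e > 0"
    and scale: "\<And>d x. d > 0 \<Longrightarrow> x \<in> L r \<Longrightarrow> close d F x \<Longrightarrow> \<exists>y\<in>L t. close (k * d) F' y"
  shows "\<exists>y\<in>L t. close e F' y"
proof -
  have d: "0 < e / (k + 1)" using k e by simp
  obtain x where x: "x \<in> L r" "close (e / (k + 1)) F x" using X_approx[OF F d] by blast
  have "k * (e / (k + 1)) \<le> e" using k e by (simp add: field_simps)
  then show ?thesis using scale[OF d x] close_mono by blast
qed

lemma X_fsm: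
  assumes F: "F \<in> X r" "r \<in> carrier H"
  shows "fsm c F \<in> X r"
proof (rule XI)
  fix s z assume s: "s \<in> carrier H" "z \<in> L s"
  then show "fsm c F z \<in> fib B (inv s \<otimes> r)" using F by (auto intro!: fib_sm X_fib)
next
  fix e :: real assume "e > 0"
  then show "\<exists>x\<in>L r. close e (fsm c F) x"
    by (rule approx_scale[OF F(1) norm_ge_zero[of c]]) (use close_fsm[OF F] lsm_closed[OF F(2)] in blast)
qed simp

lemma X_fmul:
  assumes F: "F \<in> X r" "r \<in> carrier H" and t: "t \<in> carrier H" "b \<in> fib B t"
  shows "fmul F b \<in> X (r \<otimes> t)"
proof (rule XI)
  fix s z assume s: "s \<in> carrier H" "z \<in> L s"
  show "fmul F b z \<in> fib B (inv s \<otimes> (r \<otimes> t))"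
    using s fib_mul[OF _ t(1) X_fib[OF F(1) s] t(2)] F t by (simp add: m_assoc)
next
  fix e :: real assume e: "e > 0"
  have bt: "b \<in> tot" using fib_tot[OF t] .
  show "\<exists>x\<in>L (r \<otimes> t). close e (fmul F b) x"
  proof (rule approx_scale[OF F(1) tot_norm_ge_0[OF bt] e])
    fix d x assume x: "x \<in> L r" "close d F x"
    have "close (bnorm B b * d) (fmul F b) (lmul x b)"
      unfolding close_def
    proof (intro ballI)
      fix s z assume s: "s \<in> carrier H" "z \<in> L s"
      have k: "inv s \<otimes> r \<in> carrier H" using s F by simp
      note m = X_fib[OF F(1) s] lip_fib[OF s(1) F(2) s(2) x(1)]
      have "fmul F b z \<ominus> lip z (lmul x b) = (F z \<ominus> lip z x) \<cdot>\<^bsub>B\<^esub> b"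
        using s lip_lmul[OF s(1) F(2) t(1) s(2) x(1) t(2)] add_bmul[OF k t(1) m(1) fib_sm[OF k m(2)] t(2)]
          sm_bmul[OF fib_tot[OF k m(2)] bt] by simp
      then have "bnorm B (fmul F b z \<ominus> lip z (lmul x b)) \<le> bnorm B (F z \<ominus> lip z x) * bnorm B b"
        using bnorm_bmul[OF fib_tot[OF k fib_diff[OF k m]] bt] by simp
      also have "\<dots> \<le> d * lnorm z * bnorm B b"
        by (rule mult_right_mono[OF closeD[OF x(2) s] tot_norm_ge_0[OF bt]])
      finally show "bnorm B (fmul F b z \<ominus> lip z (lmul x b)) \<le> bnorm B b * d * lnorm z"
        by (simp add: mult.commute mult.left_commute)
    qed
    then show "\<exists>y\<in>L (r \<otimes> t). close (bnorm B b * d) (fmul F b) y"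
      using lmul_closed[OF F(2) t(1) x(1) t(2)] by blast
  qed
qed simp

lemma fip_fadd:
  assumes F: "F \<in> X r" "r \<in> carrier H" and s: "F1 \<in> X s" "F2 \<in> X s" "s \<in> carrier H"
  shows "fip r s F (fadd F1 F2) = fip r s F F1 \<oplus>\<^bsub>B\<^esub> fip r s F F2"
proof -
  have k: "inv r \<otimes> s \<in> carrier H" using F s by simp
  obtain C1 where C1: "\<And>e x. e > 0 \<Longrightarrow> x \<in> L r \<Longrightarrow> close e F x \<Longrightarrow> bnorm B (fip r s F F1 \<ominus> F1 x) \<le> C1 * e"
    using fip_limit[OF F s(1,3)] by metis
  obtain C2 where C2: "\<And>e x. e > 0 \<Longrightarrow> x \<in> L r \<Longrightarrow> close e F x \<Longrightarrow> bnorm B (fip r s F F2 \<ominus> F2 x) \<le> C2 * e"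
    using fip_limit[OF F s(2,3)] by metis
  note m = fip_fib[OF F s(1,3)] fip_fib[OF F s(2,3)]
  show ?thesis
  proof (rule fip_eqI[OF F X_fadd[OF s(1,3,2)] s(3) fib_add[OF k m], where C = "C1 + C2"])
    fix e x assume e: "(e::real) > 0" and x: "x \<in> L r" "close e F x"
    show "bnorm B ((fip r s F F1 \<oplus>\<^bsub>B\<^esub> fip r s F F2) \<ominus> fadd F1 F2 x) \<le> (C1 + C2) * e"
      using bnorm_diff2[OF k m X_fib[OF s(1) F(2) x(1)] X_fib[OF s(2) F(2) x(1)]] C1[OF e x] C2[OF e x]
        F(2) x(1) by (simp add: distrib_right)
  qed
qed

lemma fip_fsm:
  assumes F: "F \<in> X r" "r \<in> carrier H" and s: "F1 \<in> X s" "s \<in> carrier H"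
  shows "fip r s F (fsm c F1) = c \<odot>\<^bsub>B\<^esub> fip r s F F1"
proof -
  have k: "inv r \<otimes> s \<in> carrier H" using F s by simp
  obtain C where C: "\<And>e x. e > 0 \<Longrightarrow> x \<in> L r \<Longrightarrow> close e F x \<Longrightarrow> bnorm B (fip r s F F1 \<ominus> F1 x) \<le> C * e"
    using fip_limit[OF F s] by metis
  note m = fip_fib[OF F s]
  show ?thesis
  proof (rule fip_eqI[OF F X_fsm[OF s] s(2) fib_sm[OF k m], where C = "cmod c * C"])
    fix e x assume e: "(e::real) > 0" and x: "x \<in> L r" "close e F x"
    show "bnorm B (c \<odot>\<^bsub>B\<^esub> fip r s F F1 \<ominus> fsm c F1 x) \<le> cmod c * C * e"
      using bnorm_diff_sm[OF k m X_fib[OF s(1) F(2) x(1)], of c] mult_left_mono[OF C[OF e x], of "cmod c"]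
        F(2) x(1) by (simp add: mult.assoc)
  qed
qed

lemma fip_fmul:
  assumes F: "F \<in> X r" "r \<in> carrier H" and s: "F1 \<in> X s" "s \<in> carrier H" and t: "t \<in> carrier H" "b \<in> fib B t"
  shows "fip r (s \<otimes> t) F (fmul F1 b) = fip r s F F1 \<cdot>\<^bsub>B\<^esub> b"
proof -
  have k: "inv r \<otimes> s \<in> carrier H" "inv r \<otimes> s \<otimes> t = inv r \<otimes> (s \<otimes> t)" using F s t by (simp_all add: m_assoc)
  have bt: "b \<in> tot" using fib_tot[OF t] .
  obtain C where C: "\<And>e x. e > 0 \<Longrightarrow> x \<in> L r \<Longrightarrow> close e F x \<Longrightarrow> bnorm B (fip r s F F1 \<ominus> F1 x) \<le> C * e"
    using fip_limit[OF F s] by metis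
  note m = fip_fib[OF F s]
  show ?thesis
  proof (rule fip_eqI[OF F X_fmul[OF s t] _ fib_mul[OF k(1) t(1) m t(2) k(2)], where C = "C * bnorm B b"])
    fix e x assume e: "(e::real) > 0" and x: "x \<in> L r" "close e F x"
    note f = X_fib[OF s(1) F(2) x(1)]
    have "fip r s F F1 \<cdot>\<^bsub>B\<^esub> b \<ominus> fmul F1 b x = (fip r s F F1 \<ominus> F1 x) \<cdot>\<^bsub>B\<^esub> b"
      using add_bmul[OF k(1) t(1) m fib_sm[OF k(1) f] t(2)] sm_bmul[OF fib_tot[OF k(1) f] bt] F(2) x(1) by simp
    then have "bnorm B (fip r s F F1 \<cdot>\<^bsub>B\<^esub> b \<ominus> fmul F1 b x) \<le> bnorm B (fip r s F F1 \<ominus> F1 x) * bnorm B b"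
      using bnorm_bmul[OF fib_tot[OF k(1) fib_diff[OF k(1) m f]] bt] by simp
    also have "\<dots> \<le> C * e * bnorm B b"
      by (rule mult_right_mono[OF C[OF e x] tot_norm_ge_0[OF bt]])
    finally show "bnorm B (fip r s F F1 \<cdot>\<^bsub>B\<^esub> b \<ominus> fmul F1 b x) \<le> C * bnorm B b * e"
      by (simp add: mult.commute mult.left_commute)
  qed (use s t in simp)
qed

text \<open>The vector x approximates \<open>emb x\<close> within every e, so the limit that defines
  the inner product is attained at x.\<close>

lemma fip_emb:
  assumes "r \<in> carrier H" "x \<in> L r" and "F \<in> X s" "s \<in> carrier H"
  shows "fip r s (emb x) F = F x"
proof -
  have k: "inv r \<otimes> s \<in> carrier H" using assms by simp
  obtain C where C: "\<And>e y. e > 0 \<Longrightarrow> y \<in> L r \<Longrightarrow> close e (emb x) y \<Longrightarrow>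
      bnorm B (fip r s (emb x) F \<ominus> F y) \<le> C * e"
    using fip_limit[OF X_emb[OF assms(1,2)] assms(1,3,4)] by metis
  show ?thesis
  proof (rule fib_eq_small[OF k fip_fib[OF X_emb[OF assms(1,2)] assms(1,3,4)] X_fib[OF assms(3,1,2)]])
    fix e :: real assume "e > 0"
    then show "bnorm B (fip r s (emb x) F \<ominus> F x) \<le> C * e"
      using C assms(2) close_emb[OF assms(1,2)] by simp
  qed
qed

lemma fnorm_fsm:
  assumes F: "F \<in> X r" "r \<in> carrier H"
  shows "fnorm r (fsm c F) = cmod c * fnorm r F"
proof -
  note c = X_fsm[OF F, of c]
  have "fip r r (fsm c F) F = bstar B (fip r r F (fsm c F))" using fip_star[OF F c F(2)] by simp
  also have "\<dots> = cnj c \<odot>\<^bsub>B\<^esub> fip r r F F"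
    using fip_fsm[OF F F, of c] bstar_sm[OF fib_tot[OF one_closed fip_self_fib[OF F]]] fip_star[OF F F]
    by simp
  finally have "fip r r (fsm c F) (fsm c F) = c \<odot>\<^bsub>B\<^esub> (cnj c \<odot>\<^bsub>B\<^esub> fip r r F F)"
    using fip_fsm[OF c F(2) F, of c] by simp
  then have "bnorm B (fip r r (fsm c F) (fsm c F)) = (cmod c * cmod c) * bnorm B (fip r r F F)"
    using fip_self_fib[OF F] by simp
  then show ?thesis by (simp add: fnorm_def real_sqrt_mult)
qed

lemma fnorm_fadd:
  assumes F: "F \<in> X r" "r \<in> carrier H" "F' \<in> X r"
  shows "fnorm r (fadd F F') \<le> fnorm r F + fnorm r F'"
proof (rule fnorm_le[OF X_fadd[OF F] F(2)])
  fix s z assume s: "s \<in> carrier H" "z \<in> L s"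
  have "bnorm B (F z \<oplus>\<^bsub>B\<^esub> F' z) \<le> bnorm B (F z) + bnorm B (F' z)"
    using F s by (intro bnorm_add[of "inv s \<otimes> r"]) (auto intro: X_fib)
  then show "bnorm B (fadd F F' z) \<le> (fnorm r F + fnorm r F') * lnorm z"
    using X_bound[OF F(1,2) s] X_bound[OF F(3,2) s] s by (simp add: distrib_right)
qed (use F fnorm_ge_0 in simp)

lemma fnorm_eq_0:
  assumes F: "F \<in> X r" "r \<in> carrier H"
  shows "fnorm r F = 0 \<longleftrightarrow> F = emb (lzero r)"
proof
  note z = X_emb[OF F(2) lzero_closed[OF F(2)]]
  show "F = emb (lzero r)" if "fnorm r F = 0"
  proof (rule X_eqI[OF F(1) z])
    fix s v assume s: "s \<in> carrier H" "v \<in> L s"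
    have k: "inv s \<otimes> r \<in> carrier H" using F s by simp
    have "bnorm B (F v) \<le> 0" using X_bound[OF F s] that by simp
    then have "bnorm B (F v) = 0" using bnorm_ge_0[OF k X_fib[OF F(1) s]] by simp
    then show "F v = emb (lzero r) v"
      using bnorm_eq_0[OF k X_fib[OF F(1) s]] s F by (simp add: lip_lzero)
  qed
  show "fnorm r F = 0" if "F = emb (lzero r)"
    using fip_emb[OF F(2) lzero_closed[OF F(2)] F] F lip_lzero[OF F(2,2) lzero_closed[OF F(2)]] that lzero_closed[OF F(2)]
    by (simp add: fnorm_def)
qed

text \<open>A Cauchy sequence of functionals converges pointwise, because the fibres of B are
  complete, and uniformly on the unit ball. An approximant of a late member therefore approximates
  the limit.\<close>

lemma X_complete:
  fixes F :: "nat \<Rightarrow> 'l \<Rightarrow> 'b"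
  assumes r: "r \<in> carrier H" and F: "\<And>n. F n \<in> X r"
    and cauchy: "\<And>e. e > 0 \<Longrightarrow> \<exists>N. \<forall>m\<ge>N. \<forall>n\<ge>N. fnorm r (fadd (F m) (fsm (-1) (F n))) < e"
  shows "\<exists>F'\<in>X r. (\<lambda>n. fnorm r (fadd (F n) (fsm (-1) F'))) \<longlonglongrightarrow> 0"
proof -
  have diff: "bnorm B (F m z \<ominus> F n z) \<le> fnorm r (fadd (F m) (fsm (-1) (F n))) * lnorm z"
    if "s \<in> carrier H" "z \<in> L s" for m n s z
    using X_bound[OF X_fadd[OF F r X_fsm[OF F r]] r that, of m "-1" n] that by simp
  \<comment> \<open>The degree of z is not an argument of a functional, so the limit is
    characterized for all degrees at once; \<open>L_disjoint\<close> leaves only one of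
    them.\<close>
  have pw: "\<exists>l. \<forall>s\<in>carrier H. z \<in> L s \<longrightarrow> l \<in> fib B (inv s \<otimes> r) \<and> (\<lambda>n. bnorm B (F n z \<ominus> l)) \<longlonglongrightarrow> 0"
    if z: "z \<in> Lall" for z
  proof -
    obtain s where s: "s \<in> carrier H" "z \<in> L s" using z by (auto simp: Lall_def)
    have k: "inv s \<otimes> r \<in> carrier H" using s r by simp
    have z0: "0 < lnorm z + 1" using lnorm_ge_0[OF s] by linarith
    have "\<exists>l\<in>fib B (inv s \<otimes> r). (\<lambda>n. bnorm B (F n z \<ominus> l)) \<longlonglongrightarrow> 0"
    proof (rule cvec.complete[OF cvec_fib[OF k] X_fib[OF F s]])
      fix e :: real assume e: "e > 0"
      obtain N where N: "\<And>m n. m \<ge> N \<Longrightarrow> n \<ge> N \<Longrightarrow> fnorm r (fadd (F m) (fsm (-1) (F n))) < e / (lnorm z + 1)"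
        using cauchy[of "e / (lnorm z + 1)"] e z0 by auto
      have "bnorm B (F m z \<ominus> F n z) < e" if "m \<ge> N" "n \<ge> N" for m n
      proof -
        have "fnorm r (fadd (F m) (fsm (-1) (F n))) * (lnorm z + 1) < e"
          using N[OF that] z0 by (simp add: pos_less_divide_eq)
        then show ?thesis
          using diff[OF s, of m n] fnorm_ge_0[OF X_fadd[OF F r X_fsm[OF F r]] r, of m "-1" n]
          by (simp add: distrib_left)
      qed
      then show "\<exists>N. \<forall>m\<ge>N. \<forall>n\<ge>N. bnorm B (F m z \<ominus> F n z) < e" by blast
    qed
    then show ?thesis using L_disjoint s by metis
  qed
  define F' where "F' = (\<lambda>z\<in>Lall. SOME l. \<forall>s\<in>carrier H. z \<in> L s \<longrightarrow>
      l \<in> fib B (inv s \<otimes> r) \<and> (\<lambda>n. bnorm B (F n z \<ominus> l)) \<longlonglongrightarrow> 0)"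
  have F': "F' z \<in> fib B (inv s \<otimes> r)" "(\<lambda>n. bnorm B (F n z \<ominus> F' z)) \<longlonglongrightarrow> 0"
    if s: "s \<in> carrier H" "z \<in> L s" for s z
    using someI_ex[OF pw[OF LallI[OF s]]] LallI[OF s] s by (simp_all add: F'_def)
  have near: "bnorm B (F m z \<ominus> F' z) \<le> e * lnorm z"
    if N: "\<And>n. n \<ge> N \<Longrightarrow> fnorm r (fadd (F m) (fsm (-1) (F n))) < e" and s: "s \<in> carrier H" "z \<in> L s"
    for m N e s z
  proof -
    have k: "inv s \<otimes> r \<in> carrier H" using s r by simp
    have "bnorm B (F m z \<ominus> F' z) \<le> e * lnorm z + bnorm B (F n z \<ominus> F' z)" if "n \<ge> N" for n
    proof -
      have "bnorm B (F m z \<ominus> F n z) \<le> e * lnorm z"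
        using diff[OF s, of m n] mult_right_mono[OF less_imp_le[OF N[OF that]] lnorm_ge_0[OF s]] by linarith
      then show ?thesis
        using bnorm_triangle3[OF k X_fib[OF F s, of m] X_fib[OF F s, of n] F'(1)[OF s]] by linarith
    qed
    moreover have "(\<lambda>n. e * lnorm z + bnorm B (F n z \<ominus> F' z)) \<longlonglongrightarrow> e * lnorm z + 0"
      by (rule tendsto_add[OF tendsto_const F'(2)[OF s]])
    ultimately show ?thesis using LIMSEQ_le_const[of _ "e * lnorm z + 0" "bnorm B (F m z \<ominus> F' z)"] by auto
  qed
  have X: "F' \<in> X r"
  proof (rule XI)
    show "F' \<in> extensional Lall" by (simp add: F'_def)
    fix e :: real assume e: "e > 0"
    then obtain N where N: "\<And>m n. m \<ge> N \<Longrightarrow> n \<ge> N \<Longrightarrow> fnorm r (fadd (F m) (fsm (-1) (F n))) < e / 2"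
      using cauchy[of "e / 2"] by auto
    obtain x where x: "x \<in> L r" "close (e / 2) (F N) x" using X_approx[OF F, of "e / 2" N] e by auto
    have "close e F' x"
      unfolding close_def
    proof (intro ballI)
      fix s z assume s: "s \<in> carrier H" "z \<in> L s"
      have k: "inv s \<otimes> r \<in> carrier H" using s r by simp
      note m = F'(1)[OF s] X_fib[OF F s, of N] lip_fib[OF s(1) r s(2) x(1)]
      have "bnorm B (F N z \<ominus> F' z) \<le> e / 2 * lnorm z" by (rule near[OF N[OF order_refl] s])
      then show "bnorm B (F' z \<ominus> lip z x) \<le> e * lnorm z"
        using bnorm_triangle3[OF k m] bnorm_commute[OF k m(1,2)] closeD[OF x(2) s] by simp
    qed
    then show "\<exists>x\<in>L r. close e F' x" using x by blast
  qed (erule (1) F'(1))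
  have "(\<lambda>n. fnorm r (fadd (F n) (fsm (-1) F'))) \<longlonglongrightarrow> 0"
  proof (rule LIMSEQ_I)
    fix e :: real assume e: "e > 0"
    then obtain N where N: "\<And>m n. m \<ge> N \<Longrightarrow> n \<ge> N \<Longrightarrow> fnorm r (fadd (F m) (fsm (-1) (F n))) < e / 2"
      using cauchy[of "e / 2"] by auto
    have "fnorm r (fadd (F m) (fsm (-1) F')) \<le> e / 2" if "m \<ge> N" for m
    proof (rule fnorm_le[OF X_fadd[OF F r X_fsm[OF X r]] r])
      fix s z assume s: "s \<in> carrier H" "z \<in> L s"
      show "bnorm B (fadd (F m) (fsm (-1) F') z) \<le> e / 2 * lnorm z"
        using near[OF N[OF that] s] s by simp
    qed (use e in simp)
    then have "norm (fnorm r (fadd (F m) (fsm (-1) F')) - 0) < e" if "m \<ge> N" for m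
      using fnorm_ge_0[OF X_fadd[OF F r X_fsm[OF X r]] r, of m "-1"] e that by force
    then show "\<exists>N. \<forall>m\<ge>N. norm (fnorm r (fadd (F m) (fsm (-1) F')) - 0) < e" by blast
  qed
  then show ?thesis using X by blast
qed

end

section \<open>The completed Hilbert bundle\<close>

text \<open>Carries the Banach space of functionals over to its tagged and encoded copy in
  \<open>completion\<close>; d is a left inverse of the encoding f.\<close>

lemma cbanach_on_transport:
  assumes S: "cbanach_on S add sm z nrm"
    and d: "\<And>x. x \<in> S \<Longrightarrow> d (f x) = x"
    and add': "\<And>x y. x \<in> S \<Longrightarrow> y \<in> S \<Longrightarrow> add' (f x) (f y) = f (add x y)"
    and sm': "\<And>c x. x \<in> S \<Longrightarrow> sm' c (f x) = f (sm c x)"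
    and nrm': "\<And>x. x \<in> S \<Longrightarrow> nrm' (f x) = nrm x"
  shows "cbanach_on (f ` S) add' sm' (f z) nrm'"
proof -
  interpret cvec S add sm z nrm using S by unfold_locales
  have c: "\<exists>l\<in>f ` S. (\<lambda>n. nrm' (add' (g n) (sm' (- 1) l))) \<longlonglongrightarrow> 0"
    if g: "\<And>n. g n \<in> f ` S"
      and cauchy: "\<And>e. e > 0 \<Longrightarrow> \<exists>N. \<forall>m\<ge>N. \<forall>n\<ge>N. nrm' (add' (g m) (sm' (- 1) (g n))) < e"
    for g :: "nat \<Rightarrow> 'b"
  proof -
    have dg: "d (g n) \<in> S" "f (d (g n)) = g n" for n using g[of n] d by auto
    have eq: "nrm' (add' (g m) (sm' (- 1) (f y))) = nrm (minus_vec (d (g m)) y)" if "y \<in> S" for m y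
      using sm'[OF that, of "-1"] add'[OF dg(1)[of m] sm_closed[OF that, of "-1"]] dg nrm' that by simp
    have "\<exists>l\<in>S. (\<lambda>n. nrm (minus_vec (d (g n)) l)) \<longlonglongrightarrow> 0"
    proof (rule complete[OF dg(1)])
      fix e :: real assume "e > 0"
      then show "\<exists>N. \<forall>m\<ge>N. \<forall>n\<ge>N. nrm (minus_vec (d (g m)) (d (g n))) < e"
        using cauchy[of e] eq[OF dg(1)] dg(2) by simp
    qed
    then show ?thesis using eq by auto
  qed
  have inj: "f x = f y \<longleftrightarrow> x = y" if "x \<in> S" "y \<in> S" for x y
    using d that by metis
  show ?thesis
    unfolding cbanach_on_def ball_simps(9)
  proof (intro conjI ballI allI)
    show "f z \<in> f ` S" by simp
  next
    fix g :: "nat \<Rightarrow> 'b"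
    show "(\<forall>n. g n \<in> f ` S) \<and>
        (\<forall>\<epsilon>>0. \<exists>N. \<forall>m\<ge>N. \<forall>n\<ge>N. nrm' (add' (g m) (sm' (- 1) (g n))) < \<epsilon>) \<longrightarrow>
        (\<exists>l\<in>f ` S. (\<lambda>n. nrm' (add' (g n) (sm' (- 1) l))) \<longlonglongrightarrow> 0)"
      using c by blast
  qed (simp_all add: add' sm' nrm' inj add_assoc sm_sm sm_add add_sm nrm_add add_commute
      add_left_commute)
qed

context pre_hilbert
begin

lemma cbanach_X:
  assumes r: "r \<in> carrier H"
  shows "cbanach_on (X r) fadd fsm (emb (lzero r)) (fnorm r)"
proof -
  have k: "inv s \<otimes> r \<in> carrier H" if "s \<in> carrier H" for s using r that by simp
  note v = cvec.add_assoc[OF cvec_fib[OF k]] cvec.sm_sm[OF cvec_fib[OF k]] cvec.sm_add[OF cvec_fib[OF k]]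
    cvec.add_sm[OF cvec_fib[OF k]] cvec.zero_add[OF cvec_fib[OF k]] cvec.diff_self[OF cvec_fib[OF k]]
    cvec.sm_one[OF cvec_fib[OF k]] cvec.add_zero[OF cvec_fib[OF k]]
  note cl = X_fadd[OF _ r] X_fsm[OF _ r] X_emb[OF r lzero_closed[OF r]]
  have 1: "fadd (fadd F F') F'' = fadd F (fadd F' F'')" if "F \<in> X r" "F' \<in> X r" "F'' \<in> X r" for F F' F''
    by (rule X_eqI[of _ r]) (use that in \<open>simp_all add: cl v X_fib[of _ r]\<close>)
  have 2: "fadd F F' = fadd F' F" if "F \<in> X r" "F' \<in> X r" for F F'
    by (rule X_eqI[of _ r])
      (use that in \<open>simp_all add: cl cvec.add_commute[OF cvec_fib[OF k]] X_fib[of _ r]\<close>)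
  have 3: "fadd (emb (lzero r)) F = F" if "F \<in> X r" for F
    by (rule X_eqI[of _ r]) (use that r in \<open>simp_all add: cl v X_fib[of _ r] lip_lzero\<close>)
  have 4: "fadd F (fsm (-1) F) = emb (lzero r)" if "F \<in> X r" for F
    by (rule X_eqI[of _ r]) (use that r in \<open>simp_all add: cl v X_fib[of _ r] lip_lzero\<close>)
  have 5: "fsm 1 F = F" if "F \<in> X r" for F
    by (rule X_eqI[of _ r]) (use that in \<open>simp_all add: cl v X_fib[of _ r]\<close>)
  have 6: "fsm c (fsm d F) = fsm (c * d) F" if "F \<in> X r" for c d F
    by (rule X_eqI[of _ r]) (use that in \<open>simp_all add: cl v X_fib[of _ r]\<close>)
  have 7: "fsm c (fadd F F') = fadd (fsm c F) (fsm c F')" if "F \<in> X r" "F' \<in> X r" for c F F'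
    by (rule X_eqI[of _ r]) (use that in \<open>simp_all add: cl v X_fib[of _ r]\<close>)
  have 8: "fsm (c + d) F = fadd (fsm c F) (fsm d F)" if "F \<in> X r" for c d F
    by (rule X_eqI[of _ r]) (use that in \<open>simp_all add: cl v X_fib[of _ r]\<close>)
  show ?thesis
    unfolding cbanach_on_def
  proof (intro conjI ballI allI)
    fix F :: "nat \<Rightarrow> 'l \<Rightarrow> 'b"
    show "(\<forall>n. F n \<in> X r) \<and>
        (\<forall>\<epsilon>>0. \<exists>N. \<forall>m\<ge>N. \<forall>n\<ge>N. fnorm r (fadd (F m) (fsm (- 1) (F n))) < \<epsilon>) \<longrightarrow>
        (\<exists>l\<in>X r. (\<lambda>n. fnorm r (fadd (F n) (fsm (- 1) l))) \<longlonglongrightarrow> 0)"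
      using X_complete[OF r, of F] by blast
  qed (simp_all add: cl 1 3 4 5 6 7 8 fnorm_ge_0 fnorm_eq_0 fnorm_fsm fnorm_fadd r, rule 2)
qed

text \<open>The tag r makes the fibres disjoint and supplies the degrees that \<open>fip\<close> and
  the right multiplication need. The injection \<open>enc\<close> is a parameter so that the bundle
  can be placed on a prescribed type.\<close>

definition completion :: "(('l \<Rightarrow> 'b) \<Rightarrow> 'e) \<Rightarrow> ('h, 'h \<times> 'e, 'b) hbundle" where
  "completion enc = (let dec = \<lambda>p. inv_into UNIV enc (snd p) in
    \<lparr>hfib = \<lambda>r. (\<lambda>F. (r, enc F)) ` X r,
     hadd = \<lambda>p q. (fst p, enc (fadd (dec p) (dec q))),
     hsm = \<lambda>c p. (fst p, enc (fsm c (dec p))),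
     hzero = \<lambda>r. (r, enc (emb (lzero r))),
     rmul = \<lambda>p b. (fst p \<otimes> deg b, enc (fmul (dec p) b)),
     ip = \<lambda>p q. fip (fst p) (fst q) (dec p) (dec q)\<rparr>)"

lemma completion_simps:
  assumes "inj enc"
  shows "hfib (completion enc) r = (\<lambda>F. (r, enc F)) ` X r"
    "hadd (completion enc) (r, enc F) (s, enc F') = (r, enc (fadd F F'))"
    "hsm (completion enc) c (r, enc F) = (r, enc (fsm c F))"
    "hzero (completion enc) r = (r, enc (emb (lzero r)))"
    "rmul (completion enc) (r, enc F) b = (r \<otimes> deg b, enc (fmul F b))"
    "ip (completion enc) (r, enc F) (s, enc F') = fip r s F F'"
  using assms by (simp_all add: completion_def Let_def)

lemma fmul_laws:
  assumes F: "F \<in> X r" "F' \<in> X r" "r \<in> carrier H" and s: "s \<in> carrier H" "b \<in> fib B s" "b' \<in> fib B s"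
  shows "fmul (fadd F F') b = fadd (fmul F b) (fmul F' b)"
    "fmul F (b \<oplus>\<^bsub>B\<^esub> b') = fadd (fmul F b) (fmul F b')"
    "fmul (fsm c F) b = fsm c (fmul F b)"
    "fmul F (c \<odot>\<^bsub>B\<^esub> b) = fsm c (fmul F b)"
proof -
  have rs: "r \<otimes> s \<in> carrier H" using F s by simp
  have k: "inv t \<otimes> r \<in> carrier H" if "t \<in> carrier H" for t using F that by simp
  have ft: "F z \<in> tot" if "t \<in> carrier H" "z \<in> L t" for t z
    using fib_tot[OF k X_fib[OF F(1)]] that by blast
  have bt: "b \<in> tot" using fib_tot s by blast
  note m = X_fmul[OF _ F(3) s(1)] X_fadd[OF _ F(3)] X_fadd[OF _ rs] X_fsm[OF _ F(3)] X_fsm[OF _ rs]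
    fib_add[OF s(1)] fib_sm[OF s(1)]
  show "fmul (fadd F F') b = fadd (fmul F b) (fmul F' b)"
    by (rule X_eqI[of _ "r \<otimes> s"])
      (use F s in \<open>simp_all add: m add_bmul[OF k s(1) X_fib[OF F(1)] X_fib[OF F(2)]]\<close>)
  show "fmul F (b \<oplus>\<^bsub>B\<^esub> b') = fadd (fmul F b) (fmul F b')"
    by (rule X_eqI[of _ "r \<otimes> s"])
      (use F s in \<open>simp_all add: m bmul_add[OF s(1) k s(2,3) X_fib[OF F(1)]]\<close>)
  show "fmul (fsm c F) b = fsm c (fmul F b)"
    by (rule X_eqI[of _ "r \<otimes> s"]) (use F s in \<open>simp_all add: m sm_bmul[OF ft bt]\<close>)
  show "fmul F (c \<odot>\<^bsub>B\<^esub> b) = fsm c (fmul F b)"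
    by (rule X_eqI[of _ "r \<otimes> s"]) (use F s in \<open>simp_all add: m bmul_sm[OF ft bt]\<close>)
qed

theorem hilbert_bundle_completion:
  assumes enc: "inj enc"
  shows "hilbert_bundle H B (completion enc)"
  unfolding hilbert_bundle_def
proof (intro conjI)
  note S = completion_simps[OF enc]
  show "\<forall>r\<in>carrier H. cbanach_on (hfib (completion enc) r) (hadd (completion enc)) (hsm (completion enc)) (hzero (completion enc) r)
      (\<lambda>x. sqrt (bnorm B (ip (completion enc) x x)))"
  proof
    fix r assume r: "r \<in> carrier H"
    show "cbanach_on (hfib (completion enc) r) (hadd (completion enc)) (hsm (completion enc)) (hzero (completion enc) r)
      (\<lambda>x. sqrt (bnorm B (ip (completion enc) x x)))"
      unfolding S(1,4)
      by (rule cbanach_on_transport[OF cbanach_X[OF r], where d = "\<lambda>p. inv_into UNIV enc (snd p)"])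
        (simp_all add: S enc fnorm_def)
  qed
  show "\<forall>r\<in>carrier H. \<forall>s\<in>carrier H. r \<noteq> s \<longrightarrow> hfib (completion enc) r \<inter> hfib (completion enc) s = {}"
    by (auto simp: S)
  show "\<forall>r\<in>carrier H. \<forall>s\<in>carrier H. \<forall>x\<in>hfib (completion enc) r. \<forall>b\<in>fib B s. rmul (completion enc) x b \<in> hfib (completion enc) (r \<otimes> s)"
    unfolding S(1) by (auto simp: S X_fmul)
  show "\<forall>r\<in>carrier H. \<forall>s\<in>carrier H. \<forall>x\<in>hfib (completion enc) r. \<forall>x'\<in>hfib (completion enc) r. \<forall>b\<in>fib B s. \<forall>b'\<in>fib B s. \<forall>c.
        rmul (completion enc) (hadd (completion enc) x x') b = hadd (completion enc) (rmul (completion enc) x b) (rmul (completion enc) x' b) \<and>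
        rmul (completion enc) x (badd B b b') = hadd (completion enc) (rmul (completion enc) x b) (rmul (completion enc) x b') \<and>
        rmul (completion enc) (hsm (completion enc) c x) b = hsm (completion enc) c (rmul (completion enc) x b) \<and>
        rmul (completion enc) x (bsm B c b) = hsm (completion enc) c (rmul (completion enc) x b)"
    by (simp add: S fmul_laws deg_eq[OF fib_add] deg_eq[OF fib_sm])
  show "\<forall>r\<in>carrier H. \<forall>s\<in>carrier H. \<forall>x\<in>hfib (completion enc) r. \<forall>y\<in>hfib (completion enc) s.
        ip (completion enc) x y \<in> fib B (inv r \<otimes> s)"
    by (simp add: S fip_fib)
  show "\<forall>r\<in>carrier H. \<forall>s\<in>carrier H. \<forall>x\<in>hfib (completion enc) r. \<forall>y\<in>hfib (completion enc) s. \<forall>y'\<in>hfib (completion enc) s. \<forall>c.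
        ip (completion enc) x (hadd (completion enc) y y') = badd B (ip (completion enc) x y) (ip (completion enc) x y') \<and>
        ip (completion enc) x (hsm (completion enc) c y) = bsm B c (ip (completion enc) x y)"
    by (simp add: S fip_fadd fip_fsm)
  show "\<forall>r\<in>carrier H. \<forall>s\<in>carrier H. \<forall>t\<in>carrier H. \<forall>x\<in>hfib (completion enc) r. \<forall>y\<in>hfib (completion enc) s. \<forall>b\<in>fib B t.
        ip (completion enc) x (rmul (completion enc) y b) = bmul B (ip (completion enc) x y) b"
    by (simp add: S fip_fmul)
  show "\<forall>r\<in>carrier H. \<forall>s\<in>carrier H. \<forall>x\<in>hfib (completion enc) r. \<forall>y\<in>hfib (completion enc) s.
        bstar B (ip (completion enc) x y) = ip (completion enc) y x"
    by (simp add: S fip_star)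
  show "\<forall>r\<in>carrier H. \<forall>x\<in>hfib (completion enc) r.
        pos_e H B (ip (completion enc) x x) \<and> (ip (completion enc) x x = bzero B \<one> \<longrightarrow> x = hzero (completion enc) r)"
  proof (intro ballI)
    fix r x assume r: "r \<in> carrier H" and "x \<in> hfib (completion enc) r"
    then obtain F where F: "F \<in> X r" "x = (r, enc F)" by (auto simp: S)
    have "fip r r F F = bzero B \<one> \<Longrightarrow> fnorm r F = 0" by (simp add: fnorm_def)
    then show "pos_e H B (ip (completion enc) x x) \<and> (ip (completion enc) x x = bzero B \<one> \<longrightarrow> x = hzero (completion enc) r)"
      using fip_pos[OF F(1) r] fnorm_eq_0[OF F(1) r] by (simp add: S F pos_e_iff)
  qed
qed

end

section \<open>Extension of an action to the completion\<close>

locale ufell_hom = A: ufell G A v + ufell H B u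
  for G :: "'g monoid" and A :: "('g, 'a) fbundle" and v :: 'a
    and H :: "'h monoid" (structure) and B :: "('h, 'b) fbundle" and u :: 'b +
  fixes \<phi> :: "'g \<Rightarrow> 'h"
  assumes hom: "\<phi> \<in> hom G H"
begin

lemma phi_closed [simp]: "g \<in> carrier G \<Longrightarrow> \<phi> g \<in> carrier H"
  using hom by (auto simp: hom_def)

lemma phi_mult: "g \<in> carrier G \<Longrightarrow> k \<in> carrier G \<Longrightarrow> \<phi> (g \<otimes>\<^bsub>G\<^esub> k) = \<phi> g \<otimes> \<phi> k"
  using hom by (auto simp: hom_def)

lemma phi_inv: "g \<in> carrier G \<Longrightarrow> \<phi> (inv\<^bsub>G\<^esub> g) = inv (\<phi> g)"
  using group_hom.hom_inv[of G H \<phi>] hom A.is_group is_group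
  by (simp add: group_hom_def group_hom_axioms_def)

end

text \<open>The laws of the action are required only after pairing with a vector: for lists of
  tensors, (a + a') x and a x + a' x are different lists with the same inner products. Boundedness
  makes the action extend to the completion.\<close>

locale pre_action = ufell_hom G A v H B u \<phi> + pre_hilbert H B u L ladd lsm lzero lmul lip
  for G :: "'g monoid" and A :: "('g, 'a) fbundle" and v :: 'a
    and H :: "'h monoid" (structure) and B :: "('h, 'b) fbundle" and u :: 'b and \<phi> :: "'g \<Rightarrow> 'h"
    and L :: "'h \<Rightarrow> 'l set" and ladd lsm lzero lmul lip +
  fixes la :: "'a \<Rightarrow> 'l \<Rightarrow> 'l"
  assumes la_closed: "g \<in> carrier G \<Longrightarrow> r \<in> carrier H \<Longrightarrow> a \<in> fib A g \<Longrightarrow> x \<in> L r \<Longrightarrow> la a x \<in> L (\<phi> g \<otimes> r)"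
    and lip_la: "g \<in> carrier G \<Longrightarrow> r \<in> carrier H \<Longrightarrow> s \<in> carrier H \<Longrightarrow> a \<in> fib A g \<Longrightarrow> x \<in> L r \<Longrightarrow> y \<in> L s \<Longrightarrow>
      lip (la a x) y = lip x (la (bstar A a) y)"
    and lip_la_add: "g \<in> carrier G \<Longrightarrow> r \<in> carrier H \<Longrightarrow> s \<in> carrier H \<Longrightarrow> a \<in> fib A g \<Longrightarrow> a' \<in> fib A g \<Longrightarrow>
      x \<in> L r \<Longrightarrow> y \<in> L s \<Longrightarrow> lip y (la (a \<oplus>\<^bsub>A\<^esub> a') x) = lip y (la a x) \<oplus>\<^bsub>B\<^esub> lip y (la a' x)"
    and lip_la_sm: "g \<in> carrier G \<Longrightarrow> r \<in> carrier H \<Longrightarrow> s \<in> carrier H \<Longrightarrow> a \<in> fib A g \<Longrightarrow>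
      x \<in> L r \<Longrightarrow> y \<in> L s \<Longrightarrow> lip y (la (c \<odot>\<^bsub>A\<^esub> a) x) = c \<odot>\<^bsub>B\<^esub> lip y (la a x)"
    and lip_la_mul: "g \<in> carrier G \<Longrightarrow> k \<in> carrier G \<Longrightarrow> r \<in> carrier H \<Longrightarrow> s \<in> carrier H \<Longrightarrow> a \<in> fib A g \<Longrightarrow>
      a' \<in> fib A k \<Longrightarrow> x \<in> L r \<Longrightarrow> y \<in> L s \<Longrightarrow> lip y (la (a \<cdot>\<^bsub>A\<^esub> a') x) = lip y (la a (la a' x))"
    and la_bounded: "g \<in> carrier G \<Longrightarrow> r \<in> carrier H \<Longrightarrow> a \<in> fib A g \<Longrightarrow> x \<in> L r \<Longrightarrow>
      lnorm (la a x) \<le> bnorm A a * lnorm x"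
begin

lemma la_star_closed:
  assumes "g \<in> carrier G" "a \<in> fib A g" "s \<in> carrier H" "z \<in> L s"
  shows "la (bstar A a) z \<in> L (inv (\<phi> g) \<otimes> s)"
  using la_closed[OF _ assms(3) A.fib_star[OF assms(1,2) refl] assms(4)] assms by (simp add: phi_inv)

text \<open>F z is a limit of elements <z, x>, hence depends on z only through its inner products.
  This turns the weak laws of \<open>pre_action\<close> into equations between functionals.\<close>

lemma X_weak_eq:
  assumes F: "F \<in> X r" "r \<in> carrier H" and s: "s \<in> carrier H" "z \<in> L s" "z' \<in> L s"
    and eq: "\<And>x. x \<in> L r \<Longrightarrow> lip x z = lip x z'"
  shows "F z = F z'"
proof -
  have k: "inv s \<otimes> r \<in> carrier H" using F s by simp
  show ?thesis
  proof (rule fib_eq_small[OF k X_fib[OF F(1) s(1,2)] X_fib[OF F(1) s(1,3)]])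
    fix e :: real assume "e > 0"
    then obtain x where x: "x \<in> L r" "close e F x" using X_approx F by blast
    have l: "lip z x = lip z' x"
      using lip_star[OF F(2) s(1) x(1) s(2)] lip_star[OF F(2) s(1) x(1) s(3)] eq[OF x(1)] by simp
    note m = X_fib[OF F(1) s(1,2)] lip_fib[OF s(1) F(2) s(3) x(1)] X_fib[OF F(1) s(1,3)]
    show "bnorm B (F z \<ominus> F z') \<le> (lnorm z + lnorm z') * e"
      using bnorm_triangle3[OF k m] bnorm_commute[OF k m(2,3)] closeD[OF x(2) s(1,2)]
        closeD[OF x(2) s(1,3)] l by (simp add: algebra_simps)
  qed
qed

text \<open>The formula is forced by <z, a x> = <a^* z, x>: acting on a vector means precomposing
  its functional with a^*.\<close>

definition flact :: "'a \<Rightarrow> ('l \<Rightarrow> 'b) \<Rightarrow> 'l \<Rightarrow> 'b" where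
  "flact a F = (\<lambda>z\<in>Lall. F (la (bstar A a) z))"

lemma flact_apply [simp]: "s \<in> carrier H \<Longrightarrow> z \<in> L s \<Longrightarrow> flact a F z = F (la (bstar A a) z)"
  using LallI by (simp add: flact_def)

lemma close_flact:
  assumes F: "F \<in> X r" "r \<in> carrier H" and a: "g \<in> carrier G" "a \<in> fib A g" and x: "x \<in> L r" "close e F x" "e > 0"
  shows "close (bnorm A a * e) (flact a F) (la a x)"
  unfolding close_def
proof (intro ballI)
  fix s z assume s: "s \<in> carrier H" "z \<in> L s"
  have at: "a \<in> A.tot" using A.fib_tot[OF a] .
  have k: "inv\<^bsub>G\<^esub> g \<in> carrier G" "inv (\<phi> g) \<otimes> s \<in> carrier H" using a s by simp_all
  note st = A.fib_star[OF a refl]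
  have "lip z (la a x) = lip (la (bstar A a) z) x"
    using lip_la[OF k(1) s(1) F(2) st s(2) x(1)] at by simp
  then have "bnorm B (flact a F z \<ominus> lip z (la a x)) \<le> e * lnorm (la (bstar A a) z)"
    using closeD[OF x(2) k(2) la_star_closed[OF a s]] s by simp
  also have "\<dots> \<le> e * (bnorm A a * lnorm z)"
    using la_bounded[OF k(1) s(1) st s(2)] A.bnorm_bstar[OF at] x(3) by (intro mult_left_mono) auto
  finally show "bnorm B (flact a F z \<ominus> lip z (la a x)) \<le> bnorm A a * e * lnorm z"
    by (simp add: mult_ac)
qed

lemma X_flact:
  assumes F: "F \<in> X r" "r \<in> carrier H" and a: "g \<in> carrier G" "a \<in> fib A g"
  shows "flact a F \<in> X (\<phi> g \<otimes> r)"
proof (rule XI)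
  fix s z assume s: "s \<in> carrier H" "z \<in> L s"
  have "inv (inv (\<phi> g) \<otimes> s) \<otimes> r = inv s \<otimes> (\<phi> g \<otimes> r)"
    using a s F by (simp add: inv_mult_group m_assoc)
  then show "flact a F z \<in> fib B (inv s \<otimes> (\<phi> g \<otimes> r))"
    using X_fib[OF F(1) _ la_star_closed[OF a s]] a s by simp
next
  fix e :: real assume "e > 0"
  then show "\<exists>x\<in>L (\<phi> g \<otimes> r). close e (flact a F) x"
    by (rule approx_scale[OF F(1) A.tot_norm_ge_0[OF A.fib_tot[OF a]]])
      (use close_flact[OF F a] la_closed[OF a(1) F(2) a(2)] in blast)
qed (simp add: flact_def)

lemma flact_linear:
  assumes F: "F \<in> X r" "F' \<in> X r" "r \<in> carrier H" and a: "g \<in> carrier G" "a \<in> fib A g" "a' \<in> fib A g"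
  shows "flact (a \<oplus>\<^bsub>A\<^esub> a') F = fadd (flact a F) (flact a' F)"
    and "flact a (fadd F F') = fadd (flact a F) (flact a F')"
    and "flact (c \<odot>\<^bsub>A\<^esub> a) F = fsm c (flact a F)"
    and "flact a (fsm c F) = fsm c (flact a F)"
proof -
  have gr: "\<phi> g \<otimes> r \<in> carrier H" "inv\<^bsub>G\<^esub> g \<in> carrier G" using F a by simp_all
  have k: "inv (\<phi> g) \<otimes> s \<in> carrier H" if "s \<in> carrier H" for s using a that by simp
  note m = X_flact[OF _ F(3) a(1)] X_fadd[OF _ F(3)] X_fadd[OF _ gr(1)] X_fsm[OF _ F(3)] X_fsm[OF _ gr(1)]
    A.fib_add[OF a] A.fib_sm[OF a(1)]
  note st = A.fib_star[OF a(1) _ refl]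
  show "flact (a \<oplus>\<^bsub>A\<^esub> a') F = fadd (flact a F) (flact a' F)"
  proof (rule X_eqI[of _ "\<phi> g \<otimes> r"])
    fix s z assume s: "s \<in> carrier H" "z \<in> L s"
    note cl = la_star_closed[OF a(1,2) s] la_star_closed[OF a(1,3) s]
    have "F (la (bstar A (a \<oplus>\<^bsub>A\<^esub> a')) z) = F (ladd (la (bstar A a) z) (la (bstar A a') z))"
    proof (rule X_weak_eq[OF F(1,3) k[OF s(1)] la_star_closed[OF a(1) A.fib_add[OF a] s]
          ladd_closed[OF k[OF s(1)] cl]])
      fix x assume x: "x \<in> L r"
      show "lip x (la (bstar A (a \<oplus>\<^bsub>A\<^esub> a')) z) = lip x (ladd (la (bstar A a) z) (la (bstar A a') z))"
        using lip_la_add[OF gr(2) s(1) F(3) st[OF a(2)] st[OF a(3)] s(2) x] A.bstar_add[OF a]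
          lip_ladd[OF F(3) k[OF s(1)] x cl] by simp
    qed
    then show "flact (a \<oplus>\<^bsub>A\<^esub> a') F z = fadd (flact a F) (flact a' F) z"
      using s X_ladd[OF F(1,3) k[OF s(1)] cl] by simp
  qed (use F a m in simp_all)
  show "flact (c \<odot>\<^bsub>A\<^esub> a) F = fsm c (flact a F)"
  proof (rule X_eqI[of _ "\<phi> g \<otimes> r"])
    fix s z assume s: "s \<in> carrier H" "z \<in> L s"
    note cl = la_star_closed[OF a(1,2) s]
    have "F (la (bstar A (c \<odot>\<^bsub>A\<^esub> a)) z) = F (lsm (cnj c) (la (bstar A a) z))"
    proof (rule X_weak_eq[OF F(1,3) k[OF s(1)] la_star_closed[OF a(1) A.fib_sm[OF a(1,2)] s]
          lsm_closed[OF k[OF s(1)] cl]])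
      fix x assume x: "x \<in> L r"
      show "lip x (la (bstar A (c \<odot>\<^bsub>A\<^esub> a)) z) = lip x (lsm (cnj c) (la (bstar A a) z))"
        using lip_la_sm[OF gr(2) s(1) F(3) st[OF a(2)] s(2) x] A.bstar_sm[OF A.fib_tot[OF a(1,2)]]
          lip_lsm[OF F(3) k[OF s(1)] x cl] by simp
    qed
    then show "flact (c \<odot>\<^bsub>A\<^esub> a) F z = fsm c (flact a F) z"
      using s X_lsm[OF F(1,3) k[OF s(1)] cl] by simp
  qed (use F a m in simp_all)
  show "flact a (fadd F F') = fadd (flact a F) (flact a F')"
    by (rule X_eqI[of _ "\<phi> g \<otimes> r"]) (use F a m fun_apply(1)[OF k la_star_closed[OF a(1,2)]] in simp_all)
  show "flact a (fsm c F) = fsm c (flact a F)"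
    by (rule X_eqI[of _ "\<phi> g \<otimes> r"]) (use F a m fun_apply(2)[OF k la_star_closed[OF a(1,2)]] in simp_all)
qed

lemma flact_mul:
  assumes F: "F \<in> X r" "r \<in> carrier H" and a: "g \<in> carrier G" "a \<in> fib A g" and b: "k \<in> carrier G" "b \<in> fib A k"
  shows "flact (a \<cdot>\<^bsub>A\<^esub> b) F = flact a (flact b F)"
proof (rule X_eqI)
  show "flact (a \<cdot>\<^bsub>A\<^esub> b) F \<in> X (\<phi> g \<otimes> (\<phi> k \<otimes> r))"
    using X_flact[OF F _ A.fib_mul[OF a(1) b(1) a(2) b(2) refl]] a b F by (simp add: phi_mult m_assoc)
  show "flact a (flact b F) \<in> X (\<phi> g \<otimes> (\<phi> k \<otimes> r))"
    using X_flact[OF X_flact[OF F b] _ a] F b by simp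
  fix s z assume s: "s \<in> carrier H" "z \<in> L s"
  have c: "inv (\<phi> g) \<otimes> s \<in> carrier H" "inv\<^bsub>G\<^esub> g \<in> carrier G" "inv\<^bsub>G\<^esub> k \<in> carrier G"
    "inv (\<phi> k) \<otimes> (inv (\<phi> g) \<otimes> s) \<in> carrier H" using a b s by simp_all
  note st = A.fib_star[OF a refl] A.fib_star[OF b refl]
  note l1 = la_star_closed[OF a s]
  note l2 = la_star_closed[OF b c(1) l1]
  have e: "bstar A (a \<cdot>\<^bsub>A\<^esub> b) = bstar A b \<cdot>\<^bsub>A\<^esub> bstar A a"
    using A.bstar_bmul[OF A.fib_tot[OF a] A.fib_tot[OF b]] .
  have l3: "la (bstar A (a \<cdot>\<^bsub>A\<^esub> b)) z \<in> L (inv (\<phi> k) \<otimes> (inv (\<phi> g) \<otimes> s))"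
    using la_star_closed[OF _ A.fib_mul[OF a(1) b(1) a(2) b(2) refl] s] a b s
    by (simp add: phi_mult inv_mult_group m_assoc)
  have "F (la (bstar A (a \<cdot>\<^bsub>A\<^esub> b)) z) = F (la (bstar A b) (la (bstar A a) z))"
    by (rule X_weak_eq[OF F c(4) l3 l2])
      (use lip_la_mul[OF c(3,2) s(1) F(2) st(2,1) s(2)] e in simp)
  then show "flact (a \<cdot>\<^bsub>A\<^esub> b) F z = flact a (flact b F) z"
    using s flact_apply[OF c(1) l1] by simp
qed

lemma flact_fmul:
  assumes F: "F \<in> X r" "r \<in> carrier H" and a: "g \<in> carrier G" "a \<in> fib A g" and b: "t \<in> carrier H" "b \<in> fib B t"
  shows "fmul (flact a F) b = flact a (fmul F b)"
proof (rule X_eqI)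
  show "fmul (flact a F) b \<in> X (\<phi> g \<otimes> (r \<otimes> t))"
    using X_fmul[OF X_flact[OF F a] _ b] F a b by (simp add: m_assoc)
  show "flact a (fmul F b) \<in> X (\<phi> g \<otimes> (r \<otimes> t))"
    using X_flact[OF X_fmul[OF F b] _ a] F b by simp
  fix s z assume s: "s \<in> carrier H" "z \<in> L s"
  have c: "inv (\<phi> g) \<otimes> s \<in> carrier H" using a s by simp
  show "fmul (flact a F) b z = flact a (fmul F b) z"
    using s fun_apply(3)[OF c la_star_closed[OF a s]] by simp
qed

text \<open>If x approximates F, then a x approximates a F, and the functional a^* F' at x is F' at
  a x. So both inner products are limits of the same elements.\<close>

lemma fip_flact:
  assumes F: "F \<in> X r" "r \<in> carrier H" and F': "F' \<in> X s" "s \<in> carrier H" and a: "g \<in> carrier G" "a \<in> fib A g"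
  shows "fip (\<phi> g \<otimes> r) s (flact a F) F' = fip r (inv (\<phi> g) \<otimes> s) F (flact (bstar A a) F')"
proof -
  have c: "\<phi> g \<otimes> r \<in> carrier H" "inv (\<phi> g) \<otimes> s \<in> carrier H" using F F' a by simp_all
  have at: "a \<in> A.tot" using A.fib_tot[OF a] .
  have m: "flact (bstar A a) F' \<in> X (inv (\<phi> g) \<otimes> s)"
    using X_flact[OF F' _ A.fib_star[OF a refl]] a by (simp add: phi_inv)
  have i: "inv (\<phi> g \<otimes> r) \<otimes> s = inv r \<otimes> (inv (\<phi> g) \<otimes> s)"
    using F F' a by (simp add: inv_mult_group m_assoc)
  have k: "inv r \<otimes> (inv (\<phi> g) \<otimes> s) \<in> carrier H" using F F' a by simp
  obtain C where C: "\<And>e x. e > 0 \<Longrightarrow> x \<in> L (\<phi> g \<otimes> r) \<Longrightarrow> close e (flact a F) x \<Longrightarrow>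
      bnorm B (fip (\<phi> g \<otimes> r) s (flact a F) F' \<ominus> F' x) \<le> C * e"
    using fip_limit[OF X_flact[OF F a] c(1) F'] by metis
  have n: "0 \<le> bnorm A a" using A.tot_norm_ge_0[OF at] .
  show ?thesis
  proof (rule fip_eqI[OF F m c(2), symmetric, where C = "C * (bnorm A a + 1)"])
    show "fip (\<phi> g \<otimes> r) s (flact a F) F' \<in> fib B (inv r \<otimes> (inv (\<phi> g) \<otimes> s))"
      using fip_fib[OF X_flact[OF F a] c(1) F'] i by simp
    fix e x assume e: "(e::real) > 0" and x: "x \<in> L r" "close e F x"
    \<comment> \<open>The summand 1 keeps the error positive when a = 0.\<close>
    have "close ((bnorm A a + 1) * e) (flact a F) (la a x)"
      by (rule close_mono[OF close_flact[OF F a x e]]) (use e in simp)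
    moreover have "0 < (bnorm A a + 1) * e" using n e by simp
    ultimately show "bnorm B (fip (\<phi> g \<otimes> r) s (flact a F) F' \<ominus> flact (bstar A a) F' x) \<le> C * (bnorm A a + 1) * e"
      using C la_closed[OF a(1) F(2) a(2) x(1)] F(2) x(1) at by (simp add: mult.assoc)
  qed
qed

definition completion_act :: "(('l \<Rightarrow> 'b) \<Rightarrow> 'e) \<Rightarrow> 'a \<Rightarrow> 'h \<times> 'e \<Rightarrow> 'h \<times> 'e" where
  "completion_act enc a p = (\<phi> (A.deg a) \<otimes> fst p, enc (flact a (inv_into UNIV enc (snd p))))"

lemma completion_act_simp:
  "inj enc \<Longrightarrow> completion_act enc a (r, enc F) = (\<phi> (A.deg a) \<otimes> r, enc (flact a F))"
  by (simp add: completion_act_def)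

theorem bundle_action_completion:
  assumes enc: "inj enc"
  shows "bundle_action G H \<phi> A B (completion enc) (completion_act enc)"
  unfolding bundle_action_def
proof (intro conjI)
  note S = completion_simps[OF enc] completion_act_simp[OF enc]
  show "\<forall>g\<in>carrier G. \<forall>h\<in>carrier H. \<forall>a\<in>fib A g. \<forall>x\<in>hfib (completion enc) h.
      completion_act enc a x \<in> hfib (completion enc) (\<phi> g \<otimes> h)"
    by (auto simp: S X_flact)
  show "\<forall>g\<in>carrier G. \<forall>h\<in>carrier H. \<forall>a\<in>fib A g. \<forall>a'\<in>fib A g. \<forall>x\<in>hfib (completion enc) h. \<forall>x'\<in>hfib (completion enc) h. \<forall>c.
        completion_act enc (badd A a a') x = hadd (completion enc) (completion_act enc a x) (completion_act enc a' x) \<and>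
        completion_act enc a (hadd (completion enc) x x') = hadd (completion enc) (completion_act enc a x) (completion_act enc a x') \<and>
        completion_act enc (bsm A c a) x = hsm (completion enc) c (completion_act enc a x) \<and>
        completion_act enc a (hsm (completion enc) c x) = hsm (completion enc) c (completion_act enc a x)"
    by (simp add: S flact_linear A.deg_eq[OF A.fib_add] A.deg_eq[OF A.fib_sm])
  show "\<forall>g\<in>carrier G. \<forall>g'\<in>carrier G. \<forall>h\<in>carrier H. \<forall>a\<in>fib A g. \<forall>a'\<in>fib A g'. \<forall>x\<in>hfib (completion enc) h.
        completion_act enc (bmul A a a') x = completion_act enc a (completion_act enc a' x)"
    by (simp add: S flact_mul A.deg_eq[OF A.fib_mul[OF _ _ _ _ refl]] phi_mult m_assoc)
  show "\<forall>g\<in>carrier G. \<forall>h\<in>carrier H. \<forall>k\<in>carrier H. \<forall>a\<in>fib A g. \<forall>x\<in>hfib (completion enc) h. \<forall>y\<in>hfib (completion enc) k.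
        ip (completion enc) (completion_act enc a x) y = ip (completion enc) x (completion_act enc (bstar A a) y)"
    by (simp add: S fip_flact A.deg_eq[OF A.fib_star[OF _ _ refl]] phi_inv)
  show "\<forall>g\<in>carrier G. \<forall>h\<in>carrier H. \<forall>s\<in>carrier H. \<forall>a\<in>fib A g. \<forall>x\<in>hfib (completion enc) h. \<forall>b\<in>fib B s.
        rmul (completion enc) (completion_act enc a x) b = completion_act enc a (rmul (completion enc) x b)"
    by (simp add: S flact_fmul m_assoc)
qed

end

section \<open>Finite sums and roots\<close>

context cvec
begin

definition lsum :: "('i \<Rightarrow> 'x) \<Rightarrow> 'i list \<Rightarrow> 'x" where
  "lsum f xs = foldr (\<lambda>p acc. f p \<boxplus> acc) xs z"

lemma lsum_simps [simp]:
  "lsum f [] = z" "lsum f (p # xs) = f p \<boxplus> lsum f xs"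
  by (simp_all add: lsum_def)

lemma lsum_closed: "(\<And>p. p \<in> set xs \<Longrightarrow> f p \<in> S) \<Longrightarrow> lsum f xs \<in> S"
  by (induction xs) auto

lemma lsum_cong: "(\<And>p. p \<in> set xs \<Longrightarrow> f p = g p) \<Longrightarrow> lsum f xs = lsum g xs"
  by (induction xs) auto

lemma lsum_map: "lsum f (map h xs) = lsum (\<lambda>p. f (h p)) xs"
  by (induction xs) auto

lemma lsum_append:
  "(\<And>p. p \<in> set xs \<union> set ys \<Longrightarrow> f p \<in> S) \<Longrightarrow> lsum f (xs @ ys) = lsum f xs \<boxplus> lsum f ys"
  by (induction xs) (auto simp: add_assoc lsum_closed)

lemma lsum_add:
  "(\<And>p. p \<in> set xs \<Longrightarrow> f p \<in> S) \<Longrightarrow> (\<And>p. p \<in> set xs \<Longrightarrow> g p \<in> S) \<Longrightarrow>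
    lsum (\<lambda>p. f p \<boxplus> g p) xs = lsum f xs \<boxplus> lsum g xs"
  by (induction xs) (auto simp: add_assoc add_left_commute lsum_closed)

lemma lsum_zero: "(\<And>p. p \<in> set xs \<Longrightarrow> f p = z) \<Longrightarrow> lsum f xs = z"
  by (induction xs) auto

lemma lsum_swap:
  "(\<And>p q. p \<in> set xs \<Longrightarrow> q \<in> set ys \<Longrightarrow> f p q \<in> S) \<Longrightarrow>
    lsum (\<lambda>p. lsum (f p) ys) xs = lsum (\<lambda>q. lsum (\<lambda>p. f p q) xs) ys"
proof (induction xs)
  case Nil
  then show ?case by (simp add: lsum_zero)
next
  case (Cons p xs)
  then show ?case by (simp add: lsum_add lsum_closed)
qed

text \<open>The constant may depend on the summand but not on N; in this form the decay of single
  inner products carries over to a Gram sum.\<close>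

lemma nrm_lsum_uniform:
  assumes "\<And>p N. p \<in> set xs \<Longrightarrow> f N p \<in> S"
    and "\<And>p. p \<in> set xs \<Longrightarrow> \<exists>K. \<forall>N. nrm (f N p) \<le> K * e N"
  shows "\<exists>K. \<forall>N. nrm (lsum (f N) xs) \<le> K * e N"
  using assms
proof (induction xs)
  case Nil
  then show ?case by (auto intro: exI[of _ 0])
next
  case (Cons p xs)
  obtain K where K: "\<And>N. nrm (f N p) \<le> K * e N" using Cons.prems(2)[of p] by auto
  obtain K' where K': "\<And>N. nrm (lsum (f N) xs) \<le> K' * e N" using Cons by auto
  have "nrm (lsum (f N) (p # xs)) \<le> (K + K') * e N" for N
    using nrm_add[of "f N p" "lsum (f N) xs"] K[of N] K'[of N] Cons.prems(1)
    by (simp add: lsum_closed distrib_right)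
  then show ?case by blast
qed

text \<open>The sums in \<open>positive_definite\<close> are indexed left folds, while
  \<open>lsum\<close> recurses on lists, which suits the inductions on tensors.\<close>

lemma fsum_nth:
  "(\<And>p. p \<in> set xs \<Longrightarrow> f p \<in> S) \<Longrightarrow> fsum (\<boxplus>) z (\<lambda>i. f (xs ! i)) (length xs) = lsum f xs"
proof (induction xs rule: rev_induct)
  case (snoc p xs)
  have "foldl (\<lambda>acc i. acc \<boxplus> f ((xs @ [p]) ! i)) z [0..<length xs] =
      foldl (\<lambda>acc i. acc \<boxplus> f (xs ! i)) z [0..<length xs]"
    by (rule foldl_cong) (auto simp: nth_append)
  moreover have "lsum f (xs @ [p]) = lsum f xs \<boxplus> lsum f [p]"
    by (rule lsum_append) (use snoc.prems in auto)
  ultimately show ?case using snoc by (simp add: fsum_def)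
qed (simp add: fsum_def)

end

text \<open>Stated for additive maps so as to cover the conjugate linear involution as well; that h
  maps zero to zero follows by cancellation.\<close>

lemma lsum_hom:
  assumes S: "cvec S add sm z nrm" and S': "cvec S' add' sm' z' nrm'"
    and h: "\<And>x. x \<in> S \<Longrightarrow> h x \<in> S'" "\<And>x y. x \<in> S \<Longrightarrow> y \<in> S \<Longrightarrow> h (add x y) = add' (h x) (h y)"
    and f: "\<And>p. p \<in> set xs \<Longrightarrow> f p \<in> S"
  shows "h (cvec.lsum add z f xs) = cvec.lsum add' z' (\<lambda>p. h (f p)) xs"
proof -
  interpret S: cvec S add sm z nrm by (rule S)
  interpret S': cvec S' add' sm' z' nrm' by (rule S')
  have "h z = add' (h z) (h z)" using h(2)[of z z] by simp
  then have "h z = z'"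
    using S'.add_assoc[of "h z" "h z" "sm' (-1) (h z)"] h(1)[of z] by simp
  then show ?thesis using f by (induction xs) (simp_all add: h S.lsum_closed)
qed

section \<open>Positive sums and powers of a root\<close>

context ucstar
begin

lemma pos_lsum: "(\<And>p. p \<in> set xs \<Longrightarrow> pos (f p)) \<Longrightarrow> pos (lsum f xs)"
  by (induction xs) auto

lemma pos_lsum_minus:
  "p \<in> set xs \<Longrightarrow> (\<And>p. p \<in> set xs \<Longrightarrow> pos (f p)) \<Longrightarrow> pos (lsum f xs \<boxminus> f p)"
proof (induction xs)
  case (Cons q xs)
  have S: "f q \<in> S" "f p \<in> S" "lsum f xs \<in> S" using Cons.prems by (auto intro!: lsum_closed)
  show ?case
  proof (cases "p = q")
    case True
    have "(f q \<boxplus> lsum f xs) \<boxminus> f q = lsum f xs"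
      by (intro vec_eqI) ((rule rp_rules | simp add: S)+)
    then show ?thesis using True Cons.prems by (simp add: pos_lsum)
  next
    case False
    then have "pos (f q \<boxplus> (lsum f xs \<boxminus> f p))" using Cons by auto
    then show ?thesis using S by (simp add: add_assoc)
  qed
qed simp

lemma pos_conj:
  assumes "pos h" "w \<in> S"
  shows "pos (star w \<star> (h \<star> w))"
proof -
  obtain d where d: "d \<in> S" "star d = d" "h = d \<star> d" using assms(1) by (rule posE)
  have e: "star w \<star> (h \<star> w) = star (d \<star> w) \<star> (d \<star> w)" using d assms by (simp add: mul_assoc)
  show ?thesis unfolding e using d assms by (intro pos_star_mul) simp
qed

primrec pow :: "'x \<Rightarrow> nat \<Rightarrow> 'x" where
  "pow r 0 = u"
| "pow r (Suc n) = r \<star> pow r n"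

lemma pow_closed [simp]: "r \<in> S \<Longrightarrow> pow r n \<in> S"
  by (induction n) auto

lemma pow_commute: "r \<in> S \<Longrightarrow> w \<in> S \<Longrightarrow> r \<star> w = w \<star> r \<Longrightarrow> pow r n \<star> w = w \<star> pow r n"
proof (induction n)
  case (Suc n)
  then have "pow r (Suc n) \<star> w = r \<star> (w \<star> pow r n)" by (simp add: mul_assoc)
  also have "\<dots> = (w \<star> r) \<star> pow r n" using Suc.prems by (metis mul_assoc pow_closed)
  finally show ?case using Suc.prems by (simp add: mul_assoc)
qed simp

lemma pow_star: "r \<in> S \<Longrightarrow> star r = r \<Longrightarrow> star (pow r n) = pow r n"
  by (induction n) (simp_all add: pow_commute)

text \<open>For \<open>0 \<le> q \<le> 1\<close> and \<open>r = \<surd>(1 - q)\<close>, the elements \<open>r\<^sup>n q r\<^sup>n\<close> decrease and their sum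
  telescopes to \<open>1 - r\<^sup>2\<^sup>n\<close>; hence the \<open>n\<close>-th one has norm at most \<open>1/n\<close>.\<close>

lemma telescoping_root:
  assumes q: "pos q" "nrm q \<le> 1"
  obtains r p where "r \<in> S" "star r = r" "\<And>n. p n = lsum (\<lambda>m. pow r m \<star> (q \<star> pow r m)) [0..<n]"
    "\<And>n. p n = u \<boxminus> pow r n \<star> pow r n"
    "\<And>n. real n * nrm (pow r n \<star> (q \<star> pow r n)) \<le> 1"
proof -
  have qS: "q \<in> S" "star q = q" using q by auto
  obtain r where r: "r \<in> S" "star r = r" "r \<star> r = u \<boxminus> q"
    and comm: "\<And>w. w \<in> S \<Longrightarrow> q \<star> w = w \<star> q \<Longrightarrow> r \<star> w = w \<star> r"
    using sqrt_exists[OF qS q(2)] by blast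
  have rq: "r \<star> q = q \<star> r" by (rule comm) (use qS in simp_all)
  have pq: "pow r n \<star> q = q \<star> pow r n" for n by (rule pow_commute[OF r(1) qS(1) rq])
  have pr: "pow r n \<star> r = r \<star> pow r n" for n by (rule pow_commute[OF r(1) r(1) refl])
  have ps: "star (pow r n) = pow r n" for n by (rule pow_star[OF r(1,2)])
  let ?t = "\<lambda>m. pow r m \<star> (q \<star> pow r m)"
  define p where "p n = lsum ?t [0..<n]" for n
  have tS: "?t m \<in> S" for m using r qS by simp
  have tpos: "pos (?t m)" for m using pos_conj[OF q(1), of "pow r m"] r by (simp add: ps)
  have pS: "p n \<in> S" for n unfolding p_def by (rule lsum_closed) (rule tS)
  have p_Suc: "p (Suc n) = p n \<boxplus> ?t n" for n
    using tS by (simp add: p_def lsum_append)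
  have sq: "pow r (Suc n) \<star> pow r (Suc n) = pow r n \<star> pow r n \<boxminus> ?t n" for n
  proof -
    have "pow r (Suc n) \<star> pow r (Suc n) = r \<star> ((pow r n \<star> r) \<star> pow r n)"
      using r by (simp add: mul_assoc)
    also have "\<dots> = (r \<star> r) \<star> (pow r n \<star> pow r n)"
      unfolding pr using r(1) by (simp add: mul_assoc)
    also have "\<dots> = pow r n \<star> pow r n \<boxminus> q \<star> (pow r n \<star> pow r n)"
      unfolding r(3) using r qS by (simp add: expand)
    also have "q \<star> (pow r n \<star> pow r n) = ?t n"
      using r qS pq[of n] by (metis mul_assoc pow_closed)
    finally show ?thesis .
  qed
  have p_eq: "p n = u \<boxminus> pow r n \<star> pow r n" for n
  proof (induction n)
    case (Suc n)
    show ?case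
      unfolding p_Suc sq Suc
      by (intro vec_eqI) ((rule rp_rules | simp add: r qS)+)
  qed (simp add: p_def)
  \<comment> \<open>As r^2 = u - q and all factors commute, the difference is q r^n q r^n, the
    square of a self-adjoint element.\<close>
  have t_dec: "pos (?t n \<boxminus> ?t (Suc n))" for n
  proof -
    have e: "?t m = q \<star> (pow r m \<star> pow r m)" for m
      using r qS pq[of m] by (metis mul_assoc pow_closed)
    have "?t n \<boxminus> ?t (Suc n) = q \<star> ?t n"
      unfolding e[of "Suc n"] sq unfolding e[of n] using r qS tS
      by (simp del: pow.simps add: expand, intro vec_eqI) ((rule rp_rules | simp add: r qS)+)
    also have "\<dots> = star (q \<star> pow r n) \<star> (q \<star> pow r n)"
    proof -
      have "star (q \<star> pow r n) = q \<star> pow r n" using r(1) qS pq[of n] ps[of n] by simp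
      then show ?thesis using r(1) qS(1) by (simp add: mul_assoc)
    qed
    finally show ?thesis using pos_star_mul[of "q \<star> pow r n"] r qS by simp
  qed
  \<comment> \<open>Writing t_n for the n-th summand, the induction step is p_(n+1) - (n+1) t_(n+1)
    = (p_n - n t_n) + (n+1) (t_n - t_(n+1)).\<close>
  have dom: "pos (p n \<boxminus> complex_of_real (real n) \<odot> ?t n)" for n
  proof (induction n)
    case (Suc n)
    have "pos ((p n \<boxminus> complex_of_real (real n) \<odot> ?t n) \<boxplus>
        complex_of_real (real (Suc n)) \<odot> (?t n \<boxminus> ?t (Suc n)))"
      by (intro pos_add Suc pos_sm t_dec) simp
    also have "(p n \<boxminus> complex_of_real (real n) \<odot> ?t n) \<boxplus>
        complex_of_real (real (Suc n)) \<odot> (?t n \<boxminus> ?t (Suc n)) =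
      p (Suc n) \<boxminus> complex_of_real (real (Suc n)) \<odot> ?t (Suc n)"
      unfolding p_Suc
      by (intro vec_eqI) ((rule rp_rules | simp del: pow.simps add: pS tS algebra_simps)+)
    finally show ?case .
  qed (simp add: p_def qS)
  have "real n * nrm (?t n) \<le> 1" for n
  proof -
    \<comment> \<open>Since p_n = u - r^(2n), adding the positive element r^(2n) turns n t_n <= p_n
      into n t_n <= u.\<close>
    have "pos ((p n \<boxminus> complex_of_real (real n) \<odot> ?t n) \<boxplus> pow r n \<star> pow r n)"
      by (rule pos_add[OF dom posI]) (simp_all add: r(1) ps)
    also have "(p n \<boxminus> complex_of_real (real n) \<odot> ?t n) \<boxplus> pow r n \<star> pow r n =
        complex_of_real 1 \<odot> u \<boxminus> complex_of_real (real n) \<odot> ?t n"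
      unfolding p_eq by (intro vec_eqI) ((rule rp_rules | simp add: r qS)+)
    finally have "nrm (complex_of_real (real n) \<odot> ?t n) \<le> 1"
      by (intro nrm_le_if_pos[OF pos_sm[OF tpos]]) simp_all
    then show ?thesis using tS by simp
  qed
  then show thesis using that[of r p] r p_def p_eq by blast
qed

end

section \<open>The Hilbert bundle of a positive definite bundle map\<close>

lemma fsum_cong: "(\<And>i. i < n \<Longrightarrow> f i = g i) \<Longrightarrow> fsum add z f n = fsum add z g n"
  unfolding fsum_def by (rule foldl_cong) auto

lemma (in cvec) lsum_drop:
  "(\<And>p. p \<in> set us \<union> set vs \<Longrightarrow> f p \<in> S) \<Longrightarrow> f w = z \<Longrightarrow> lsum f (us @ w # vs) = lsum f (us @ vs)"
  by (induction us) (simp_all add: lsum_closed)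

locale pd_kernel = ufell_hom G A v H B u \<phi>
  for G :: "'g monoid" and A :: "('g, 'a) fbundle" and v :: 'a
    and H :: "'h monoid" (structure) and B :: "('h, 'b) fbundle" and u :: 'b and \<phi> :: "'g \<Rightarrow> 'h" +
  fixes T :: "'a \<Rightarrow> 'b"
  assumes bmap: "bundle_map G \<phi> A B T"
    and posdef: "positive_definite G H \<phi> A B T"
begin

lemma T_fib: "g \<in> carrier G \<Longrightarrow> a \<in> fib A g \<Longrightarrow> \<phi> g = k \<Longrightarrow> T a \<in> fib B k"
  and T_add: "g \<in> carrier G \<Longrightarrow> a \<in> fib A g \<Longrightarrow> a' \<in> fib A g \<Longrightarrow> T (a \<oplus>\<^bsub>A\<^esub> a') = T a \<oplus>\<^bsub>B\<^esub> T a'"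
  and T_sm: "g \<in> carrier G \<Longrightarrow> a \<in> fib A g \<Longrightarrow> T (c \<odot>\<^bsub>A\<^esub> a) = c \<odot>\<^bsub>B\<^esub> T a"
  using bmap unfolding bundle_map_def by auto

lemma T_bound:
  assumes "g \<in> carrier G"
  obtains C where "0 \<le> C" "\<And>a. a \<in> fib A g \<Longrightarrow> bnorm B (T a) \<le> C * bnorm A a"
proof -
  obtain C where C: "\<And>a. a \<in> fib A g \<Longrightarrow> bnorm B (T a) \<le> C * bnorm A a"
    using bmap assms unfolding bundle_map_def by blast
  show thesis
  proof (rule that[of "\<bar>C\<bar>"])
    fix a assume a: "a \<in> fib A g"
    have "C * bnorm A a \<le> \<bar>C\<bar> * bnorm A a"
      using A.bnorm_ge_0[OF assms a] by (intro mult_right_mono) auto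
    then show "bnorm B (T a) \<le> \<bar>C\<bar> * bnorm A a" using C[OF a] by linarith
  qed simp
qed

text \<open>A pair \<open>(a, b)\<close> stands for the elementary tensor \<open>a \<otimes> b\<close>, and a list of pairs for its sum.\<close>

definition tensors :: "'h \<Rightarrow> ('a \<times> 'b) set" where
  "tensors r = {p. \<exists>g\<in>carrier G. fst p \<in> fib A g \<and> snd p \<in> fib B (inv (\<phi> g) \<otimes> r)}"

definition tensor_ip :: "'a \<times> 'b \<Rightarrow> 'a \<times> 'b \<Rightarrow> 'b" where
  "tensor_ip p q = bstar B (snd p) \<cdot>\<^bsub>B\<^esub> (T (bstar A (fst p) \<cdot>\<^bsub>A\<^esub> fst q) \<cdot>\<^bsub>B\<^esub> snd q)"

definition left_act :: "'a \<Rightarrow> 'a \<times> 'b \<Rightarrow> 'a \<times> 'b" where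
  "left_act c p = (c \<cdot>\<^bsub>A\<^esub> fst p, snd p)"

definition right_act :: "'b \<Rightarrow> 'a \<times> 'b \<Rightarrow> 'a \<times> 'b" where
  "right_act b p = (fst p, snd p \<cdot>\<^bsub>B\<^esub> b)"

abbreviation LS :: "'h \<Rightarrow> ('i \<Rightarrow> 'b) \<Rightarrow> 'i list \<Rightarrow> 'b" where
  "LS k \<equiv> cvec.lsum (badd B) (bzero B k)"

text \<open>The degree k only selects the zero from which the sums start, since different fibres
  have different zeros.\<close>

definition gram :: "'h \<Rightarrow> ('a \<times> 'b) list \<Rightarrow> ('a \<times> 'b) list \<Rightarrow> 'b" where
  "gram k xs ys = LS k (\<lambda>p. LS k (tensor_ip p) ys) xs"

lemma tensors_tot:
  assumes "r \<in> carrier H" "p \<in> tensors r" shows "fst p \<in> A.tot" "snd p \<in> tot"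
proof -
  obtain g where g: "g \<in> carrier G" "fst p \<in> fib A g" "snd p \<in> fib B (inv (\<phi> g) \<otimes> r)"
    using assms by (auto simp: tensors_def)
  show "fst p \<in> A.tot" using A.fib_tot[OF g(1,2)] .
  show "snd p \<in> tot" using fib_tot[OF _ g(3)] assms g by simp
qed

lemma tensors_mul_fib:
  assumes "p \<in> tensors r" "q \<in> tensors s"
  obtains g where "g \<in> carrier G" "bstar A (fst p) \<cdot>\<^bsub>A\<^esub> fst q \<in> fib A g"
proof -
  obtain g where g: "g \<in> carrier G" "fst p \<in> fib A g" using assms by (auto simp: tensors_def)
  obtain g' where g': "g' \<in> carrier G" "fst q \<in> fib A g'" using assms by (auto simp: tensors_def)
  show thesis
    by (rule that[OF _ A.fib_mul[OF _ g'(1) A.fib_star[OF g refl] g'(2) refl]]) (use g g' in simp_all)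
qed

lemma tensors_T_tot: "p \<in> tensors r \<Longrightarrow> q \<in> tensors s \<Longrightarrow> T (bstar A (fst p) \<cdot>\<^bsub>A\<^esub> fst q) \<in> tot"
  using tensors_mul_fib[of p r q s] T_fib[OF _ _ refl] fib_tot phi_closed by metis

lemma tensor_ip_fib:
  assumes r: "r \<in> carrier H" "p \<in> tensors r" and s: "s \<in> carrier H" "q \<in> tensors s"
  shows "tensor_ip p q \<in> fib B (inv r \<otimes> s)"
proof -
  obtain g where g: "g \<in> carrier G" "fst p \<in> fib A g" "snd p \<in> fib B (inv (\<phi> g) \<otimes> r)"
    using r by (auto simp: tensors_def)
  obtain k where k: "k \<in> carrier G" "fst q \<in> fib A k" "snd q \<in> fib B (inv (\<phi> k) \<otimes> s)"
    using s by (auto simp: tensors_def)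
  have b: "bstar B (snd p) \<in> fib B (inv r \<otimes> \<phi> g)"
    by (rule fib_star[OF _ g(3)]) (use g r in \<open>simp_all add: inv_mult_group\<close>)
  have "bstar A (fst p) \<cdot>\<^bsub>A\<^esub> fst q \<in> fib A (inv\<^bsub>G\<^esub> g \<otimes>\<^bsub>G\<^esub> k)"
    by (rule A.fib_mul[OF _ k(1) A.fib_star[OF g(1,2) refl] k(2)]) (use g k in simp_all)
  then have "T (bstar A (fst p) \<cdot>\<^bsub>A\<^esub> fst q) \<in> fib B (inv (\<phi> g) \<otimes> \<phi> k)"
    by (rule T_fib[rotated]) (use g k in \<open>simp_all add: phi_mult phi_inv\<close>)
  then have "T (bstar A (fst p) \<cdot>\<^bsub>A\<^esub> fst q) \<cdot>\<^bsub>B\<^esub> snd q \<in> fib B (inv (\<phi> g) \<otimes> s)"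
    by (rule fib_mul[rotated 2, OF _ k(3)]) (use g k s in \<open>simp_all add: m_assoc\<close>)
  then show ?thesis
    unfolding tensor_ip_def by (rule fib_mul[rotated 2, OF b]) (use g r s in \<open>simp_all add: m_assoc\<close>)
qed

lemma left_act_tensors:
  assumes "r \<in> carrier H" "p \<in> tensors r" and c: "g \<in> carrier G" "c \<in> fib A g"
  shows "left_act c p \<in> tensors (\<phi> g \<otimes> r)"
proof -
  obtain k where k: "k \<in> carrier G" "fst p \<in> fib A k" "snd p \<in> fib B (inv (\<phi> k) \<otimes> r)"
    using assms by (auto simp: tensors_def)
  have "inv (\<phi> (g \<otimes>\<^bsub>G\<^esub> k)) \<otimes> (\<phi> g \<otimes> r) = inv (\<phi> k) \<otimes> r"
    using assms k by (simp add: phi_mult inv_mult_group m_assoc)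
  then show ?thesis
    using A.fib_mul[OF c(1) k(1) c(2) k(2) refl] k c A.m_closed
    by (auto simp: tensors_def left_act_def intro!: bexI[of _ "g \<otimes>\<^bsub>G\<^esub> k"])
qed

lemma right_act_tensors:
  assumes "r \<in> carrier H" "p \<in> tensors r" and b: "s \<in> carrier H" "b \<in> fib B s"
  shows "right_act b p \<in> tensors (r \<otimes> s)"
proof -
  obtain k where k: "k \<in> carrier G" "fst p \<in> fib A k" "snd p \<in> fib B (inv (\<phi> k) \<otimes> r)"
    using assms by (auto simp: tensors_def)
  have "snd p \<cdot>\<^bsub>B\<^esub> b \<in> fib B (inv (\<phi> k) \<otimes> (r \<otimes> s))"
    by (rule fib_mul[OF _ b(1) k(3) b(2)]) (use assms k in \<open>simp_all add: m_assoc\<close>)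
  then show ?thesis using k by (auto simp: tensors_def right_act_def)
qed

lemma tensor_ip_left_act:
  assumes "r \<in> carrier H" "p \<in> tensors r" "s \<in> carrier H" "q \<in> tensors s" "c \<in> A.tot"
  shows "tensor_ip (left_act c p) q = tensor_ip p (left_act (bstar A c) q)"
  using tensors_tot[OF assms(1,2)] tensors_tot[OF assms(3,4)] assms(5)
  by (simp add: tensor_ip_def left_act_def A.bstar_bmul A.bmul_assoc)

lemma tensor_ip_right_act:
  assumes "r \<in> carrier H" "p \<in> tensors r" "s \<in> carrier H" "q \<in> tensors s" "b \<in> tot"
  shows "tensor_ip p (right_act b q) = tensor_ip p q \<cdot>\<^bsub>B\<^esub> b" "tensor_ip (right_act b p) q = bstar B b \<cdot>\<^bsub>B\<^esub> tensor_ip p q"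
  using tensors_tot[OF assms(1,2)] tensors_tot[OF assms(3,4)] assms(5) tensors_T_tot[OF assms(2,4)]
  by (simp_all add: tensor_ip_def right_act_def bstar_bmul bmul_assoc)

section \<open>Gram sums and positivity in the unit degree\<close>

lemma gram_hom:
  assumes k: "k \<in> carrier H" "k' \<in> carrier H"
    and h: "\<And>x. x \<in> fib B k \<Longrightarrow> h x \<in> fib B k'"
      "\<And>x y. x \<in> fib B k \<Longrightarrow> y \<in> fib B k \<Longrightarrow> h (x \<oplus>\<^bsub>B\<^esub> y) = h x \<oplus>\<^bsub>B\<^esub> h y"
    and tm: "\<And>p q. p \<in> set xs \<Longrightarrow> q \<in> set ys \<Longrightarrow> tensor_ip p q \<in> fib B k"
      "\<And>p q. p \<in> set xs \<Longrightarrow> q \<in> set ys \<Longrightarrow> tensor_ip (f p) (f' q) = h (tensor_ip p q)"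
  shows "gram k' (map f xs) (map f' ys) = h (gram k xs ys)"
proof -
  interpret V: cvec "fib B k" "badd B" "bsm B" "bzero B k" "bnorm B" by (rule cvec_fib[OF k(1)])
  interpret V': cvec "fib B k'" "badd B" "bsm B" "bzero B k'" "bnorm B" by (rule cvec_fib[OF k(2)])
  have inner: "h (LS k (tensor_ip p) ys) = LS k' (\<lambda>q. tensor_ip (f p) (f' q)) ys" "LS k (tensor_ip p) ys \<in> fib B k"
    if p: "p \<in> set xs" for p
  proof -
    have "h (LS k (tensor_ip p) ys) = LS k' (\<lambda>q. h (tensor_ip p q)) ys"
      by (rule lsum_hom[where h = h, OF V.cvec_axioms V'.cvec_axioms]; (rule h tm(1)[OF p]; assumption))
    also have "\<dots> = LS k' (\<lambda>q. tensor_ip (f p) (f' q)) ys"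
      by (rule V'.lsum_cong) (rule tm(2)[OF p, symmetric])
    finally show "h (LS k (tensor_ip p) ys) = LS k' (\<lambda>q. tensor_ip (f p) (f' q)) ys" .
    show "LS k (tensor_ip p) ys \<in> fib B k" by (rule V.lsum_closed) (rule tm(1)[OF p])
  qed
  have "h (gram k xs ys) = LS k' (\<lambda>p. h (LS k (tensor_ip p) ys)) xs"
    unfolding gram_def
    by (rule lsum_hom[where h = h, OF V.cvec_axioms V'.cvec_axioms]; (rule h inner(2); assumption))
  also have "\<dots> = LS k' (\<lambda>p. LS k' (\<lambda>q. tensor_ip (f p) (f' q)) ys) xs"
    by (rule V'.lsum_cong) (rule inner(1))
  finally show ?thesis by (simp only: gram_def V'.lsum_map)
qed

lemma gram_add:
  assumes k: "k \<in> carrier H"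
    and tm: "\<And>p q. p \<in> set xs \<Longrightarrow> q \<in> set ys \<Longrightarrow> tensor_ip p (f q) \<in> fib B k"
      "\<And>p q. p \<in> set xs \<Longrightarrow> q \<in> set ys \<Longrightarrow> tensor_ip p (f' q) \<in> fib B k"
      "\<And>p q. p \<in> set xs \<Longrightarrow> q \<in> set ys \<Longrightarrow> tensor_ip p (f'' q) = tensor_ip p (f q) \<oplus>\<^bsub>B\<^esub> tensor_ip p (f' q)"
  shows "gram k xs (map f'' ys) = gram k xs (map f ys) \<oplus>\<^bsub>B\<^esub> gram k xs (map f' ys)"
proof -
  interpret V: cvec "fib B k" "badd B" "bsm B" "bzero B k" "bnorm B" by (rule cvec_fib[OF k])
  have "gram k xs (map f'' ys) = LS k (\<lambda>p. LS k (\<lambda>q. tensor_ip p (f q)) ys \<oplus>\<^bsub>B\<^esub> LS k (\<lambda>q. tensor_ip p (f' q)) ys) xs"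
    unfolding gram_def V.lsum_map
  proof (rule V.lsum_cong)
    fix p assume p: "p \<in> set xs"
    have "LS k (\<lambda>q. tensor_ip p (f'' q)) ys = LS k (\<lambda>q. tensor_ip p (f q) \<oplus>\<^bsub>B\<^esub> tensor_ip p (f' q)) ys"
      by (rule V.lsum_cong) (simp add: tm(3) p)
    also have "\<dots> = LS k (\<lambda>q. tensor_ip p (f q)) ys \<oplus>\<^bsub>B\<^esub> LS k (\<lambda>q. tensor_ip p (f' q)) ys"
      by (rule V.lsum_add) (simp_all add: tm p)
    finally show "LS k (\<lambda>q. tensor_ip p (f'' q)) ys = LS k (\<lambda>q. tensor_ip p (f q)) ys \<oplus>\<^bsub>B\<^esub> LS k (\<lambda>q. tensor_ip p (f' q)) ys" .
  qed
  also have "\<dots> = gram k xs (map f ys) \<oplus>\<^bsub>B\<^esub> gram k xs (map f' ys)"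
    unfolding gram_def V.lsum_map
    by (rule V.lsum_add) (auto intro!: V.lsum_closed tm)
  finally show ?thesis .
qed

lemma gram_fib:
  assumes "r \<in> carrier H" "set xs \<subseteq> tensors r" "s \<in> carrier H" "set ys \<subseteq> tensors s"
  shows "gram (inv r \<otimes> s) xs ys \<in> fib B (inv r \<otimes> s)"
proof -
  have k: "inv r \<otimes> s \<in> carrier H" using assms by simp
  show ?thesis unfolding gram_def
    by (intro cvec.lsum_closed[OF cvec_fib[OF k]] tensor_ip_fib) (use assms in auto)
qed

text \<open>In the unit degree the second component of a tensor has degree inverse to \<phi>(g), so
  its adjoint has the degree that \<open>positive_definite\<close> prescribes for the coefficients
  b_i.\<close>

lemma pos_gram_unit_degree:
  assumes xs: "set xs \<subseteq> tensors \<one>"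
  shows "E.pos (gram \<one> xs xs)"
proof -
  let ?n = "length xs"
  have "\<exists>g. g \<in> carrier G \<and> fst (xs ! i) \<in> fib A g \<and> snd (xs ! i) \<in> fib B (inv (\<phi> g))" if "i < ?n" for i
    using subsetD[OF xs nth_mem[OF that]] by (auto simp: tensors_def)
  then obtain gs where gs: "\<And>i. i < ?n \<Longrightarrow> gs i \<in> carrier G"
    "\<And>i. i < ?n \<Longrightarrow> fst (xs ! i) \<in> fib A (gs i)" "\<And>i. i < ?n \<Longrightarrow> snd (xs ! i) \<in> fib B (inv (\<phi> (gs i)))"
    by metis
  let ?b = "\<lambda>i. bstar B (snd (xs ! i))"
  have b: "?b i \<in> fib B (\<phi> (gs i))" if "i < ?n" for i
    by (rule fib_star[OF _ gs(3)[OF that]]) (use gs(1)[OF that] in simp_all)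
  have deg: "\<forall>i<?n. gs i \<in> carrier G \<and> fst (xs ! i) \<in> fib A (gs i) \<and> ?b i \<in> fib B (\<phi> (gs i))"
    using gs b by blast
  have "pos_e H B (fsum (badd B) (bzero B \<one>) (\<lambda>i. fsum (badd B) (bzero B \<one>)
      (\<lambda>j. ?b i \<cdot>\<^bsub>B\<^esub> T (bstar A (fst (xs ! i)) \<cdot>\<^bsub>A\<^esub> fst (xs ! j)) \<cdot>\<^bsub>B\<^esub> bstar B (?b j)) ?n) ?n)"
    by (rule posdef[unfolded positive_definite_def, THEN spec[of _ ?n], THEN spec[of _ gs],
          THEN spec[of _ "\<lambda>i. fst (xs ! i)"], THEN spec[of _ ?b], THEN mp, OF deg])
  also have "fsum (badd B) (bzero B \<one>) (\<lambda>i. fsum (badd B) (bzero B \<one>)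
      (\<lambda>j. ?b i \<cdot>\<^bsub>B\<^esub> T (bstar A (fst (xs ! i)) \<cdot>\<^bsub>A\<^esub> fst (xs ! j)) \<cdot>\<^bsub>B\<^esub> bstar B (?b j)) ?n) ?n =
      fsum (badd B) (bzero B \<one>) (\<lambda>i. LS \<one> (tensor_ip (xs ! i)) xs) ?n"
  proof (rule fsum_cong)
    fix i assume i: "i < ?n"
    have pi: "xs ! i \<in> tensors \<one>" using xs i by auto
    have "fsum (badd B) (bzero B \<one>)
        (\<lambda>j. ?b i \<cdot>\<^bsub>B\<^esub> T (bstar A (fst (xs ! i)) \<cdot>\<^bsub>A\<^esub> fst (xs ! j)) \<cdot>\<^bsub>B\<^esub> bstar B (?b j)) ?n =
      fsum (badd B) (bzero B \<one>) (\<lambda>j. tensor_ip (xs ! i) (xs ! j)) ?n"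
    proof (rule fsum_cong)
      fix j assume j: "j < ?n"
      have pj: "xs ! j \<in> tensors \<one>" using xs j by auto
      show "?b i \<cdot>\<^bsub>B\<^esub> T (bstar A (fst (xs ! i)) \<cdot>\<^bsub>A\<^esub> fst (xs ! j)) \<cdot>\<^bsub>B\<^esub> bstar B (?b j) = tensor_ip (xs ! i) (xs ! j)"
        using tensors_tot[OF one_closed pi] tensors_tot[OF one_closed pj] tensors_T_tot[OF pi pj] by (simp add: tensor_ip_def bmul_assoc)
    qed
    also have "\<dots> = LS \<one> (tensor_ip (xs ! i)) xs"
      by (rule E.fsum_nth) (use tensor_ip_fib[OF one_closed pi one_closed] xs in auto)
    finally show "fsum (badd B) (bzero B \<one>)
        (\<lambda>j. ?b i \<cdot>\<^bsub>B\<^esub> T (bstar A (fst (xs ! i)) \<cdot>\<^bsub>A\<^esub> fst (xs ! j)) \<cdot>\<^bsub>B\<^esub> bstar B (?b j)) ?n =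
      LS \<one> (tensor_ip (xs ! i)) xs" .
  qed
  also have "\<dots> = gram \<one> xs xs"
    unfolding gram_def
  proof (rule E.fsum_nth[where f = "\<lambda>p. LS \<one> (tensor_ip p) xs"], rule E.lsum_closed)
    fix p q assume "p \<in> set xs" "q \<in> set xs"
    then show "tensor_ip p q \<in> fib B \<one>" using tensor_ip_fib[OF one_closed _ one_closed, of p q] xs by auto
  qed
  finally show ?thesis by (simp add: pos_e_iff)
qed

section \<open>Hermitian symmetry\<close>

lemma phi_one: "\<phi> \<one>\<^bsub>G\<^esub> = \<one>"
  using phi_mult[of "\<one>\<^bsub>G\<^esub>" "\<one>\<^bsub>G\<^esub>"] l_cancel_one[of "\<phi> \<one>\<^bsub>G\<^esub>" "\<phi> \<one>\<^bsub>G\<^esub>"] by simp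

text \<open>Positive definiteness for the pairs \<open>(1, 1), (a, b)\<close> and \<open>(1, 1), (a, \<i>b)\<close> shows, by
  polarization, that \<open>T(a) b = T(a\<^sup>*)\<^sup>* b\<close> for all \<open>b\<close> of degree inverse to that of \<open>T(a)\<close>.\<close>

lemma T_star:
  assumes a: "g \<in> carrier G" "a \<in> fib A g"
  shows "bstar B (T a) = T (bstar A a)"
proof -
  let ?X = "T a" and ?Y = "T (bstar A a)"
  have at: "a \<in> A.tot" and vt: "v \<in> A.tot" and ut: "u \<in> tot"
    using A.fib_tot[OF a] A.fib_tot[OF _ A.unit_fib] fib_tot[OF _ unit_fib] by simp_all
  have gi: "inv (\<phi> g) \<in> carrier H" "inv\<^bsub>G\<^esub> g \<in> carrier G" "\<phi> g \<in> carrier H" using a by simp_all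
  have X: "?X \<in> fib B (\<phi> g)" by (rule T_fib[OF a refl])
  have Y: "?Y \<in> fib B (inv (\<phi> g))" by (rule T_fib[OF gi(2) A.fib_star[OF a refl] phi_inv[OF a(1)]])
  have Xt: "?X \<in> tot" "?Y \<in> tot" using fib_tot[OF gi(3) X] fib_tot[OF gi(1) Y] by simp_all
  let ?p = "(v, u)"
  have p: "?p \<in> tensors \<one>" using A.unit_fib unit_fib by (auto simp: tensors_def phi_one intro!: bexI[of _ "\<one>\<^bsub>G\<^esub>"])
  \<comment> \<open>The Gram sum of the two pairs and its diagonal terms are self-adjoint, hence so
    is the sum of the two off-diagonal terms.\<close>
  have sa: "?X \<cdot>\<^bsub>B\<^esub> b \<oplus>\<^bsub>B\<^esub> bstar B b \<cdot>\<^bsub>B\<^esub> ?Y = bstar B (?X \<cdot>\<^bsub>B\<^esub> b) \<oplus>\<^bsub>B\<^esub> bstar B (bstar B b \<cdot>\<^bsub>B\<^esub> ?Y)"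
    and fb: "?X \<cdot>\<^bsub>B\<^esub> b \<in> fib B \<one>" "bstar B b \<cdot>\<^bsub>B\<^esub> ?Y \<in> fib B \<one>"
    if b: "b \<in> fib B (inv (\<phi> g))" for b
  proof -
    let ?q = "(a, b)"
    have bt: "b \<in> tot" using fib_tot[OF gi(1) b] .
    have q: "?q \<in> tensors \<one>" using a b by (auto simp: tensors_def)
    have pq: "tensor_ip ?p ?q = ?X \<cdot>\<^bsub>B\<^esub> b" "tensor_ip ?q ?p = bstar B b \<cdot>\<^bsub>B\<^esub> ?Y"
      using at vt bt Xt by (simp_all add: tensor_ip_def)
    have f: "tensor_ip ?p ?p \<in> fib B \<one>" "tensor_ip ?q ?q \<in> fib B \<one>" "tensor_ip ?p ?q \<in> fib B \<one>" "tensor_ip ?q ?p \<in> fib B \<one>"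
      using tensor_ip_fib[OF one_closed p one_closed p] tensor_ip_fib[OF one_closed q one_closed q]
        tensor_ip_fib[OF one_closed p one_closed q] tensor_ip_fib[OF one_closed q one_closed p] by simp_all
    show "?X \<cdot>\<^bsub>B\<^esub> b \<in> fib B \<one>" "bstar B b \<cdot>\<^bsub>B\<^esub> ?Y \<in> fib B \<one>" using f pq by simp_all
    have "E.pos (tensor_ip ?p ?p)" "E.pos (tensor_ip ?q ?q)"
      using pos_gram_unit_degree[of "[?p]"] pos_gram_unit_degree[of "[?q]"] p q f by (simp_all add: gram_def)
    then have d: "bstar B (tensor_ip ?p ?p) = tensor_ip ?p ?p" "bstar B (tensor_ip ?q ?q) = tensor_ip ?q ?q" by simp_all
    have ps: "E.pos ((tensor_ip ?p ?p \<oplus>\<^bsub>B\<^esub> tensor_ip ?p ?q) \<oplus>\<^bsub>B\<^esub> (tensor_ip ?q ?p \<oplus>\<^bsub>B\<^esub> tensor_ip ?q ?q))"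
      using pos_gram_unit_degree[of "[?p, ?q]"] p q f by (simp add: gram_def)
    have s: "(tensor_ip ?p ?p \<oplus>\<^bsub>B\<^esub> bstar B (tensor_ip ?p ?q)) \<oplus>\<^bsub>B\<^esub> (bstar B (tensor_ip ?q ?p) \<oplus>\<^bsub>B\<^esub> tensor_ip ?q ?q) =
        (tensor_ip ?p ?p \<oplus>\<^bsub>B\<^esub> tensor_ip ?p ?q) \<oplus>\<^bsub>B\<^esub> (tensor_ip ?q ?p \<oplus>\<^bsub>B\<^esub> tensor_ip ?q ?q)"
      using E.pos_star[OF ps] by (simp only: E.star_add E.add_closed f d)
    have c: "x \<oplus>\<^bsub>B\<^esub> y = ((tensor_ip ?p ?p \<oplus>\<^bsub>B\<^esub> x) \<oplus>\<^bsub>B\<^esub> (y \<oplus>\<^bsub>B\<^esub> tensor_ip ?q ?q)) \<oplus>\<^bsub>B\<^esub>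
        (-1) \<odot>\<^bsub>B\<^esub> (tensor_ip ?p ?p \<oplus>\<^bsub>B\<^esub> tensor_ip ?q ?q)" if "x \<in> fib B \<one>" "y \<in> fib B \<one>" for x y
      by (intro E.vec_eqI) ((rule E.rp_rules | simp add: f that)+)
    show "?X \<cdot>\<^bsub>B\<^esub> b \<oplus>\<^bsub>B\<^esub> bstar B b \<cdot>\<^bsub>B\<^esub> ?Y = bstar B (?X \<cdot>\<^bsub>B\<^esub> b) \<oplus>\<^bsub>B\<^esub> bstar B (bstar B b \<cdot>\<^bsub>B\<^esub> ?Y)"
      unfolding pq[symmetric] c[OF f(3,4)] c[OF E.star_closed[OF f(3)] E.star_closed[OF f(4)]] s ..
  qed
  \<comment> \<open>The difference D is tested against b = D^*, the element for which the asserted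
    identity reads D D^* = 0.\<close>
  let ?D = "?X \<oplus>\<^bsub>B\<^esub> (-1) \<odot>\<^bsub>B\<^esub> bstar B ?Y"
  have Ys: "bstar B ?Y \<in> fib B (\<phi> g)" by (rule fib_star[OF gi(1) Y]) (use gi in simp)
  have dD: "?D \<in> fib B (\<phi> g)" using gi X Ys by (intro fib_add fib_sm)
  have Dt: "?D \<in> tot" using fib_tot[OF gi(3) dD] .
  let ?b = "bstar B ?D"
  have b: "?b \<in> fib B (inv (\<phi> g))" by (rule fib_star[OF gi(3) dD refl])
  have bt: "?b \<in> tot" using Dt by simp
  have ib: "\<i> \<odot>\<^bsub>B\<^esub> ?b \<in> fib B (inv (\<phi> g))" using fib_sm[OF gi(1) b] .
  define x y where "x = ?X \<cdot>\<^bsub>B\<^esub> ?b" and "y = bstar B ?b \<cdot>\<^bsub>B\<^esub> ?Y"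
  have xy: "x \<in> fib B \<one>" "y \<in> fib B \<one>" unfolding x_def y_def by (rule fb[OF b])+
  have "x \<oplus>\<^bsub>B\<^esub> y = bstar B x \<oplus>\<^bsub>B\<^esub> bstar B y" unfolding x_def y_def by (rule sa[OF b])
  moreover have "\<i> \<odot>\<^bsub>B\<^esub> x \<oplus>\<^bsub>B\<^esub> (-\<i>) \<odot>\<^bsub>B\<^esub> y = (-\<i>) \<odot>\<^bsub>B\<^esub> bstar B x \<oplus>\<^bsub>B\<^esub> \<i> \<odot>\<^bsub>B\<^esub> bstar B y"
  proof -
    have e: "?X \<cdot>\<^bsub>B\<^esub> (\<i> \<odot>\<^bsub>B\<^esub> ?b) = \<i> \<odot>\<^bsub>B\<^esub> x" "bstar B (\<i> \<odot>\<^bsub>B\<^esub> ?b) \<cdot>\<^bsub>B\<^esub> ?Y = (-\<i>) \<odot>\<^bsub>B\<^esub> y"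
      unfolding x_def y_def bstar_sm[OF bt] using Xt bt tot_star[OF bt] by (simp_all add: bmul_sm sm_bmul)
    show ?thesis using sa[OF ib] unfolding e using xy by simp
  qed
  \<comment> \<open>The cases b and i b say that x + y and i x - i y agree with their adjoints. The
    same linear formula recovers x from the former and y^* from the latter.\<close>
  moreover have "x = (1/2) \<odot>\<^bsub>B\<^esub> ((x \<oplus>\<^bsub>B\<^esub> y) \<oplus>\<^bsub>B\<^esub> (-\<i>) \<odot>\<^bsub>B\<^esub> (\<i> \<odot>\<^bsub>B\<^esub> x \<oplus>\<^bsub>B\<^esub> (-\<i>) \<odot>\<^bsub>B\<^esub> y))"
    by (intro E.vec_eqI) ((rule E.rp_rules | simp add: xy)+)
  moreover have "bstar B y = (1/2) \<odot>\<^bsub>B\<^esub> ((bstar B x \<oplus>\<^bsub>B\<^esub> bstar B y) \<oplus>\<^bsub>B\<^esub>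
      (-\<i>) \<odot>\<^bsub>B\<^esub> ((-\<i>) \<odot>\<^bsub>B\<^esub> bstar B x \<oplus>\<^bsub>B\<^esub> \<i> \<odot>\<^bsub>B\<^esub> bstar B y))"
    by (intro E.vec_eqI) ((rule E.rp_rules | simp add: xy)+)
  ultimately have "x = bstar B y" by metis
  also have "bstar B y = bstar B ?Y \<cdot>\<^bsub>B\<^esub> ?b"
    unfolding y_def using bt tot_star[OF bt] Xt by (subst bstar_bmul) simp_all
  finally have eq: "?X \<cdot>\<^bsub>B\<^esub> ?b = bstar B ?Y \<cdot>\<^bsub>B\<^esub> ?b" unfolding x_def .
  have Yt: "bstar B ?Y \<in> tot" using Xt by simp
  have "?D \<cdot>\<^bsub>B\<^esub> ?b = ?X \<cdot>\<^bsub>B\<^esub> ?b \<oplus>\<^bsub>B\<^esub> ((-1) \<odot>\<^bsub>B\<^esub> bstar B ?Y) \<cdot>\<^bsub>B\<^esub> ?b"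
    by (rule add_bmul[OF gi(3,1) X fib_sm[OF gi(3) Ys] b])
  also have "\<dots> = bzero B \<one>"
    unfolding sm_bmul[OF Yt bt] eq[symmetric] by (rule E.diff_self[OF fb(1)[OF b]])
  finally have "bnorm B ?b = 0"
    using bnorm_cstar[OF bt] bstar_bstar[OF Dt] E.nrm_zero by (simp del: bstar_bstar)
  then have "bnorm B ?D = 0" using bnorm_bstar[OF Dt] by simp
  then have "?D = bzero B (\<phi> g)" using bnorm_eq_0[OF gi(3) dD] by simp
  then have "?X = bstar B ?Y" by (rule cvec.eq_if_diff_zero[OF cvec_fib[OF gi(3)] X Ys])
  then show ?thesis using Xt by simp
qed

lemma tensor_ip_star:
  assumes "r \<in> carrier H" "p \<in> tensors r" "s \<in> carrier H" "q \<in> tensors s"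
  shows "bstar B (tensor_ip p q) = tensor_ip q p"
proof -
  obtain g where g: "g \<in> carrier G" "bstar A (fst p) \<cdot>\<^bsub>A\<^esub> fst q \<in> fib A g"
    using tensors_mul_fib[OF assms(2,4)] .
  show ?thesis
    using tensors_tot[OF assms(1,2)] tensors_tot[OF assms(3,4)] tensors_T_tot[OF assms(2,4)] tensors_T_tot[OF assms(4,2)] T_star[OF g]
    by (simp add: tensor_ip_def bstar_bmul bmul_assoc A.bstar_bmul)
qed

lemma gram_star:
  assumes r: "r \<in> carrier H" "set xs \<subseteq> tensors r" and s: "s \<in> carrier H" "set ys \<subseteq> tensors s"
  shows "bstar B (gram (inv r \<otimes> s) xs ys) = gram (inv s \<otimes> r) ys xs"
proof -
  have k: "inv r \<otimes> s \<in> carrier H" "inv s \<otimes> r \<in> carrier H" using r s by simp_all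
  have i: "inv (inv r \<otimes> s) = inv s \<otimes> r" using r s by (simp add: inv_mult_group)
  interpret V: cvec "fib B (inv r \<otimes> s)" "badd B" "bsm B" "bzero B (inv r \<otimes> s)" "bnorm B"
    by (rule cvec_fib[OF k(1)])
  interpret V': cvec "fib B (inv s \<otimes> r)" "badd B" "bsm B" "bzero B (inv s \<otimes> r)" "bnorm B"
    by (rule cvec_fib[OF k(2)])
  have h: "\<And>x. x \<in> fib B (inv r \<otimes> s) \<Longrightarrow> bstar B x \<in> fib B (inv s \<otimes> r)"
    "\<And>x y. x \<in> fib B (inv r \<otimes> s) \<Longrightarrow> y \<in> fib B (inv r \<otimes> s) \<Longrightarrow>
      bstar B (x \<oplus>\<^bsub>B\<^esub> y) = bstar B x \<oplus>\<^bsub>B\<^esub> bstar B y"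
    by (rule fib_star[OF k(1) _ i] bstar_add[OF k(1)]; assumption)+
  have f: "p \<in> set xs \<Longrightarrow> q \<in> set ys \<Longrightarrow> tensor_ip p q \<in> fib B (inv r \<otimes> s)" for p q
    by (rule tensor_ip_fib) (use r s in auto)
  have f': "p \<in> set xs \<Longrightarrow> q \<in> set ys \<Longrightarrow> tensor_ip q p \<in> fib B (inv s \<otimes> r)" for p q
    by (rule tensor_ip_fib) (use r s in auto)
  let ?k = "inv r \<otimes> s" and ?k' = "inv s \<otimes> r"
  have inner: "bstar B (LS ?k (tensor_ip p) ys) = LS ?k' (\<lambda>q. tensor_ip q p) ys" "LS ?k (tensor_ip p) ys \<in> fib B ?k"
    if p: "p \<in> set xs" for p
  proof -
    have "bstar B (LS ?k (tensor_ip p) ys) = LS ?k' (\<lambda>q. bstar B (tensor_ip p q)) ys"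
      by (rule lsum_hom[where h = "bstar B", OF V.cvec_axioms V'.cvec_axioms]; (rule h f[OF p]; assumption))
    also have "\<dots> = LS ?k' (\<lambda>q. tensor_ip q p) ys"
      by (rule V'.lsum_cong, rule tensor_ip_star[OF r(1) _ s(1)]) (use r s p in auto)
    finally show "bstar B (LS ?k (tensor_ip p) ys) = LS ?k' (\<lambda>q. tensor_ip q p) ys" .
    show "LS ?k (tensor_ip p) ys \<in> fib B ?k" by (rule V.lsum_closed) (rule f[OF p])
  qed
  have "bstar B (gram ?k xs ys) = LS ?k' (\<lambda>p. bstar B (LS ?k (tensor_ip p) ys)) xs"
    unfolding gram_def
    by (rule lsum_hom[where h = "bstar B", OF V.cvec_axioms V'.cvec_axioms]; (rule h inner(2); assumption))
  also have "\<dots> = LS ?k' (\<lambda>p. LS ?k' (\<lambda>q. tensor_ip q p) ys) xs"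
    by (rule V'.lsum_cong) (rule inner(1))
  also have "\<dots> = gram ?k' ys xs"
    unfolding gram_def by (rule V'.lsum_swap) (rule f')
  finally show ?thesis .
qed

section \<open>Deleting a tensor whose first component has unit degree\<close>

lemma tensor_ip_fib_one: "r \<in> carrier H \<Longrightarrow> p \<in> tensors r \<Longrightarrow> q \<in> tensors r \<Longrightarrow> tensor_ip p q \<in> fib B \<one>"
  using tensor_ip_fib[of r p r q] by simp

lemma gram_fib_one: "r \<in> carrier H \<Longrightarrow> set xs \<subseteq> tensors r \<Longrightarrow> set ys \<subseteq> tensors r \<Longrightarrow> gram \<one> xs ys \<in> fib B \<one>"
  using gram_fib[of r xs r ys] by simp

lemma gram_map_cong:
  assumes "k \<in> carrier H" "\<And>p q. p \<in> set xs \<Longrightarrow> q \<in> set ys \<Longrightarrow> tensor_ip (f p) (f' q) = tensor_ip (g p) (g' q)"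
  shows "gram k (map f xs) (map f' ys) = gram k (map g xs) (map g' ys)"
proof -
  interpret V: cvec "fib B k" "badd B" "bsm B" "bzero B k" "bnorm B" by (rule cvec_fib[OF assms(1)])
  show ?thesis unfolding gram_def V.lsum_map
    by (intro V.lsum_cong assms(2))
qed

lemma gram_right_act:
  assumes r: "r \<in> carrier H" "set xs \<subseteq> tensors r" and m: "s \<in> carrier H" "m \<in> fib B s"
  shows "gram \<one> (map (right_act m) xs) (map (right_act m) xs) = bstar B m \<cdot>\<^bsub>B\<^esub> (gram \<one> xs xs \<cdot>\<^bsub>B\<^esub> m)"
proof (rule gram_hom[where h = "\<lambda>x. bstar B m \<cdot>\<^bsub>B\<^esub> (x \<cdot>\<^bsub>B\<^esub> m)" and k = \<one>, OF one_closed one_closed])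
  have mt: "m \<in> tot" using fib_tot[OF m] .
  have si: "inv s \<in> carrier H" using m by simp
  note ms = fib_star[OF m refl]
  have xm: "x \<cdot>\<^bsub>B\<^esub> m \<in> fib B s" if "x \<in> fib B \<one>" for x
    by (rule fib_mul[OF one_closed m(1) that m(2)]) (use m in simp)
  show "bstar B m \<cdot>\<^bsub>B\<^esub> (x \<cdot>\<^bsub>B\<^esub> m) \<in> fib B \<one>" if "x \<in> fib B \<one>" for x
    by (rule fib_mul[OF si m(1) ms xm[OF that]]) (use m in simp)
  show "bstar B m \<cdot>\<^bsub>B\<^esub> ((x \<oplus>\<^bsub>B\<^esub> y) \<cdot>\<^bsub>B\<^esub> m) =
      bstar B m \<cdot>\<^bsub>B\<^esub> (x \<cdot>\<^bsub>B\<^esub> m) \<oplus>\<^bsub>B\<^esub> bstar B m \<cdot>\<^bsub>B\<^esub> (y \<cdot>\<^bsub>B\<^esub> m)" if "x \<in> fib B \<one>" "y \<in> fib B \<one>" for x y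
    using add_bmul[OF one_closed m(1) that m(2)] bmul_add[OF m(1) si xm[OF that(1)] xm[OF that(2)] ms] by simp
  fix p q assume "p \<in> set xs" "q \<in> set xs"
  then have pq: "p \<in> tensors r" "q \<in> tensors r" using r by auto
  then show f: "tensor_ip p q \<in> fib B \<one>" by (rule tensor_ip_fib_one[OF r(1)])
  have "tensor_ip (right_act m p) (right_act m q) = tensor_ip (right_act m p) q \<cdot>\<^bsub>B\<^esub> m"
    by (rule tensor_ip_right_act(1)[OF _ right_act_tensors[OF r(1) pq(1) m] r(1) pq(2) mt]) (use r m in simp)
  also have "\<dots> = bstar B m \<cdot>\<^bsub>B\<^esub> (tensor_ip p q \<cdot>\<^bsub>B\<^esub> m)"
    using tensor_ip_right_act(2)[OF r(1) pq(1) r(1) pq(2) mt] mt fib_tot[OF one_closed f] by (simp add: bmul_assoc)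
  finally show "tensor_ip (right_act m p) (right_act m q) = bstar B m \<cdot>\<^bsub>B\<^esub> (tensor_ip p q \<cdot>\<^bsub>B\<^esub> m)" .
qed

text \<open>The hypothesis is put on the norm so that the degree of \<open>snd w\<close>, on which
  the zero element depends, need not be named.\<close>

lemma tensor_ip_zero:
  assumes r: "r \<in> carrier H" "w \<in> tensors r" "q \<in> tensors r" and z: "bnorm B (snd w) = 0"
  shows "tensor_ip w q = bzero B \<one>" "tensor_ip q w = bzero B \<one>"
proof -
  have tt: "snd w \<in> tot" "snd q \<in> tot" "T (bstar A (fst w) \<cdot>\<^bsub>A\<^esub> fst q) \<in> tot"
    using tensors_tot[OF r(1,2)] tensors_tot[OF r(1,3)] tensors_T_tot[OF r(2,3)] by simp_all
  have "bnorm B (tensor_ip w q) \<le> bnorm B (bstar B (snd w)) * bnorm B (T (bstar A (fst w) \<cdot>\<^bsub>A\<^esub> fst q) \<cdot>\<^bsub>B\<^esub> snd q)"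
    unfolding tensor_ip_def by (rule bnorm_bmul) (simp_all add: tt)
  then have "bnorm B (tensor_ip w q) = 0"
    using z tt E.nrm_ge_0[OF tensor_ip_fib_one[OF r]] by (simp add: bnorm_bstar)
  then show *: "tensor_ip w q = bzero B \<one>" using tensor_ip_fib_one[OF r] by simp
  show "tensor_ip q w = bzero B \<one>" using tensor_ip_star[OF r(1,2) r(1,3)] * by simp
qed

lemma gram_drop:
  assumes r: "r \<in> carrier H" "set (us @ w # vs) \<subseteq> tensors r" and z: "bnorm B (snd w) = 0"
  shows "gram \<one> (us @ w # vs) (us @ w # vs) = gram \<one> (us @ vs) (us @ vs)"
proof -
  have w: "w \<in> tensors r" using r by simp
  have in1: "LS \<one> (tensor_ip p) (us @ w # vs) = LS \<one> (tensor_ip p) (us @ vs)" if "p \<in> tensors r" for p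
  proof (rule E.lsum_drop)
    show "tensor_ip p w = bzero B \<one>" by (rule tensor_ip_zero(2)[OF r(1) w that z])
  qed (use r tensor_ip_fib_one[OF r(1) that] in auto)
  have out: "LS \<one> (tensor_ip w) (us @ vs) = bzero B \<one>"
    by (rule E.lsum_zero, rule tensor_ip_zero(1)[OF r(1) w _ z]) (use r in auto)
  have "gram \<one> (us @ w # vs) (us @ w # vs) = LS \<one> (\<lambda>p. LS \<one> (tensor_ip p) (us @ vs)) (us @ w # vs)"
    unfolding gram_def by (rule E.lsum_cong, rule in1) (use r in auto)
  also have "\<dots> = gram \<one> (us @ vs) (us @ vs)"
    unfolding gram_def
    by (rule E.lsum_drop[where f = "\<lambda>p. LS \<one> (tensor_ip p) (us @ vs)", OF E.lsum_closed out],
        rule tensor_ip_fib_one[OF r(1)]) (use r in auto)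
  finally show ?thesis .
qed

lemma bnorm_eq_0_of_pos_neg:
  assumes "w \<in> tot" "E.pos ((-1) \<odot>\<^bsub>B\<^esub> (bstar B w \<cdot>\<^bsub>B\<^esub> w))"
  shows "bnorm B w = 0"
  using E.pos_antisym[OF pos_cstar[OF assms(1)] assms(2)] bnorm_cstar[OF assms(1)] E.nrm_zero by simp

text \<open>Positive definiteness is an assertion about lists of degree \<open>\<one>\<close>. If the list contains a
  tensor \<open>c \<otimes> b\<close> with \<open>c\<close> of degree \<open>\<one>\<close>, then multiplying all its members by \<open>n b\<^sup>*\<close>, where
  \<open>n\<close> is the negative part of the Gram sum \<open>y\<close>, gives a list of degree \<open>\<one>\<close>; thus
  \<open>b n y n b\<^sup>* \<ge> 0\<close>, so that \<open>n b\<^sup>* = 0\<close>. Hence \<open>n y n\<close> does not change when the tensor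
  \<open>c \<otimes> b\<close> is deleted from the list.\<close>

lemma pos_gram_step:
  assumes r: "r \<in> carrier H" "set (us @ (c, b) # vs) \<subseteq> tensors r" and c: "c \<in> fib A \<one>\<^bsub>G\<^esub>"
    and IH: "\<And>m. m \<in> fib B \<one> \<Longrightarrow> E.pos (gram \<one> (map (right_act m) (us @ vs)) (map (right_act m) (us @ vs)))"
  shows "E.pos (gram \<one> (us @ (c, b) # vs) (us @ (c, b) # vs))"
proof -
  let ?xs = "us @ (c, b) # vs"
  define y where "y = gram \<one> ?xs ?xs"
  have y: "y \<in> fib B \<one>" "bstar B y = y"
    unfolding y_def using gram_fib_one[OF r(1,2,2)] gram_star[OF r r] r(1) by simp_all
  obtain n p where n: "n \<in> fib B \<one>" "bstar B n = n" and p: "p \<in> fib B \<one>" "bstar B p = p"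
    and nyn: "n \<cdot>\<^bsub>B\<^esub> (y \<cdot>\<^bsub>B\<^esub> n) = (-1) \<odot>\<^bsub>B\<^esub> ((n \<cdot>\<^bsub>B\<^esub> p) \<cdot>\<^bsub>B\<^esub> (p \<cdot>\<^bsub>B\<^esub> n))"
    and nn: "n \<cdot>\<^bsub>B\<^esub> n = 2 \<odot>\<^bsub>B\<^esub> (p \<cdot>\<^bsub>B\<^esub> (p \<cdot>\<^bsub>B\<^esub> n))"
    and n0: "n = bzero B \<one> \<Longrightarrow> E.pos y"
    using E.negative_part[OF y] by metis
  have ri: "inv r \<in> carrier H" using r by simp
  have "(c, b) \<in> tensors r" using r by simp
  then obtain g where "g \<in> carrier G" "c \<in> fib A g" "b \<in> fib B (inv (\<phi> g) \<otimes> r)" by (auto simp: tensors_def)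
  \<comment> \<open>Fibres are disjoint, so c in the unit fibre means that b carries the whole
    degree r.\<close>
  then have b: "b \<in> fib B r"
    using A.fib_disjoint[OF _ A.one_closed _ c] r by (force simp: phi_one)
  have bs: "bstar B b \<in> fib B (inv r)" by (rule fib_star[OF r(1) b refl])
  have tt: "b \<in> tot" "n \<in> tot" "p \<in> tot" "y \<in> tot"
    using fib_tot[OF r(1) b] fib_tot[OF one_closed] n p y by simp_all
  \<comment> \<open>The factor m has degree inverse to r, so it moves the list into the unit degree;
    w is chosen so that compressing y by m gives -w^* w.\<close>
  let ?m = "n \<cdot>\<^bsub>B\<^esub> bstar B b" and ?w = "p \<cdot>\<^bsub>B\<^esub> (n \<cdot>\<^bsub>B\<^esub> bstar B b)"
  have m: "?m \<in> fib B (inv r)" by (rule fib_mul[OF one_closed ri n(1) bs]) (use ri in simp)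
  have w: "?w \<in> fib B (inv r)" by (rule fib_mul[OF one_closed ri p(1) m]) (use ri in simp)
  have "set (map (right_act ?m) ?xs) \<subseteq> tensors (r \<otimes> inv r)"
    using right_act_tensors[OF r(1) _ ri m] r(2) by auto
  then have "E.pos (gram \<one> (map (right_act ?m) ?xs) (map (right_act ?m) ?xs))"
    using r(1) by (intro pos_gram_unit_degree) simp
  also have "gram \<one> (map (right_act ?m) ?xs) (map (right_act ?m) ?xs) = bstar B ?m \<cdot>\<^bsub>B\<^esub> (y \<cdot>\<^bsub>B\<^esub> ?m)"
    unfolding y_def by (rule gram_right_act[OF r ri m])
  also have "\<dots> = b \<cdot>\<^bsub>B\<^esub> ((n \<cdot>\<^bsub>B\<^esub> (y \<cdot>\<^bsub>B\<^esub> n)) \<cdot>\<^bsub>B\<^esub> bstar B b)"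
    using tt n(2) by (simp add: bstar_bmul bmul_assoc)
  also have "\<dots> = (-1) \<odot>\<^bsub>B\<^esub> (bstar B ?w \<cdot>\<^bsub>B\<^esub> ?w)"
    unfolding nyn using tt n(2) p(2) by (simp add: bstar_bmul bmul_assoc sm_bmul bmul_sm)
  finally have "bnorm B ?w = 0" using tt by (intro bnorm_eq_0_of_pos_neg) simp_all
  then have w0: "?w = bzero B (inv r)" using bnorm_eq_0[OF ri w] by simp
  \<comment> \<open>As n^2 = 2 p^2 n, the vanishing of w = p m gives n m = 0, and then m^* m = b n m
    = 0.\<close>
  have "n \<cdot>\<^bsub>B\<^esub> ?m = (n \<cdot>\<^bsub>B\<^esub> n) \<cdot>\<^bsub>B\<^esub> bstar B b" using tt by (simp add: bmul_assoc)
  also have "\<dots> = 2 \<odot>\<^bsub>B\<^esub> (p \<cdot>\<^bsub>B\<^esub> ?w)" unfolding nn using tt by (simp add: bmul_assoc sm_bmul)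
  also have "\<dots> = bzero B (inv r)"
    unfolding w0 using bmul_zero[OF one_closed ri p(1)] cvec.sm_zero_right[OF cvec_fib[OF ri]] ri by simp
  finally have nm: "n \<cdot>\<^bsub>B\<^esub> ?m = bzero B (inv r)" .
  have "bstar B ?m \<cdot>\<^bsub>B\<^esub> ?m = b \<cdot>\<^bsub>B\<^esub> (n \<cdot>\<^bsub>B\<^esub> ?m)" using tt n(2) by (simp add: bstar_bmul bmul_assoc)
  also have "\<dots> = bzero B \<one>" unfolding nm using bmul_zero[OF r(1) ri b] r(1) by simp
  finally have "(bnorm B ?m)\<^sup>2 = 0" using bnorm_cstar[of ?m] E.nrm_zero tt by simp
  then have "bnorm B (bstar B ?m) = 0" using tt by (subst bnorm_bstar) simp_all
  moreover have "bstar B ?m = b \<cdot>\<^bsub>B\<^esub> n" using tt n(2) by (simp add: bstar_bmul)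
  ultimately have bn: "bnorm B (snd (right_act n (c, b))) = 0" by (simp add: right_act_def)
  have sub: "set (map (right_act n) us @ right_act n (c, b) # map (right_act n) vs) \<subseteq> tensors r"
    using right_act_tensors[OF r(1) _ one_closed n(1)] r by auto
  have "n \<cdot>\<^bsub>B\<^esub> (y \<cdot>\<^bsub>B\<^esub> n) = gram \<one> (map (right_act n) ?xs) (map (right_act n) ?xs)"
    using gram_right_act[OF r one_closed n(1)] n(2) unfolding y_def by simp
  also have "\<dots> = gram \<one> (map (right_act n) (us @ vs)) (map (right_act n) (us @ vs))"
    using gram_drop[OF r(1) sub bn] by simp
  finally have "E.pos (n \<cdot>\<^bsub>B\<^esub> (y \<cdot>\<^bsub>B\<^esub> n))" using IH[OF n(1)] by simp
  then have "E.pos ((-1) \<odot>\<^bsub>B\<^esub> (bstar B (p \<cdot>\<^bsub>B\<^esub> n) \<cdot>\<^bsub>B\<^esub> (p \<cdot>\<^bsub>B\<^esub> n)))"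
    unfolding nyn using tt n(2) p(2) by (simp add: bstar_bmul)
  then have "bnorm B (p \<cdot>\<^bsub>B\<^esub> n) = 0" using tt by (intro bnorm_eq_0_of_pos_neg) simp_all
  then have "p \<cdot>\<^bsub>B\<^esub> n = bzero B \<one>" using p(1) n(1) by simp
  then have "n \<cdot>\<^bsub>B\<^esub> n = bzero B \<one>" using nn p by simp
  then have "n = bzero B \<one>" using E.nrm_square[OF n] n(1) by simp
  then show ?thesis using n0 unfolding y_def by simp
qed

section \<open>Left multiplication inside Gram sums\<close>

lemma tensor_ip_left_act_add:
  assumes "r \<in> carrier H" "p \<in> tensors r" "s \<in> carrier H" "q \<in> tensors s"
    and a: "g \<in> carrier G" "a \<in> fib A g" "a' \<in> fib A g"
  shows "tensor_ip p (left_act (a \<oplus>\<^bsub>A\<^esub> a') q) = tensor_ip p (left_act a q) \<oplus>\<^bsub>B\<^esub> tensor_ip p (left_act a' q)"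
proof -
  obtain k where k: "k \<in> carrier G" "fst p \<in> fib A k" "snd p \<in> fib B (inv (\<phi> k) \<otimes> r)"
    using assms by (auto simp: tensors_def)
  obtain l where l: "l \<in> carrier G" "fst q \<in> fib A l" "snd q \<in> fib B (inv (\<phi> l) \<otimes> s)"
    using assms by (auto simp: tensors_def)
  have c: "inv\<^bsub>G\<^esub> k \<in> carrier G" "g \<otimes>\<^bsub>G\<^esub> l \<in> carrier G" "inv\<^bsub>G\<^esub> k \<otimes>\<^bsub>G\<^esub> (g \<otimes>\<^bsub>G\<^esub> l) \<in> carrier G"
    "inv (\<phi> l) \<otimes> s \<in> carrier H" "inv (\<phi> k) \<otimes> r \<in> carrier H" "inv (inv (\<phi> k) \<otimes> r) \<in> carrier H"
    using a k l assms by simp_all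
  note ks = A.fib_star[OF k(1,2) refl]
  have al: "x \<cdot>\<^bsub>A\<^esub> fst q \<in> fib A (g \<otimes>\<^bsub>G\<^esub> l)" if "x \<in> fib A g" for x
    by (rule A.fib_mul[OF a(1) l(1) that l(2) refl])
  have kal: "bstar A (fst p) \<cdot>\<^bsub>A\<^esub> (x \<cdot>\<^bsub>A\<^esub> fst q) \<in> fib A (inv\<^bsub>G\<^esub> k \<otimes>\<^bsub>G\<^esub> (g \<otimes>\<^bsub>G\<^esub> l))" if "x \<in> fib A g" for x
    by (rule A.fib_mul[OF c(1,2) ks al[OF that] refl])
  let ?h = "\<phi> (inv\<^bsub>G\<^esub> k \<otimes>\<^bsub>G\<^esub> (g \<otimes>\<^bsub>G\<^esub> l))"
  have h: "?h \<in> carrier H" "?h \<otimes> (inv (\<phi> l) \<otimes> s) \<in> carrier H" using c by simp_all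
  have Tf: "T (bstar A (fst p) \<cdot>\<^bsub>A\<^esub> (x \<cdot>\<^bsub>A\<^esub> fst q)) \<in> fib B ?h" if "x \<in> fib A g" for x
    by (rule T_fib[OF c(3) kal[OF that] refl])
  have Tq: "T (bstar A (fst p) \<cdot>\<^bsub>A\<^esub> (x \<cdot>\<^bsub>A\<^esub> fst q)) \<cdot>\<^bsub>B\<^esub> snd q \<in> fib B (?h \<otimes> (inv (\<phi> l) \<otimes> s))"
    if "x \<in> fib A g" for x
    by (rule fib_mul[OF h(1) c(4) Tf[OF that] l(3) refl])
  show ?thesis
    unfolding tensor_ip_def left_act_def fst_conv snd_conv A.add_bmul[OF a(1) l(1) a(2,3) l(2)]
      A.bmul_add[OF c(2,1) al[OF a(2)] al[OF a(3)] ks] T_add[OF c(3) kal[OF a(2)] kal[OF a(3)]]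
      add_bmul[OF h(1) c(4) Tf[OF a(2)] Tf[OF a(3)] l(3)]
    by (rule bmul_add[OF h(2) c(6) Tq[OF a(2)] Tq[OF a(3)] fib_star[OF c(5) k(3) refl]])
qed

lemma tensor_ip_left_act_sm:
  assumes pq: "r \<in> carrier H" "p \<in> tensors r" "s \<in> carrier H" "q \<in> tensors s" and a: "g \<in> carrier G" "a \<in> fib A g"
  shows "tensor_ip p (left_act (c \<odot>\<^bsub>A\<^esub> a) q) = c \<odot>\<^bsub>B\<^esub> tensor_ip p (left_act a q)"
proof -
  have at: "a \<in> A.tot" using A.fib_tot[OF a] .
  have q': "left_act a q \<in> tensors (\<phi> g \<otimes> s)" by (rule left_act_tensors[OF pq(3,4) a])
  obtain k where k: "k \<in> carrier G" "bstar A (fst p) \<cdot>\<^bsub>A\<^esub> fst (left_act a q) \<in> fib A k"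
    using tensors_mul_fib[OF pq(2) q'] .
  note tt = tensors_tot[OF pq(1,2)] tensors_tot[OF pq(3,4)] tensors_T_tot[OF pq(2) q']
  have "bstar A (fst p) \<cdot>\<^bsub>A\<^esub> ((c \<odot>\<^bsub>A\<^esub> a) \<cdot>\<^bsub>A\<^esub> fst q) = c \<odot>\<^bsub>A\<^esub> (bstar A (fst p) \<cdot>\<^bsub>A\<^esub> (a \<cdot>\<^bsub>A\<^esub> fst q))"
    using tt at by (simp add: A.sm_bmul A.bmul_sm)
  then show ?thesis
    using tt T_sm[OF k, of c] by (simp add: tensor_ip_def left_act_def sm_bmul bmul_sm)
qed

lemma left_act_left_act: "r \<in> carrier H \<Longrightarrow> q \<in> tensors r \<Longrightarrow> a \<in> A.tot \<Longrightarrow> a' \<in> A.tot \<Longrightarrow> left_act (a \<cdot>\<^bsub>A\<^esub> a') q = left_act a (left_act a' q)"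
  using tensors_tot[of r q] by (simp add: left_act_def A.bmul_assoc)

text \<open>This is the sum of all b_i^* T(a_i^* x a_j) b_j. It is linear in x, its value at the
  unit is the Gram sum, and its value at d^* d is the Gram sum of the list multiplied by d; so a
  decomposition of the unit decomposes the Gram sum.\<close>

definition gram_act :: "('a \<times> 'b) list \<Rightarrow> 'a \<Rightarrow> 'b" where
  "gram_act xs x = gram \<one> xs (map (left_act x) xs)"

lemma left_act_tensors_one: "r \<in> carrier H \<Longrightarrow> p \<in> tensors r \<Longrightarrow> x \<in> fib A \<one>\<^bsub>G\<^esub> \<Longrightarrow> left_act x p \<in> tensors r"
  using left_act_tensors[of r p "\<one>\<^bsub>G\<^esub>" x] by (simp add: phi_one)

lemma gram_act_fib:
  assumes "r \<in> carrier H" "set xs \<subseteq> tensors r" "x \<in> fib A \<one>\<^bsub>G\<^esub>" shows "gram_act xs x \<in> fib B \<one>"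
  unfolding gram_act_def by (rule gram_fib_one[OF assms(1,2)]) (use assms left_act_tensors_one in auto)

lemma gram_act_add:
  assumes r: "r \<in> carrier H" "set xs \<subseteq> tensors r" and x: "x \<in> fib A \<one>\<^bsub>G\<^esub>" "y \<in> fib A \<one>\<^bsub>G\<^esub>"
  shows "gram_act xs (x \<oplus>\<^bsub>A\<^esub> y) = gram_act xs x \<oplus>\<^bsub>B\<^esub> gram_act xs y"
  unfolding gram_act_def
proof (rule gram_add)
  fix p q assume "p \<in> set xs" "q \<in> set xs"
  then have pq: "p \<in> tensors r" "q \<in> tensors r" using r by auto
  show "tensor_ip p (left_act x q) \<in> fib B \<one>" "tensor_ip p (left_act y q) \<in> fib B \<one>"
    using tensor_ip_fib_one[OF r(1) pq(1)] left_act_tensors_one[OF r(1) pq(2)] x by auto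
  show "tensor_ip p (left_act (x \<oplus>\<^bsub>A\<^esub> y) q) = tensor_ip p (left_act x q) \<oplus>\<^bsub>B\<^esub> tensor_ip p (left_act y q)"
    by (rule tensor_ip_left_act_add[OF r(1) pq(1) r(1) pq(2) A.one_closed x])
qed simp

lemma gram_act_sm:
  assumes r: "r \<in> carrier H" "set xs \<subseteq> tensors r" and x: "x \<in> fib A \<one>\<^bsub>G\<^esub>"
  shows "gram_act xs (c \<odot>\<^bsub>A\<^esub> x) = c \<odot>\<^bsub>B\<^esub> gram_act xs x"
proof -
  have pq: "p \<in> tensors r" "left_act x q \<in> tensors r" if "p \<in> set xs" "q \<in> set xs" for p q
    using left_act_tensors_one[OF r(1) subsetD[OF r(2) that(2)] x] subsetD[OF r(2) that(1)] by simp_all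
  have "LS \<one> (\<lambda>q. tensor_ip p (left_act (c \<odot>\<^bsub>A\<^esub> x) q)) xs = c \<odot>\<^bsub>B\<^esub> LS \<one> (\<lambda>q. tensor_ip p (left_act x q)) xs"
    if p: "p \<in> set xs" for p
  proof -
    have "LS \<one> (\<lambda>q. tensor_ip p (left_act (c \<odot>\<^bsub>A\<^esub> x) q)) xs = LS \<one> (\<lambda>q. c \<odot>\<^bsub>B\<^esub> tensor_ip p (left_act x q)) xs"
    proof (rule E.lsum_cong)
      fix q assume q: "q \<in> set xs"
      show "tensor_ip p (left_act (c \<odot>\<^bsub>A\<^esub> x) q) = c \<odot>\<^bsub>B\<^esub> tensor_ip p (left_act x q)"
        by (rule tensor_ip_left_act_sm[OF r(1) subsetD[OF r(2) p] r(1) subsetD[OF r(2) q] A.one_closed x])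
    qed
    also have "\<dots> = c \<odot>\<^bsub>B\<^esub> LS \<one> (\<lambda>q. tensor_ip p (left_act x q)) xs"
      by (rule lsum_hom[where h = "bsm B c", OF E.cvec_axioms E.cvec_axioms, symmetric])
        (use tensor_ip_fib_one[OF r(1)] pq p in \<open>simp_all add: E.sm_add\<close>)
    finally show ?thesis .
  qed
  then have "LS \<one> (\<lambda>p. LS \<one> (\<lambda>q. tensor_ip p (left_act (c \<odot>\<^bsub>A\<^esub> x) q)) xs) xs =
      LS \<one> (\<lambda>p. c \<odot>\<^bsub>B\<^esub> LS \<one> (\<lambda>q. tensor_ip p (left_act x q)) xs) xs"
    by (rule E.lsum_cong)
  also have "\<dots> = c \<odot>\<^bsub>B\<^esub> LS \<one> (\<lambda>p. LS \<one> (\<lambda>q. tensor_ip p (left_act x q)) xs) xs"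
    by (rule lsum_hom[where h = "bsm B c", OF E.cvec_axioms E.cvec_axioms, symmetric])
      (use tensor_ip_fib_one[OF r(1)] pq in \<open>simp_all add: E.sm_add E.lsum_closed\<close>)
  finally show ?thesis by (simp add: gram_act_def gram_def E.lsum_map)
qed

lemma gram_act_unit:
  assumes r: "r \<in> carrier H" "set xs \<subseteq> tensors r"
  shows "gram_act xs v = gram \<one> xs xs"
proof -
  have "left_act v q = q" if "q \<in> set xs" for q
    using tensors_tot(1)[OF r(1), of q] r(2) that by (auto simp: left_act_def)
  then show ?thesis unfolding gram_act_def by (simp add: map_idI)
qed

lemma gram_act_star_mul:
  assumes r: "r \<in> carrier H" "set xs \<subseteq> tensors r" and d: "g \<in> carrier G" "d \<in> fib A g"
  shows "gram_act xs (bstar A d \<cdot>\<^bsub>A\<^esub> d) = gram \<one> (map (left_act d) xs) (map (left_act d) xs)"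
proof -
  have dt: "d \<in> A.tot" using A.fib_tot[OF d] .
  have "gram \<one> (map (\<lambda>p. p) xs) (map (left_act (bstar A d \<cdot>\<^bsub>A\<^esub> d)) xs) = gram \<one> (map (left_act d) xs) (map (left_act d) xs)"
  proof (rule gram_map_cong)
    fix p q assume "p \<in> set xs" "q \<in> set xs"
    then have pq: "p \<in> tensors r" "q \<in> tensors r" using r by auto
    have "tensor_ip (left_act d p) (left_act d q) = tensor_ip p (left_act (bstar A d) (left_act d q))"
      by (rule tensor_ip_left_act[OF r(1) pq(1) _ left_act_tensors[OF r(1) pq(2) d] dt]) (use r d in simp)
    then show "tensor_ip p (left_act (bstar A d \<cdot>\<^bsub>A\<^esub> d) q) = tensor_ip (left_act d p) (left_act d q)"
      using left_act_left_act[OF r(1) pq(2) _ dt, of "bstar A d"] dt by simp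
  qed simp
  then show ?thesis by (simp add: gram_act_def)
qed

lemma gram_act_lsum:
  assumes r: "r \<in> carrier H" "set xs \<subseteq> tensors r" and f: "\<And>i. i \<in> set is \<Longrightarrow> f i \<in> fib A \<one>\<^bsub>G\<^esub>"
  shows "gram_act xs (A.E.lsum f is) = LS \<one> (\<lambda>i. gram_act xs (f i)) is"
  by (rule lsum_hom[where h = "gram_act xs", OF A.E.cvec_axioms E.cvec_axioms]; (rule gram_act_fib[OF r] gram_act_add[OF r] f; assumption))

text \<open>The argument of \<open>T\<close> is (w a)^* (w a') for the first components a and a',
  with norm at most ||w a|| ||w a'||, which is at most e by the inequality between arithmetic and
  geometric mean. The map \<open>T\<close> is bounded on the fibre in question.\<close>

lemma tensor_ip_decay:
  assumes r: "r \<in> carrier H" "p \<in> tensors r" "q \<in> tensors r"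
    and w: "\<And>n::nat. w n \<in> fib A \<one>\<^bsub>G\<^esub>" "\<And>n. bstar A (w n) = w n"
    and small: "\<And>n. (bnorm A (w n \<cdot>\<^bsub>A\<^esub> fst p))\<^sup>2 \<le> e n" "\<And>n. (bnorm A (w n \<cdot>\<^bsub>A\<^esub> fst q))\<^sup>2 \<le> e n"
  shows "\<exists>K. \<forall>n. bnorm B (tensor_ip p (left_act (w n \<cdot>\<^bsub>A\<^esub> w n) q)) \<le> K * e n"
proof -
  obtain k where k: "k \<in> carrier G" "fst p \<in> fib A k" using r by (auto simp: tensors_def)
  obtain l where l: "l \<in> carrier G" "fst q \<in> fib A l" using r by (auto simp: tensors_def)
  have c: "inv\<^bsub>G\<^esub> k \<in> carrier G" "inv\<^bsub>G\<^esub> k \<otimes>\<^bsub>G\<^esub> l \<in> carrier G" using k l by simp_all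
  obtain C where C: "0 \<le> C" "\<And>a. a \<in> fib A (inv\<^bsub>G\<^esub> k \<otimes>\<^bsub>G\<^esub> l) \<Longrightarrow> bnorm B (T a) \<le> C * bnorm A a"
    using T_bound[OF c(2)] by blast
  note tt = tensors_tot[OF r(1,2)] tensors_tot[OF r(1,3)]
  have bound: "bnorm B (tensor_ip p (left_act (w n \<cdot>\<^bsub>A\<^esub> w n) q)) \<le> (bnorm B (snd p) * C * bnorm B (snd q)) * e n" for n
  proof -
    have wt: "w n \<in> A.tot" using A.fib_tot[OF A.one_closed w(1)] .
    have wp: "w n \<cdot>\<^bsub>A\<^esub> fst p \<in> fib A k" by (rule A.fib_mul[OF _ k(1) w(1) k(2)]) (use k in simp_all)
    have wq: "w n \<cdot>\<^bsub>A\<^esub> fst q \<in> fib A l" by (rule A.fib_mul[OF _ l(1) w(1) l(2)]) (use l in simp_all)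
    let ?a = "w n \<cdot>\<^bsub>A\<^esub> fst p" and ?b = "w n \<cdot>\<^bsub>A\<^esub> fst q"
    have pD: "left_act (w n) p \<in> tensors r" "left_act (w n) q \<in> tensors r" using left_act_tensors_one[OF r(1) _ w(1)] r by simp_all
    have "tensor_ip p (left_act (w n \<cdot>\<^bsub>A\<^esub> w n) q) = tensor_ip (left_act (w n) p) (left_act (w n) q)"
      using tensor_ip_left_act[OF r(1,2) r(1) pD(2) wt] left_act_left_act[OF r(1,3) wt wt] w(2) by simp
    also have "\<dots> = bstar B (snd p) \<cdot>\<^bsub>B\<^esub> (T (bstar A ?a \<cdot>\<^bsub>A\<^esub> ?b) \<cdot>\<^bsub>B\<^esub> snd q)"
      by (simp add: tensor_ip_def left_act_def)
    finally have e: "tensor_ip p (left_act (w n \<cdot>\<^bsub>A\<^esub> w n) q) = bstar B (snd p) \<cdot>\<^bsub>B\<^esub> (T (bstar A ?a \<cdot>\<^bsub>A\<^esub> ?b) \<cdot>\<^bsub>B\<^esub> snd q)" .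
    have ab: "bstar A ?a \<cdot>\<^bsub>A\<^esub> ?b \<in> fib A (inv\<^bsub>G\<^esub> k \<otimes>\<^bsub>G\<^esub> l)"
      by (rule A.fib_mul[OF c(1) l(1) A.fib_star[OF k(1) wp refl] wq refl])
    have Tt: "T (bstar A ?a \<cdot>\<^bsub>A\<^esub> ?b) \<in> tot" using fib_tot[OF _ T_fib[OF c(2) ab refl]] c by simp
    have abt: "?a \<in> A.tot" "?b \<in> A.tot" using tt wt by simp_all
    have n0: "0 \<le> bnorm A ?a" "0 \<le> bnorm A ?b" "0 \<le> bnorm B (snd p)" "0 \<le> bnorm B (snd q)"
      using tt abt by (simp_all add: tot_norm_ge_0 A.tot_norm_ge_0)
    have "bnorm A ?a * bnorm A ?b \<le> ((bnorm A ?a)\<^sup>2 + (bnorm A ?b)\<^sup>2) / 2"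
      using sum_squares_bound[of "bnorm A ?a" "bnorm A ?b"] by simp
    also have "\<dots> \<le> e n" using small[of n] by simp
    finally have nn: "bnorm A ?a * bnorm A ?b \<le> e n" .
    have "bnorm B (T (bstar A ?a \<cdot>\<^bsub>A\<^esub> ?b)) \<le> C * bnorm A (bstar A ?a \<cdot>\<^bsub>A\<^esub> ?b)" by (rule C(2)[OF ab])
    also have "\<dots> \<le> C * (bnorm A ?a * bnorm A ?b)"
      using A.bnorm_bmul[of "bstar A ?a" ?b] abt C(1) by (intro mult_left_mono) (simp_all add: A.bnorm_bstar)
    also have "\<dots> \<le> C * e n" by (rule mult_left_mono[OF nn C(1)])
    finally have Tb: "bnorm B (T (bstar A ?a \<cdot>\<^bsub>A\<^esub> ?b)) \<le> C * e n" .
    have "bnorm B (tensor_ip p (left_act (w n \<cdot>\<^bsub>A\<^esub> w n) q)) \<le> bnorm B (snd p) * (bnorm B (T (bstar A ?a \<cdot>\<^bsub>A\<^esub> ?b) \<cdot>\<^bsub>B\<^esub> snd q))"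
      unfolding e using bnorm_bmul[of "bstar B (snd p)"] tt Tt by (simp add: bnorm_bstar)
    also have "\<dots> \<le> bnorm B (snd p) * (C * e n * bnorm B (snd q))"
    proof (intro mult_left_mono n0)
      have "bnorm B (T (bstar A ?a \<cdot>\<^bsub>A\<^esub> ?b) \<cdot>\<^bsub>B\<^esub> snd q) \<le> bnorm B (T (bstar A ?a \<cdot>\<^bsub>A\<^esub> ?b)) * bnorm B (snd q)"
        by (rule bnorm_bmul[OF Tt tt(4)])
      also have "\<dots> \<le> C * e n * bnorm B (snd q)" by (rule mult_right_mono[OF Tb n0(4)])
      finally show "bnorm B (T (bstar A ?a \<cdot>\<^bsub>A\<^esub> ?b) \<cdot>\<^bsub>B\<^esub> snd q) \<le> C * e n * bnorm B (snd q)" .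
    qed
    finally show ?thesis by (simp add: mult_ac)
  qed
  then show ?thesis by blast
qed

text \<open>The elements \<open>x\<^sup>* a a\<^sup>* x\<close>, where \<open>a\<close> is the first component of a member of the list, have
  nonnegative image under \<open>gram_act\<close> by the previous reduction. The unit is approximated by sums of
  such elements, up to \<open>w\<^sup>2\<close> with \<open>w a\<close> small for all these \<open>a\<close>.\<close>

lemma pos_gram:
  assumes "r \<in> carrier H" "set xs \<subseteq> tensors r"
  shows "E.pos (gram \<one> xs xs)"
  using assms
proof (induction "length xs" arbitrary: xs r rule: less_induct)
  case less
  note r = less.prems
  let ?s = "\<lambda>p. fst p \<cdot>\<^bsub>A\<^esub> bstar A (fst p)"
  have Dx: "p \<in> tensors r" "fst p \<in> A.tot" if "p \<in> set xs" for p
    using that r tensors_tot(1)[OF r(1), of p] by auto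
  have spos: "A.E.pos (?s p)" if "p \<in> set xs" for p
    using A.pos_cstar[of "bstar A (fst p)"] Dx(2)[OF that] by simp
  have key: "E.pos (gram_act xs (bstar A x \<cdot>\<^bsub>A\<^esub> (?s p \<cdot>\<^bsub>A\<^esub> x)))" if p: "p \<in> set xs" and x: "x \<in> fib A \<one>\<^bsub>G\<^esub>" for p x
  proof -
    obtain us b c vs where s: "p = (c, b)" "xs = us @ (c, b) # vs" using p by (metis split_list surj_pair)
    obtain g where g: "g \<in> carrier G" "c \<in> fib A g" using Dx(1)[OF p] s by (auto simp: tensors_def)
    have gi: "inv\<^bsub>G\<^esub> g \<in> carrier G" using g by simp
    have ct: "c \<in> A.tot" "x \<in> A.tot" using A.fib_tot[OF g] A.fib_tot[OF A.one_closed x] by simp_all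
    \<comment> \<open>Left multiplication by c^* x turns the component c into c^* x c, which lies in
      the unit fibre, as \<open>pos_gram_step\<close> demands.\<close>
    let ?d = "bstar A c \<cdot>\<^bsub>A\<^esub> x"
    have d: "?d \<in> fib A (inv\<^bsub>G\<^esub> g)" by (rule A.fib_mul[OF gi A.one_closed A.fib_star[OF g refl] x]) (use gi in simp)
    have dc: "?d \<cdot>\<^bsub>A\<^esub> c \<in> fib A \<one>\<^bsub>G\<^esub>" by (rule A.fib_mul[OF gi g(1) d g(2)]) (use g in simp)
    have r': "\<phi> (inv\<^bsub>G\<^esub> g) \<otimes> r \<in> carrier H" using gi r by simp
    have sub: "left_act ?d ` set xs \<subseteq> tensors (\<phi> (inv\<^bsub>G\<^esub> g) \<otimes> r)" using left_act_tensors[OF r(1) _ gi d] r(2) by auto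
    have "E.pos (gram \<one> (map (left_act ?d) us @ (?d \<cdot>\<^bsub>A\<^esub> c, b) # map (left_act ?d) vs) (map (left_act ?d) us @ (?d \<cdot>\<^bsub>A\<^esub> c, b) # map (left_act ?d) vs))"
    proof (rule pos_gram_step[OF r' _ dc])
      show "set (map (left_act ?d) us @ (?d \<cdot>\<^bsub>A\<^esub> c, b) # map (left_act ?d) vs) \<subseteq> tensors (\<phi> (inv\<^bsub>G\<^esub> g) \<otimes> r)"
        using sub s by (auto simp: left_act_def)
      fix m assume m: "m \<in> fib B \<one>"
      show "E.pos (gram \<one> (map (right_act m) (map (left_act ?d) us @ map (left_act ?d) vs)) (map (right_act m) (map (left_act ?d) us @ map (left_act ?d) vs)))"
      \<comment> \<open>The remaining list is shorter, but its degree has been shifted by the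
        inverse of \<phi>(g); this is why the induction ranges over all degrees.\<close>
      proof (rule less.hyps[of _ "\<phi> (inv\<^bsub>G\<^esub> g) \<otimes> r"])
        show "set (map (right_act m) (map (left_act ?d) us @ map (left_act ?d) vs)) \<subseteq> tensors (\<phi> (inv\<^bsub>G\<^esub> g) \<otimes> r)"
        proof -
          have "right_act m p' \<in> tensors (\<phi> (inv\<^bsub>G\<^esub> g) \<otimes> r)" if "p' \<in> left_act ?d ` set xs" for p'
            using right_act_tensors[OF r' subsetD[OF sub that] one_closed m] r' by simp
          moreover have "set (map (right_act m) (map (left_act ?d) us @ map (left_act ?d) vs)) \<subseteq> right_act m ` left_act ?d ` set xs"
            using s(2) by auto
          ultimately show ?thesis by blast
        qed
      qed (use s r' in simp_all)
    qed
    also have "map (left_act ?d) us @ (?d \<cdot>\<^bsub>A\<^esub> c, b) # map (left_act ?d) vs = map (left_act ?d) xs"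
      using s by (simp add: left_act_def)
    also have "gram \<one> (map (left_act ?d) xs) (map (left_act ?d) xs) = gram_act xs (bstar A ?d \<cdot>\<^bsub>A\<^esub> ?d)"
      by (rule gram_act_star_mul[OF r gi d, symmetric])
    also have "bstar A ?d \<cdot>\<^bsub>A\<^esub> ?d = bstar A x \<cdot>\<^bsub>A\<^esub> (?s p \<cdot>\<^bsub>A\<^esub> x)"
      using ct s by (simp add: A.bstar_bmul A.bmul_assoc)
    finally show ?thesis .
  qed
  define q0 where "q0 = A.E.lsum ?s xs"
  have q0: "A.E.pos q0" unfolding q0_def by (rule A.E.pos_lsum) (rule spos)
  have key0: "E.pos (gram_act xs (x \<cdot>\<^bsub>A\<^esub> (q0 \<cdot>\<^bsub>A\<^esub> x)))" if x: "x \<in> fib A \<one>\<^bsub>G\<^esub>" "bstar A x = x" for x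
  proof -
    have "x \<cdot>\<^bsub>A\<^esub> (q0 \<cdot>\<^bsub>A\<^esub> x) = A.E.lsum (\<lambda>p. x \<cdot>\<^bsub>A\<^esub> (?s p \<cdot>\<^bsub>A\<^esub> x)) xs"
      unfolding q0_def
      by (rule lsum_hom[where h = "\<lambda>y. x \<cdot>\<^bsub>A\<^esub> (y \<cdot>\<^bsub>A\<^esub> x)", OF A.E.cvec_axioms A.E.cvec_axioms])
        (use x A.E.pos_closed[OF spos] in \<open>simp_all add: A.E.add_mul A.E.mul_add\<close>)
    then have "gram_act xs (x \<cdot>\<^bsub>A\<^esub> (q0 \<cdot>\<^bsub>A\<^esub> x)) = LS \<one> (\<lambda>p. gram_act xs (x \<cdot>\<^bsub>A\<^esub> (?s p \<cdot>\<^bsub>A\<^esub> x))) xs"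
      using gram_act_lsum[OF r, of xs "\<lambda>p. x \<cdot>\<^bsub>A\<^esub> (?s p \<cdot>\<^bsub>A\<^esub> x)"] x A.E.pos_closed[OF spos] by simp
    also have "E.pos \<dots>" by (rule E.pos_lsum) (use key[OF _ x(1)] x(2) in simp)
    finally show ?thesis .
  qed
  \<comment> \<open>Dividing by the norm plus 1 makes \<open>q1\<close> a contraction, also when
    \<open>q0\<close> is zero.\<close>
  define \<tau> where "\<tau> = bnorm A q0 + 1"
  have \<tau>: "0 < \<tau>" using A.E.nrm_ge_0[OF A.E.pos_closed[OF q0]] by (simp add: \<tau>_def)
  define q1 where "q1 = complex_of_real (1 / \<tau>) \<odot>\<^bsub>A\<^esub> q0"
  have q1: "A.E.pos q1" unfolding q1_def using q0 \<tau> by (intro A.E.pos_sm) auto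
  have q1n: "bnorm A q1 \<le> 1" using q0 \<tau> by (simp add: q1_def norm_divide) (simp add: \<tau>_def)
  have q0q1: "q0 = complex_of_real \<tau> \<odot>\<^bsub>A\<^esub> q1" using \<tau> q0 by (simp add: q1_def A.E.sm_sm)
  obtain \<rho> P where \<rho>: "\<rho> \<in> fib A \<one>\<^bsub>G\<^esub>" "bstar A \<rho> = \<rho>"
    and P: "\<And>n. P n = A.E.lsum (\<lambda>m. A.E.pow \<rho> m \<cdot>\<^bsub>A\<^esub> (q1 \<cdot>\<^bsub>A\<^esub> A.E.pow \<rho> m)) [0..<n]"
      "\<And>n. P n = v \<oplus>\<^bsub>A\<^esub> (-1) \<odot>\<^bsub>A\<^esub> (A.E.pow \<rho> n \<cdot>\<^bsub>A\<^esub> A.E.pow \<rho> n)"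
    and small: "\<And>n. real n * bnorm A (A.E.pow \<rho> n \<cdot>\<^bsub>A\<^esub> (q1 \<cdot>\<^bsub>A\<^esub> A.E.pow \<rho> n)) \<le> 1"
    by (rule A.E.telescoping_root[OF q1 q1n], rule that)
  let ?w = "\<lambda>n. A.E.pow \<rho> n"
  have w: "?w n \<in> fib A \<one>\<^bsub>G\<^esub>" "bstar A (?w n) = ?w n" for n
    using A.E.pow_closed[OF \<rho>(1)] A.E.pow_star[OF \<rho>] by simp_all
  have Pfib: "P n \<in> fib A \<one>\<^bsub>G\<^esub>" for n unfolding P(2) using w A.unit_fib by simp
  have Ppos: "E.pos (gram_act xs (P n))" for n
  proof -
    have one: "E.pos (gram_act xs (?w m \<cdot>\<^bsub>A\<^esub> (q1 \<cdot>\<^bsub>A\<^esub> ?w m)))" for m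
    proof -
      have "?w m \<cdot>\<^bsub>A\<^esub> (q1 \<cdot>\<^bsub>A\<^esub> ?w m) = complex_of_real (1 / \<tau>) \<odot>\<^bsub>A\<^esub> (?w m \<cdot>\<^bsub>A\<^esub> (q0 \<cdot>\<^bsub>A\<^esub> ?w m))"
        unfolding q1_def using w(1) q0 by (simp add: A.E.sm_mul A.E.mul_sm)
      then have "gram_act xs (?w m \<cdot>\<^bsub>A\<^esub> (q1 \<cdot>\<^bsub>A\<^esub> ?w m)) = complex_of_real (1 / \<tau>) \<odot>\<^bsub>B\<^esub> gram_act xs (?w m \<cdot>\<^bsub>A\<^esub> (q0 \<cdot>\<^bsub>A\<^esub> ?w m))"
        using gram_act_sm[OF r, of "?w m \<cdot>\<^bsub>A\<^esub> (q0 \<cdot>\<^bsub>A\<^esub> ?w m)"] w(1) q0 by simp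
      then show ?thesis using E.pos_sm[OF key0[OF w], of "1 / \<tau>"] \<tau> by simp
    qed
    have "gram_act xs (P n) = LS \<one> (\<lambda>m. gram_act xs (?w m \<cdot>\<^bsub>A\<^esub> (q1 \<cdot>\<^bsub>A\<^esub> ?w m))) [0..<n]"
      unfolding P(1) by (rule gram_act_lsum[OF r]) (use w q1 in simp)
    also have "E.pos \<dots>" by (rule E.pos_lsum) (rule one)
    finally show ?thesis .
  qed
  \<comment> \<open>The index is shifted by one, because the bound of
    \<open>telescoping_root\<close> is void for the power 0.\<close>
  let ?e = "\<lambda>n. \<tau> * (1 / (real n + 1))"
  \<comment> \<open>The squared norm of w a is the norm of w a a^* w. This is at most the norm of w
    q0 w, since a a^* is one of the positive summands of \<open>q0\<close>, and
    \<open>telescoping_root\<close> bounds the latter.\<close>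
  have wa: "(bnorm A (?w (Suc n) \<cdot>\<^bsub>A\<^esub> fst p))\<^sup>2 \<le> ?e n" if p: "p \<in> set xs" for n p
  proof -
    let ?x = "?w (Suc n)"
    have xt: "?x \<in> A.tot" using A.fib_tot[OF A.one_closed w(1)] .
    have pt: "fst p \<in> A.tot" by (rule Dx(2)[OF p])
    have "(bnorm A (?x \<cdot>\<^bsub>A\<^esub> fst p))\<^sup>2 = (bnorm A (bstar A (?x \<cdot>\<^bsub>A\<^esub> fst p)))\<^sup>2"
      using xt pt by (simp only: A.bnorm_bstar A.tot_mul)
    also have "\<dots> = bnorm A (bstar A (bstar A (?x \<cdot>\<^bsub>A\<^esub> fst p)) \<cdot>\<^bsub>A\<^esub> bstar A (?x \<cdot>\<^bsub>A\<^esub> fst p))"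
      by (rule A.bnorm_cstar[symmetric]) (simp only: xt pt A.tot_mul A.tot_star)
    also have "bstar A (bstar A (?x \<cdot>\<^bsub>A\<^esub> fst p)) \<cdot>\<^bsub>A\<^esub> bstar A (?x \<cdot>\<^bsub>A\<^esub> fst p) = ?x \<cdot>\<^bsub>A\<^esub> (?s p \<cdot>\<^bsub>A\<^esub> ?x)"
      using xt pt w(2)[of "Suc n"]
      by (simp only: A.bstar_bmul A.bstar_bstar A.bmul_assoc A.tot_mul A.tot_star)
    also have "bnorm A \<dots> \<le> bnorm A (?x \<cdot>\<^bsub>A\<^esub> (q0 \<cdot>\<^bsub>A\<^esub> ?x))"
    proof (rule A.E.nrm_mono)
      have sf: "?s p \<in> fib A \<one>\<^bsub>G\<^esub>" by (rule A.E.pos_closed[OF spos[OF p]])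
      show "A.E.pos (?x \<cdot>\<^bsub>A\<^esub> (?s p \<cdot>\<^bsub>A\<^esub> ?x))"
        using A.E.pos_conj[OF spos[OF p] w(1)] by (simp only: w(2))
      show "?x \<cdot>\<^bsub>A\<^esub> (q0 \<cdot>\<^bsub>A\<^esub> ?x) \<in> fib A \<one>\<^bsub>G\<^esub>" using w(1) q0 by (simp del: A.E.pow.simps)
      have "A.E.pos (q0 \<oplus>\<^bsub>A\<^esub> (-1) \<odot>\<^bsub>A\<^esub> ?s p)"
        unfolding q0_def by (rule A.E.pos_lsum_minus[OF p]) (rule spos)
      from A.E.pos_conj[OF this w(1)[of "Suc n"]]
      show "A.E.pos (?x \<cdot>\<^bsub>A\<^esub> (q0 \<cdot>\<^bsub>A\<^esub> ?x) \<oplus>\<^bsub>A\<^esub> (-1) \<odot>\<^bsub>A\<^esub> (?x \<cdot>\<^bsub>A\<^esub> (?s p \<cdot>\<^bsub>A\<^esub> ?x)))"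
        using w(1) A.E.pos_closed[OF q0] sf
        by (simp only: w(2) A.E.add_mul A.E.mul_add A.E.sm_mul A.E.mul_sm A.E.sm_closed A.E.mul_closed)
    qed
    also have "\<dots> = \<tau> * bnorm A (?x \<cdot>\<^bsub>A\<^esub> (q1 \<cdot>\<^bsub>A\<^esub> ?x))"
      unfolding q0q1 using w(1) q1 \<tau> by (simp del: A.E.pow.simps add: A.E.sm_mul A.E.mul_sm)
    also have "\<dots> \<le> ?e n"
      using small[of "Suc n"] \<tau> by (intro mult_left_mono) (simp_all del: A.E.pow.simps add: field_simps)
    finally show ?thesis .
  qed
  let ?R = "\<lambda>n. gram_act xs (?w (Suc n) \<cdot>\<^bsub>A\<^esub> ?w (Suc n))"
  have ww: "?w n \<cdot>\<^bsub>A\<^esub> ?w n \<in> fib A \<one>\<^bsub>G\<^esub>" for n using w(1) by (simp del: A.E.pow.simps)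
  have tf: "tensor_ip p (left_act (?w n \<cdot>\<^bsub>A\<^esub> ?w n) q) \<in> fib B \<one>" if "p \<in> set xs" "q \<in> set xs" for p q n
    by (rule tensor_ip_fib_one[OF r(1) Dx(1)[OF that(1)] left_act_tensors_one[OF r(1) Dx(1)[OF that(2)] ww]])
  have "\<exists>K. \<forall>n. bnorm B (?R n) \<le> K * ?e n"
    unfolding gram_act_def gram_def E.lsum_map
  proof (rule E.nrm_lsum_uniform)
    fix p assume p: "p \<in> set xs"
    show "LS \<one> (\<lambda>q. tensor_ip p (left_act (?w (Suc n) \<cdot>\<^bsub>A\<^esub> ?w (Suc n)) q)) xs \<in> fib B \<one>" for n
      by (rule E.lsum_closed) (rule tf[OF p])
    show "\<exists>K. \<forall>n. bnorm B (LS \<one> (\<lambda>q. tensor_ip p (left_act (?w (Suc n) \<cdot>\<^bsub>A\<^esub> ?w (Suc n)) q)) xs) \<le> K * ?e n"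
    proof (rule E.nrm_lsum_uniform)
      fix q assume q: "q \<in> set xs"
      show "tensor_ip p (left_act (?w (Suc n) \<cdot>\<^bsub>A\<^esub> ?w (Suc n)) q) \<in> fib B \<one>" for n by (rule tf[OF p q])
      show "\<exists>K. \<forall>n. bnorm B (tensor_ip p (left_act (?w (Suc n) \<cdot>\<^bsub>A\<^esub> ?w (Suc n)) q)) \<le> K * ?e n"
        by (rule tensor_ip_decay[OF r(1) Dx(1)[OF p] Dx(1)[OF q] w wa[OF p] wa[OF q]])
    qed
  qed
  then obtain K where K: "\<And>n. bnorm B (?R n) \<le> K * ?e n" by blast
  show ?case
  proof (rule E.pos_limit[OF gram_fib_one[OF r r(2)]])
    fix e :: real assume e: "e > 0"
    have "(\<lambda>n. K * ?e n) \<longlonglongrightarrow> 0"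
      by (intro tendsto_mult_right_zero LIMSEQ_one_over)
    then have "eventually (\<lambda>n. K * ?e n < e) sequentially" using e by (intro order_tendstoD) auto
    then obtain n where n: "K * ?e n < e" by (auto simp: eventually_sequentially)
    have f: "gram_act xs (P (Suc n)) \<in> fib B \<one>" "?R n \<in> fib B \<one>"
      by (rule gram_act_fib[OF r Pfib], rule gram_act_fib[OF r ww])
    have "v = P (Suc n) \<oplus>\<^bsub>A\<^esub> ?w (Suc n) \<cdot>\<^bsub>A\<^esub> ?w (Suc n)"
      unfolding P(2) by (intro A.E.vec_eqI) ((rule A.E.rp_rules | simp del: A.E.pow.simps add: A.unit_fib w(1))+)
    then have "gram \<one> xs xs = gram_act xs (P (Suc n)) \<oplus>\<^bsub>B\<^esub> ?R n"
      using gram_act_unit[OF r] gram_act_add[OF r Pfib ww] by metis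
    then have "gram_act xs (P (Suc n)) \<oplus>\<^bsub>B\<^esub> (-1) \<odot>\<^bsub>B\<^esub> gram \<one> xs xs = (-1) \<odot>\<^bsub>B\<^esub> ?R n"
      by (simp del: A.E.pow.simps, intro E.vec_eqI) ((rule E.rp_rules | simp del: A.E.pow.simps add: f)+)
    then have "bnorm B (gram_act xs (P (Suc n)) \<oplus>\<^bsub>B\<^esub> (-1) \<odot>\<^bsub>B\<^esub> gram \<one> xs xs) \<le> e"
      using K[of n] n f by (simp del: A.E.pow.simps)
    then show "\<exists>h. E.pos h \<and> bnorm B (h \<oplus>\<^bsub>B\<^esub> (-1) \<odot>\<^bsub>B\<^esub> gram \<one> xs xs) \<le> e" using Ppos by blast
  qed
qed

section \<open>The pre-Hilbert bundle of tensor lists and its action\<close>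

text \<open>The element ||a||^2 - a^* a equals c^* c with c in the unit fibre. Under
  \<open>gram_act\<close> it becomes both ||a||^2 times the Gram sum minus that of the list
  multiplied by a, and the Gram sum of the list multiplied by c, which is positive by
  \<open>pos_gram\<close>.\<close>

lemma bnorm_gram_left_act:
  assumes r: "r \<in> carrier H" "set xs \<subseteq> tensors r" and a: "g \<in> carrier G" "a \<in> fib A g"
  shows "bnorm B (gram \<one> (map (left_act a) xs) (map (left_act a) xs)) \<le> (bnorm A a)\<^sup>2 * bnorm B (gram \<one> xs xs)"
proof -
  have at: "a \<in> A.tot" using A.fib_tot[OF a] .
  let ?aa = "bstar A a \<cdot>\<^bsub>A\<^esub> a" and ?N = "complex_of_real ((bnorm A a)\<^sup>2)"
  have aa: "A.E.pos ?aa" "?aa \<in> fib A \<one>\<^bsub>G\<^esub>" using A.pos_cstar[OF at] by simp_all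
  have "A.E.pos (?N \<odot>\<^bsub>A\<^esub> v \<oplus>\<^bsub>A\<^esub> (-1) \<odot>\<^bsub>A\<^esub> ?aa)"
    by (rule A.E.pos_nrm_minus[OF aa(1)]) (simp add: A.bnorm_cstar[OF at])
  then obtain c where c: "c \<in> fib A \<one>\<^bsub>G\<^esub>" "?N \<odot>\<^bsub>A\<^esub> v \<oplus>\<^bsub>A\<^esub> (-1) \<odot>\<^bsub>A\<^esub> ?aa = bstar A c \<cdot>\<^bsub>A\<^esub> c"
    unfolding A.E.pos_iff by blast
  have "E.pos (gram \<one> (map (left_act c) xs) (map (left_act c) xs))"
    by (rule pos_gram[OF r(1)]) (use left_act_tensors_one[OF r(1) _ c(1)] r(2) in auto)
  also have "gram \<one> (map (left_act c) xs) (map (left_act c) xs) = gram_act xs (?N \<odot>\<^bsub>A\<^esub> v \<oplus>\<^bsub>A\<^esub> (-1) \<odot>\<^bsub>A\<^esub> ?aa)"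
    unfolding c(2) by (rule gram_act_star_mul[OF r A.one_closed c(1), symmetric])
  also have "\<dots> = ?N \<odot>\<^bsub>B\<^esub> gram \<one> xs xs \<oplus>\<^bsub>B\<^esub> (-1) \<odot>\<^bsub>B\<^esub> gram \<one> (map (left_act a) xs) (map (left_act a) xs)"
    using aa A.unit_fib
    by (simp add: gram_act_add[OF r] gram_act_sm[OF r] gram_act_unit[OF r] gram_act_star_mul[OF r a])
  finally have p: "E.pos (?N \<odot>\<^bsub>B\<^esub> gram \<one> xs xs \<oplus>\<^bsub>B\<^esub> (-1) \<odot>\<^bsub>B\<^esub> gram \<one> (map (left_act a) xs) (map (left_act a) xs))" .
  have "E.pos (gram \<one> (map (left_act a) xs) (map (left_act a) xs))"
    by (rule pos_gram[of "\<phi> g \<otimes> r"]) (use left_act_tensors[OF r(1) _ a] r a in auto)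
  from E.nrm_mono[OF this _ p] show ?thesis
    using gram_fib_one[OF r r(2)] by (simp add: norm_power norm_of_real)
qed

text \<open>Empty lists are excluded because they would belong to all degrees at once.\<close>

definition tensor_lists :: "'h \<Rightarrow> ('a \<times> 'b) list set" where
  "tensor_lists r = {xs. xs \<noteq> [] \<and> set xs \<subseteq> tensors r}"

definition ldeg :: "('a \<times> 'b) list \<Rightarrow> 'h" where
  "ldeg xs = (THE r. r \<in> carrier H \<and> xs \<in> tensor_lists r)"

text \<open>The inner product of \<open>pre_hilbert\<close> takes no degrees as arguments, so the
  degrees that fix the zero of the Gram sum are recovered from the lists.\<close>

definition tip :: "('a \<times> 'b) list \<Rightarrow> ('a \<times> 'b) list \<Rightarrow> 'b" where
  "tip xs ys = gram (inv (ldeg xs) \<otimes> ldeg ys) xs ys"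

definition tsm :: "complex \<Rightarrow> ('a \<times> 'b) list \<Rightarrow> ('a \<times> 'b) list" where
  "tsm c = map (\<lambda>p. (fst p, c \<odot>\<^bsub>B\<^esub> snd p))"

definition tzero :: "'h \<Rightarrow> ('a \<times> 'b) list" where
  "tzero r = [(v, bzero B r)]"

definition tmul :: "('a \<times> 'b) list \<Rightarrow> 'b \<Rightarrow> ('a \<times> 'b) list" where
  "tmul xs b = map (right_act b) xs"

definition tact :: "'a \<Rightarrow> ('a \<times> 'b) list \<Rightarrow> ('a \<times> 'b) list" where
  "tact a = map (left_act a)"

lemma tensor_lists_disjoint:
  assumes "r \<in> carrier H" "s \<in> carrier H" "xs \<in> tensor_lists r" "xs \<in> tensor_lists s"
  shows "r = s"
proof -
  obtain p where p: "p \<in> tensors r" "p \<in> tensors s" using assms by (cases xs) (auto simp: tensor_lists_def)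
  obtain g where g: "g \<in> carrier G" "fst p \<in> fib A g" "snd p \<in> fib B (inv (\<phi> g) \<otimes> r)"
    using p by (auto simp: tensors_def)
  obtain k where k: "k \<in> carrier G" "fst p \<in> fib A k" "snd p \<in> fib B (inv (\<phi> k) \<otimes> s)"
    using p by (auto simp: tensors_def)
  have "g = k" using A.fib_disjoint g k by blast
  then have "inv (\<phi> g) \<otimes> r = inv (\<phi> g) \<otimes> s"
    using fib_disjoint[OF _ _ g(3), of "inv (\<phi> g) \<otimes> s"] g k assms by simp
  then show ?thesis using g assms by simp
qed

lemma ldeg_eq: "r \<in> carrier H \<Longrightarrow> xs \<in> tensor_lists r \<Longrightarrow> ldeg xs = r"
  unfolding ldeg_def using tensor_lists_disjoint by blast

lemma tip_eq:
  "r \<in> carrier H \<Longrightarrow> s \<in> carrier H \<Longrightarrow> xs \<in> tensor_lists r \<Longrightarrow> ys \<in> tensor_lists s \<Longrightarrow> tip xs ys = gram (inv r \<otimes> s) xs ys"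
  by (simp add: tip_def ldeg_eq)

lemma tensor_lists_tensors: "xs \<in> tensor_lists r \<Longrightarrow> p \<in> set xs \<Longrightarrow> p \<in> tensors r"
  and tensor_lists_set: "xs \<in> tensor_lists r \<Longrightarrow> set xs \<subseteq> tensors r"
  by (auto simp: tensor_lists_def)

lemma tensor_lists_mapI: "xs \<in> tensor_lists r \<Longrightarrow> (\<And>p. p \<in> tensors r \<Longrightarrow> f p \<in> tensors s) \<Longrightarrow> map f xs \<in> tensor_lists s"
  unfolding tensor_lists_def by (simp add: image_subset_iff) (meson subsetD)

lemma scale_tensors: "r \<in> carrier H \<Longrightarrow> p \<in> tensors r \<Longrightarrow> (fst p, c \<odot>\<^bsub>B\<^esub> snd p) \<in> tensors r"
  by (force simp: tensors_def intro: fib_sm)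

lemma tzero_tl: "r \<in> carrier H \<Longrightarrow> tzero r \<in> tensor_lists r"
  using A.unit_fib by (auto simp: tensor_lists_def tzero_def tensors_def phi_one intro!: bexI[of _ "\<one>\<^bsub>G\<^esub>"])

lemma tact_tl: "r \<in> carrier H \<Longrightarrow> xs \<in> tensor_lists r \<Longrightarrow> g \<in> carrier G \<Longrightarrow> a \<in> fib A g \<Longrightarrow> tact a xs \<in> tensor_lists (\<phi> g \<otimes> r)"
  unfolding tact_def by (rule tensor_lists_mapI) (auto intro: left_act_tensors)

lemma tmul_tl: "r \<in> carrier H \<Longrightarrow> xs \<in> tensor_lists r \<Longrightarrow> s \<in> carrier H \<Longrightarrow> b \<in> fib B s \<Longrightarrow> tmul xs b \<in> tensor_lists (r \<otimes> s)"
  unfolding tmul_def by (rule tensor_lists_mapI) (auto intro: right_act_tensors)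

lemma tsm_tl: "r \<in> carrier H \<Longrightarrow> xs \<in> tensor_lists r \<Longrightarrow> tsm c xs \<in> tensor_lists r"
  unfolding tsm_def by (rule tensor_lists_mapI[OF _ scale_tensors])

lemma tappend_tl: "xs \<in> tensor_lists r \<Longrightarrow> ys \<in> tensor_lists r \<Longrightarrow> xs @ ys \<in> tensor_lists r"
  by (auto simp: tensor_lists_def)

lemma gram_append:
  assumes "r \<in> carrier H" "s \<in> carrier H" "xs \<in> tensor_lists r" "ys \<in> tensor_lists s" "zs \<in> tensor_lists s"
  shows "gram (inv r \<otimes> s) xs (ys @ zs) = gram (inv r \<otimes> s) xs ys \<oplus>\<^bsub>B\<^esub> gram (inv r \<otimes> s) xs zs"
proof -
  have k: "inv r \<otimes> s \<in> carrier H" using assms by simp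
  interpret V: cvec "fib B (inv r \<otimes> s)" "badd B" "bsm B" "bzero B (inv r \<otimes> s)" "bnorm B"
    by (rule cvec_fib[OF k])
  have f: "tensor_ip p q \<in> fib B (inv r \<otimes> s)" if "p \<in> set xs" "q \<in> set ys \<union> set zs" for p q
    by (rule tensor_ip_fib[OF assms(1) _ assms(2)]) (use assms that tensor_lists_tensors in blast)+
  have "gram (inv r \<otimes> s) xs (ys @ zs) =
      LS (inv r \<otimes> s) (\<lambda>p. LS (inv r \<otimes> s) (tensor_ip p) ys \<oplus>\<^bsub>B\<^esub> LS (inv r \<otimes> s) (tensor_ip p) zs) xs"
    unfolding gram_def by (rule V.lsum_cong, rule V.lsum_append) (rule f)
  also have "\<dots> = gram (inv r \<otimes> s) xs ys \<oplus>\<^bsub>B\<^esub> gram (inv r \<otimes> s) xs zs"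
    unfolding gram_def by (rule V.lsum_add; rule V.lsum_closed; rule f; simp)
  finally show ?thesis .
qed

lemma tensor_ip_scale:
  assumes "r \<in> carrier H" "p \<in> tensors r" "s \<in> carrier H" "q \<in> tensors s"
  shows "tensor_ip p (fst q, c \<odot>\<^bsub>B\<^esub> snd q) = c \<odot>\<^bsub>B\<^esub> tensor_ip p q"
  using tensors_tot[OF assms(1,2)] tensors_tot[OF assms(3,4)] tensors_T_tot[OF assms(2,4)] by (simp add: tensor_ip_def bmul_sm)

lemma gram_tzero:
  assumes "r \<in> carrier H" "s \<in> carrier H" "xs \<in> tensor_lists r"
  shows "gram (inv r \<otimes> s) xs (tzero s) = bzero B (inv r \<otimes> s)"
proof -
  have k: "inv r \<otimes> s \<in> carrier H" using assms by simp
  interpret V: cvec "fib B (inv r \<otimes> s)" "badd B" "bsm B" "bzero B (inv r \<otimes> s)" "bnorm B"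
    by (rule cvec_fib[OF k])
  let ?q = "(v, bzero B s)"
  have q: "?q \<in> tensors s" using tensor_lists_tensors[OF tzero_tl[OF assms(2)]] by (simp add: tzero_def)
  have "tensor_ip p ?q = bzero B (inv r \<otimes> s)" if "p \<in> set xs" for p
  proof -
    have p: "p \<in> tensors r" using tensor_lists_tensors[OF assms(3) that] .
    have "(fst ?q, 0 \<odot>\<^bsub>B\<^esub> snd ?q) = ?q" using sm_0_fib[OF assms(2) fib_zero[OF assms(2)]] by simp
    then have "tensor_ip p ?q = 0 \<odot>\<^bsub>B\<^esub> tensor_ip p ?q" using tensor_ip_scale[OF assms(1) p assms(2) q, of 0] by metis
    then show ?thesis using sm_0_fib[OF k tensor_ip_fib[OF assms(1) p assms(2) q]] by simp
  qed
  then show ?thesis unfolding gram_def tzero_def by (intro V.lsum_zero) simp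
qed

lemma gram_hom_right:
  assumes k: "k \<in> carrier H" "k' \<in> carrier H"
    and h: "\<And>x. x \<in> fib B k \<Longrightarrow> h x \<in> fib B k'"
      "\<And>x y. x \<in> fib B k \<Longrightarrow> y \<in> fib B k \<Longrightarrow> h (x \<oplus>\<^bsub>B\<^esub> y) = h x \<oplus>\<^bsub>B\<^esub> h y"
    and tm: "\<And>p q. p \<in> set xs \<Longrightarrow> q \<in> set ys \<Longrightarrow> tensor_ip p q \<in> fib B k"
      "\<And>p q. p \<in> set xs \<Longrightarrow> q \<in> set ys \<Longrightarrow> tensor_ip p (f q) = h (tensor_ip p q)"
  shows "gram k' xs (map f ys) = h (gram k xs ys)"
  using gram_hom[where f = "\<lambda>p. p" and f' = f and h = h, OF k h tm] by simp

sublocale pre_hilbert H B u tensor_lists "(@)" tsm tzero tmul tip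
proof
  fix r s assume r: "r \<in> carrier H" and s: "s \<in> carrier H"
  have k: "inv r \<otimes> s \<in> carrier H" using r s by simp
  fix xs assume xs: "xs \<in> tensor_lists r"
  show "\<And>y. y \<in> tensor_lists r \<Longrightarrow> xs @ y \<in> tensor_lists r" by (rule tappend_tl[OF xs])
  show "\<And>c. tsm c xs \<in> tensor_lists r" by (rule tsm_tl[OF r xs])
  show "\<And>b. b \<in> fib B s \<Longrightarrow> tmul xs b \<in> tensor_lists (r \<otimes> s)" by (rule tmul_tl[OF r xs s])
  show "xs \<in> tensor_lists s \<Longrightarrow> r = s" by (rule tensor_lists_disjoint[OF r s xs])
  show "tip xs (tzero s) = bzero B (inv r \<otimes> s)"
    by (simp add: tip_eq[OF r s xs tzero_tl[OF s]] gram_tzero[OF r s xs])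
  show "E.pos (tip xs xs)"
    using pos_gram[OF r tensor_lists_set[OF xs]] r by (simp add: tip_eq[OF r r xs xs])
  fix ys assume ys: "ys \<in> tensor_lists s"
  have f: "tensor_ip p q \<in> fib B (inv r \<otimes> s)" if "p \<in> set xs" "q \<in> set ys" for p q
    by (rule tensor_ip_fib[OF r tensor_lists_tensors[OF xs that(1)] s tensor_lists_tensors[OF ys that(2)]])
  show "tip xs ys \<in> fib B (inv r \<otimes> s)"
    unfolding tip_eq[OF r s xs ys] by (rule gram_fib[OF r tensor_lists_set[OF xs] s tensor_lists_set[OF ys]])
  show "\<And>zs. zs \<in> tensor_lists s \<Longrightarrow> tip xs (ys @ zs) = tip xs ys \<oplus>\<^bsub>B\<^esub> tip xs zs"
    by (simp add: tip_eq[OF r s xs] ys tappend_tl gram_append[OF r s xs])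
  show "tip xs (tsm c ys) = c \<odot>\<^bsub>B\<^esub> tip xs ys" for c
    unfolding tip_eq[OF r s xs ys] tip_eq[OF r s xs tsm_tl[OF s ys]]
    unfolding tsm_def
  proof (rule gram_hom_right[OF k k _ _ f])
    show "c \<odot>\<^bsub>B\<^esub> (x \<oplus>\<^bsub>B\<^esub> y) = c \<odot>\<^bsub>B\<^esub> x \<oplus>\<^bsub>B\<^esub> c \<odot>\<^bsub>B\<^esub> y"
      if "x \<in> fib B (inv r \<otimes> s)" "y \<in> fib B (inv r \<otimes> s)" for x y
      using cvec.sm_add[OF cvec_fib[OF k] that] .
    show "tensor_ip p (fst q, c \<odot>\<^bsub>B\<^esub> snd q) = c \<odot>\<^bsub>B\<^esub> tensor_ip p q" if "p \<in> set xs" "q \<in> set ys" for p q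
      by (rule tensor_ip_scale[OF r tensor_lists_tensors[OF xs that(1)] s tensor_lists_tensors[OF ys that(2)]])
  qed (use fib_sm[OF k] in auto)
  show "bstar B (tip xs ys) = tip ys xs"
    unfolding tip_eq[OF r s xs ys] tip_eq[OF s r ys xs]
    by (rule gram_star[OF r tensor_lists_set[OF xs] s tensor_lists_set[OF ys]])
  fix m b assume m: "m \<in> carrier H" "b \<in> fib B m"
  have km: "inv r \<otimes> (s \<otimes> m) \<in> carrier H" "inv r \<otimes> s \<otimes> m = inv r \<otimes> (s \<otimes> m)"
    using r s m by (simp_all add: m_assoc)
  show "tip xs (tmul ys b) = tip xs ys \<cdot>\<^bsub>B\<^esub> b"
    unfolding tip_eq[OF r s xs ys] tip_eq[OF r m_closed[OF s m(1)] xs tmul_tl[OF s ys m]]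
    unfolding tmul_def
  proof (rule gram_hom_right[where h = "\<lambda>x. x \<cdot>\<^bsub>B\<^esub> b", OF k km(1) _ _ f])
    show "x \<cdot>\<^bsub>B\<^esub> b \<in> fib B (inv r \<otimes> (s \<otimes> m))" if "x \<in> fib B (inv r \<otimes> s)" for x
      by (rule fib_mul[OF k m(1) that m(2) km(2)])
    show "(x \<oplus>\<^bsub>B\<^esub> y) \<cdot>\<^bsub>B\<^esub> b = x \<cdot>\<^bsub>B\<^esub> b \<oplus>\<^bsub>B\<^esub> y \<cdot>\<^bsub>B\<^esub> b"
      if "x \<in> fib B (inv r \<otimes> s)" "y \<in> fib B (inv r \<otimes> s)" for x y
      by (rule add_bmul[OF k m(1) that m(2)])
    show "tensor_ip p (right_act b q) = tensor_ip p q \<cdot>\<^bsub>B\<^esub> b" if "p \<in> set xs" "q \<in> set ys" for p q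
      by (rule tensor_ip_right_act(1)[OF r tensor_lists_tensors[OF xs that(1)] s tensor_lists_tensors[OF ys that(2)] fib_tot[OF m]])
  qed
qed (rule tzero_tl)

sublocale pre_action G A v H B u \<phi> tensor_lists "(@)" tsm tzero tmul tip tact
proof
  fix g r a xs assume g: "g \<in> carrier G" and r: "r \<in> carrier H" and a: "a \<in> fib A g" and xs: "xs \<in> tensor_lists r"
  have at: "a \<in> A.tot" using A.fib_tot[OF g a] .
  have gr: "\<phi> g \<otimes> r \<in> carrier H" using g r by simp
  note axs = tact_tl[OF r xs g a]
  show "tact a xs \<in> tensor_lists (\<phi> g \<otimes> r)" by (rule axs)
  have "bnorm B (tip (tact a xs) (tact a xs)) \<le> (bnorm A a)\<^sup>2 * bnorm B (tip xs xs)"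
    using bnorm_gram_left_act[OF r tensor_lists_set[OF xs] g a] gr r
    by (simp add: tip_eq[OF gr gr axs axs] tip_eq[OF r r xs xs]) (simp add: tact_def)
  then have "lnorm (tact a xs) \<le> sqrt ((bnorm A a)\<^sup>2 * bnorm B (tip xs xs))"
    unfolding lnorm_def by (rule real_sqrt_le_mono)
  then show "lnorm (tact a xs) \<le> bnorm A a * lnorm xs"
    using A.tot_norm_ge_0[OF at] by (simp add: lnorm_def real_sqrt_mult)
  fix s ys assume s: "s \<in> carrier H" and ys: "ys \<in> tensor_lists s"
  have gs: "inv (\<phi> g) \<otimes> s \<in> carrier H" using g s by simp
  have ays: "tact (bstar A a) ys \<in> tensor_lists (inv (\<phi> g) \<otimes> s)"
    using tact_tl[OF s ys _ A.fib_star[OF g a refl]] g by (simp add: phi_inv)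
  have k: "inv (\<phi> g \<otimes> r) \<otimes> s = inv r \<otimes> (inv (\<phi> g) \<otimes> s)" "inv r \<otimes> (inv (\<phi> g) \<otimes> s) \<in> carrier H"
    using g r s by (simp_all add: inv_mult_group m_assoc)
  have "gram (inv r \<otimes> (inv (\<phi> g) \<otimes> s)) (map (left_act a) xs) (map (\<lambda>q. q) ys) =
      gram (inv r \<otimes> (inv (\<phi> g) \<otimes> s)) (map (\<lambda>p. p) xs) (map (left_act (bstar A a)) ys)"
    by (rule gram_map_cong[OF k(2)], rule tensor_ip_left_act[OF r tensor_lists_tensors[OF xs] s tensor_lists_tensors[OF ys] at])
  then show "tip (tact a xs) ys = tip xs (tact (bstar A a) ys)"
    unfolding tip_eq[OF gr s axs ys] tip_eq[OF r gs xs ays] k(1) by (simp add: tact_def)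
  have ks: "inv s \<otimes> (\<phi> g \<otimes> r) \<in> carrier H" using g r s by simp
  have f: "tensor_ip p (left_act x q) \<in> fib B (inv s \<otimes> (\<phi> g \<otimes> r))" if "x \<in> fib A g" "p \<in> set ys" "q \<in> set xs" for x p q
    by (rule tensor_ip_fib[OF s tensor_lists_tensors[OF ys that(2)] gr left_act_tensors[OF r tensor_lists_tensors[OF xs that(3)] g that(1)]])
  show "tip ys (tact (a \<oplus>\<^bsub>A\<^esub> a') xs) = tip ys (tact a xs) \<oplus>\<^bsub>B\<^esub> tip ys (tact a' xs)" if a': "a' \<in> fib A g" for a'
    unfolding tip_eq[OF s gr ys axs] tip_eq[OF s gr ys tact_tl[OF r xs g a']]
      tip_eq[OF s gr ys tact_tl[OF r xs g A.fib_add[OF g a a']]]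
    unfolding tact_def
    by (rule gram_add[OF ks f[OF a] f[OF a']]; (assumption | rule tensor_ip_left_act_add[OF s tensor_lists_tensors[OF ys] r tensor_lists_tensors[OF xs] g a a'])+)
  show "tip ys (tact (c \<odot>\<^bsub>A\<^esub> a) xs) = c \<odot>\<^bsub>B\<^esub> tip ys (tact a xs)" for c
  proof -
    \<comment> \<open>Moving the scalar from the first to the second component changes the list but
      none of its inner products.\<close>
    have "gram (inv s \<otimes> (\<phi> g \<otimes> r)) (map (\<lambda>p. p) ys) (map (left_act (c \<odot>\<^bsub>A\<^esub> a)) xs) =
        gram (inv s \<otimes> (\<phi> g \<otimes> r)) (map (\<lambda>p. p) ys) (map (\<lambda>q. (fst (left_act a q), c \<odot>\<^bsub>B\<^esub> snd (left_act a q))) xs)"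
    proof (rule gram_map_cong[OF ks])
      fix p q assume "p \<in> set ys" "q \<in> set xs"
      then have pq: "p \<in> tensors s" "q \<in> tensors r" using tensor_lists_tensors xs ys by blast+
      show "tensor_ip p (left_act (c \<odot>\<^bsub>A\<^esub> a) q) = tensor_ip p (fst (left_act a q), c \<odot>\<^bsub>B\<^esub> snd (left_act a q))"
        using tensor_ip_left_act_sm[OF s pq(1) r pq(2) g a] tensor_ip_scale[OF s pq(1) gr left_act_tensors[OF r pq(2) g a]] by simp
    qed
    then have "tip ys (tact (c \<odot>\<^bsub>A\<^esub> a) xs) = tip ys (tsm c (tact a xs))"
      by (simp add: tip_eq[OF s gr ys] tact_tl[OF r xs g A.fib_sm[OF g a]] tsm_tl[OF gr axs])
        (simp add: tact_def tsm_def comp_def)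
    then show ?thesis using lip_lsm[OF s gr ys axs] by simp
  qed
  show "tip ys (tact (b \<cdot>\<^bsub>A\<^esub> a) xs) = tip ys (tact b (tact a xs))" if "h \<in> carrier G" "b \<in> fib A h" for b h
  proof -
    have "tact (b \<cdot>\<^bsub>A\<^esub> a) xs = tact b (tact a xs)"
      using left_act_left_act[OF r tensor_lists_tensors[OF xs] A.fib_tot[OF that] at] by (simp add: tact_def)
    then show ?thesis by simp
  qed
qed

text \<open>Since a acts on functionals through a^*, the value of a \<xi> at 1 \<otimes> 1 is <a^*
  (1 \<otimes> 1), 1 \<otimes> 1>, and this is the form in which \<open>T\<close> is
  recovered.\<close>

lemma vacuum:
  shows "[(v, u)] \<in> tensor_lists \<one>"
    and "g \<in> carrier G \<Longrightarrow> a \<in> fib A g \<Longrightarrow> tip (tact (bstar A a) [(v, u)]) [(v, u)] = T a"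
proof -
  show x: "[(v, u)] \<in> tensor_lists \<one>"
    using A.unit_fib unit_fib by (auto simp: tensor_lists_def tensors_def phi_one intro!: bexI[of _ "\<one>\<^bsub>G\<^esub>"])
  assume a: "g \<in> carrier G" "a \<in> fib A g"
  have tt: "v \<in> A.tot" "a \<in> A.tot" "u \<in> tot"
    using A.fib_tot[OF _ A.unit_fib] A.fib_tot[OF a] fib_tot[OF _ unit_fib] by simp_all
  have gi: "\<phi> (inv\<^bsub>G\<^esub> g) \<otimes> \<one> \<in> carrier H" "inv\<^bsub>G\<^esub> g \<in> carrier G" using a by simp_all
  have k: "inv (\<phi> (inv\<^bsub>G\<^esub> g) \<otimes> \<one>) \<otimes> \<one> = \<phi> g" using a by (simp add: phi_inv)
  have Tf: "T a \<in> fib B (\<phi> g)" by (rule T_fib[OF a refl])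
  have Tt: "T a \<in> tot" using fib_tot[OF _ Tf] a by simp
  have "tip (tact (bstar A a) [(v, u)]) [(v, u)] = gram (\<phi> g) [left_act (bstar A a) (v, u)] [(v, u)]"
    using tip_eq[OF gi(1) one_closed tact_tl[OF one_closed x gi(2) A.fib_star[OF a refl]] x] k
    by (simp add: tact_def)
  also have "\<dots> = tensor_ip (left_act (bstar A a) (v, u)) (v, u)"
    unfolding gram_def using cvec.add_zero[OF cvec_fib[of "\<phi> g"]] a Tf tt Tt
    by (simp add: cvec.lsum_simps[OF cvec_fib[of "\<phi> g"]] tensor_ip_def left_act_def A.bstar_bmul)
  also have "\<dots> = T a" using tt Tt by (simp add: tensor_ip_def left_act_def A.bstar_bmul)
  finally show "tip (tact (bstar A a) [(v, u)]) [(v, u)] = T a" .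
qed

end

section \<open>Realization of the given map\<close>

theorem theorem6p1:
  fixes G :: "'g monoid" and H :: "'h monoid" and \<phi> :: "'g \<Rightarrow> 'h"
    and A :: "('g, 'a) fbundle" and B :: "('h, 'b) fbundle" and T :: "'a \<Rightarrow> 'b"
  assumes "group G" and "group H"
    and "unital_fell_bundle G A" and "unital_fell_bundle H B"
    and "\<phi> \<in> hom G H"
    and "bundle_map G \<phi> A B T"
    and "positive_definite G H \<phi> A B T"
  shows "\<exists>(X :: ('h, 'h \<times> (nat \<Rightarrow> ('a \<times> 'b) list) set, 'b) hbundle) \<rho> \<xi>.
           hilbert_bundle H B X \<and> bundle_action G H \<phi> A B X \<rho> \<and>
           \<xi> \<in> hfib X \<one>\<^bsub>H\<^esub> \<and>
           (\<forall>g\<in>carrier G. \<forall>a\<in>fib A g. T a = ip X \<xi> (\<rho> a \<xi>))"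
proof -
  obtain v where v: "fell_bundle G A" "v \<in> fib A \<one>\<^bsub>G\<^esub>"
    "\<And>a. a \<in> fib A \<one>\<^bsub>G\<^esub> \<Longrightarrow> bmul A v a = a" "\<And>a. a \<in> fib A \<one>\<^bsub>G\<^esub> \<Longrightarrow> bmul A a v = a"
    using assms(3) unfolding unital_fell_bundle_def by blast
  obtain u where u: "fell_bundle H B" "u \<in> fib B \<one>\<^bsub>H\<^esub>"
    "\<And>a. a \<in> fib B \<one>\<^bsub>H\<^esub> \<Longrightarrow> bmul B u a = a" "\<And>a. a \<in> fib B \<one>\<^bsub>H\<^esub> \<Longrightarrow> bmul B a u = a"
    using assms(4) unfolding unital_fell_bundle_def by blast
  interpret pd_kernel G A v H B u \<phi> T
    using assms v u by (simp add: pd_kernel_def pd_kernel_axioms_def ufell_hom_def ufell_hom_axioms_def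
        ufell_def ufell_axioms_def)
  \<comment> \<open>A functional is coded by its graph to fit the carrier type: the pair of z and F
    z becomes the sequence with z at 0 and a one-element list holding F z at all other indices;
    \<open>undefined\<close> is a filler.\<close>
  define enc :: "(('a \<times> 'b) list \<Rightarrow> 'b) \<Rightarrow> (nat \<Rightarrow> ('a \<times> 'b) list) set" where
    "enc F = range (\<lambda>z i. if i = 0 then z else [(undefined, F z)])" for F
  have enc: "inj enc"
  proof (rule injI, rule ext)
    fix F F' :: "('a \<times> 'b) list \<Rightarrow> 'b" and z
    assume "enc F = enc F'"
    then have "(\<lambda>i. if i = 0 then z else [(undefined, F z)]) \<in> enc F'" unfolding enc_def by blast
    then obtain z' where "(\<lambda>i. if i = (0::nat) then z else [(undefined, F z)]) =
        (\<lambda>i. if i = 0 then z' else [(undefined, F' z')])"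
      unfolding enc_def by blast
    from fun_cong[OF this, of 0] fun_cong[OF this, of 1] show "F z = F' z" by simp
  qed
  let ?x = "[(v, u)]"
  let ?\<xi> = "(\<one>\<^bsub>H\<^esub>, enc (emb ?x))"
  have x: "?x \<in> tensor_lists \<one>\<^bsub>H\<^esub>" by (rule vacuum(1))
  note X = X_emb[OF one_closed x]
  have "T a = ip (completion enc) ?\<xi> (completion_act enc a ?\<xi>)" if a: "g \<in> carrier G" "a \<in> fib A g" for g a
  proof -
    have gr: "\<phi> g \<otimes>\<^bsub>H\<^esub> \<one>\<^bsub>H\<^esub> \<in> carrier H" using a by simp
    have "inv\<^bsub>H\<^esub> (\<phi> g) \<otimes>\<^bsub>H\<^esub> \<one>\<^bsub>H\<^esub> \<in> carrier H" using a by simp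
    from fun_apply(4)[OF this la_star_closed[OF a one_closed x]]
    \<comment> \<open>By \<open>fip_emb\<close> the inner product in question is the value of the
      functional a \<xi> at the list x; unfolding \<open>flact\<close> and \<open>emb\<close> turns
      it into <a^* x, x>.\<close>
    have "emb ?x (tact (bstar A a) ?x) = T a" using vacuum(2)[OF a] by simp
    then have "fip \<one>\<^bsub>H\<^esub> (\<phi> g \<otimes>\<^bsub>H\<^esub> \<one>\<^bsub>H\<^esub>) (emb ?x) (flact a (emb ?x)) = T a"
      using fip_emb[OF one_closed x X_flact[OF X one_closed a] gr] flact_apply[OF one_closed x] by simp
    then show ?thesis
      using A.deg_eq[OF a(2,1)] by (simp add: completion_act_simp[OF enc] completion_simps(6)[OF enc])
  qed
  moreover have "?\<xi> \<in> hfib (completion enc) \<one>\<^bsub>H\<^esub>" using X by (simp add: completion_simps(1)[OF enc])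
  ultimately show ?thesis
    using hilbert_bundle_completion[OF enc] bundle_action_completion[OF enc] by blast
qed

end
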